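(* Let $\Omega\subset\mathbb{R}^n$ be an $(\epsilon,\delta)$-domain and $f\in\mathrm{bmo}(\Omega)$. Then $f$ can be approximated in $\mathrm{bmo}(\Omega)$ by bounded Lipschitz functions supported away from $\partial\Omega$ (i.e. bounded Lipschitz functions $g$ on $\Omega$ with $\mathrm{dist}(\mathrm{supp}(g),\partial\Omega)>0$) if and only if $\lim_{t\to0^+}\omega_\Omega(f,t)=0$. In addition, the following are equivalent: (i) $f$ is in $\mathrm{cmo}(\Omega)$, the closure of $C_c(\Omega)$ in $\mathrm{bmo}(\Omega)$; (ii) $f$ is in the closure of $C_c^\infty(\Omega)$ in $\mathrm{bmo}(\Omega)$; (iii) $f$ vanishes at infinity and $\lim_{t\to0^+}\omega_\Omega(f,t)=0$.
   Context: A domain is a connected open set. Given $\epsilon\in(0,1]$ and $\delta>0$, a domain $\Omega\subset\mathbb{R}^n$ is an $(\epsilon,\delta)$-domain if every pair of points $x,y\in\Omega$ with $|x-y|<\delta$ may be joined by a rectifiable curve $\gamma$ lying in $\Omega$ with $\mathrm{arclength}(\gamma)\le \epsilon^{-1}|x-y|$ and such that $\mathrm{dist}(z,\partial\Omega)\ge \epsilon\frac{|z-x||z-y|}{|x-y|}$ for every point $z$ on $\gamma$. All cubes $Q$ have sides parallel to the axes; $\ell(Q)$ is the sidelength and $f_Q = \frac{1}{|Q|}\int_Q f$. For an open set $U\subset\mathbb{R}^n$, $\omega_U(f,t) := \sup_{Q \subset U,\ \ell(Q)<t} \frac{1}{|Q|}\int_Q |f-f_Q|$, and for $\lambda>0$,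 $\mathrm{bmo}_\lambda(U)$ is the set of functions $f$ integrable on every cube $Q\subset U$ with $$\|f\|_{\mathrm{bmo}_\lambda(U)} := \omega_U(f,\lambda) + \sup_{Q\subset U,\ \ell(Q)\ge\lambda} |f|_Q < \infty$$ (a supremum over an empty family is $0$). For an $(\epsilon,\delta)$-domain put $\lambda_{\epsilon,\delta} := \frac{\epsilon^2\delta}{320n(1+\sqrt{n}\,\epsilon)}$ and $\mathrm{bmo}(\Omega) := \mathrm{bmo}_{\lambda_{\epsilon,\delta}}(\Omega)$ with its norm (any $\lambda\le\lambda_{\epsilon,\delta}$ gives the same space with an equivalent norm). $C_c(\Omega)$ and $C_c^\infty(\Omega)$ are the continuous, respectively smooth, functions with compact support in $\Omega$. With $\lambda=\lambda_{\epsilon,\delta}$, $f\in\mathrm{bmo}(\Omega)$ vanishes at infinity if $\lim_{R\to\infty}\|f\|_{\mathrm{bmo}_\lambda(\Omega\setminus\overline{B(0,R)})}=0$. Convention: distance to or from the empty set is $+\infty$. *)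

theory Defs
  imports "HOL-Analysis.Analysis"
begin

text \<open>
  Functions on a set \<open>U\<close> are total functions whose values outside \<open>U\<close> play no role: every notion
  below looks only at the restriction to \<open>U\<close>.  Suprema, norms and distances take values in
  \<^typ>\<open>ennreal\<close>, where the supremum of the empty set is \<open>0\<close> and its infimum is \<open>\<infinity>\<close>.
\<close>

subsection \<open>\<open>(\<epsilon>,\<delta>)\<close>-domains\<close>

definition edist :: "'a::metric_space set \<Rightarrow> 'a set \<Rightarrow> ennreal" where
  "edist S T = (INF x\<in>S. INF y\<in>T. ennreal (dist x y))"

definition arclength :: "(real \<Rightarrow> 'a::metric_space) \<Rightarrow> ennreal" where
  "arclength \<gamma> = (SUP ts \<in> {ts. sorted ts \<and> set ts \<subseteq> {0..1}}.
     \<Sum>i<length ts - 1. ennreal (dist (\<gamma> (ts ! i)) (\<gamma> (ts ! Suc i))))"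

definition rectifiable_curve :: "(real \<Rightarrow> 'a::metric_space) \<Rightarrow> bool" where
  "rectifiable_curve \<gamma> \<longleftrightarrow> path \<gamma> \<and> arclength \<gamma> < \<infinity>"

definition domain :: "'a::topological_space set \<Rightarrow> bool" where
  "domain \<Omega> \<longleftrightarrow> open \<Omega> \<and> connected \<Omega>"

text \<open>For \<open>x = y\<close> the quotient is \<open>0\<close> and the constant curve satisfies the condition.\<close>

definition eps_delta_domain :: "real \<Rightarrow> real \<Rightarrow> (real ^ 'n) set \<Rightarrow> bool" where
  "eps_delta_domain \<epsilon> \<delta> \<Omega> \<longleftrightarrow> domain \<Omega> \<and>
     (\<forall>x\<in>\<Omega>. \<forall>y\<in>\<Omega>. norm (x - y) < \<delta> \<longrightarrow>
       (\<exists>\<gamma>. rectifiable_curve \<gamma> \<and> path_image \<gamma> \<subseteq> \<Omega> \<and> pathstart \<gamma> = x \<and> pathfinish \<gamma> = y \<and>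
            arclength \<gamma> \<le> ennreal (norm (x - y) / \<epsilon>) \<and>
            (\<forall>z\<in>path_image \<gamma>.
               edist {z} (frontier \<Omega>) \<ge> ennreal (\<epsilon> * (norm (z - x) * norm (z - y) / norm (x - y))))))"

subsection \<open>Oscillation and local bmo\<close>

definition cube :: "real ^ 'n \<Rightarrow> real \<Rightarrow> (real ^ 'n) set" where
  "cube a l = cbox a (\<chi> i. a $ i + l)"

definition cube_mean :: "(real ^ 'n) set \<Rightarrow> (real ^ 'n \<Rightarrow> real) \<Rightarrow> real" where
  "cube_mean Q f = (LINT x:Q|lebesgue. f x) / measure lebesgue Q"

definition osc :: "(real ^ 'n) set \<Rightarrow> (real ^ 'n \<Rightarrow> real) \<Rightarrow> real \<Rightarrow> ennreal" where
  "osc U f t = (SUP (a, l) \<in> {(a, l). 0 < l \<and> l < t \<and> cube a l \<subseteq> U}.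
     ennreal (cube_mean (cube a l) (\<lambda>x. \<bar>f x - cube_mean (cube a l) f\<bar>)))"

definition bmo_norm :: "real \<Rightarrow> (real ^ 'n) set \<Rightarrow> (real ^ 'n \<Rightarrow> real) \<Rightarrow> ennreal" where
  "bmo_norm \<rho> U f = osc U f \<rho> +
     (SUP (a, l) \<in> {(a, l). 0 < l \<and> \<rho> \<le> l \<and> cube a l \<subseteq> U}.
        ennreal (cube_mean (cube a l) (\<lambda>x. \<bar>f x\<bar>)))"

definition bmo_space :: "real \<Rightarrow> (real ^ 'n) set \<Rightarrow> (real ^ 'n \<Rightarrow> real) set" where
  "bmo_space \<rho> U = {f. (\<forall>a l. 0 < l \<longrightarrow> cube a l \<subseteq> U \<longrightarrow> f absolutely_integrable_on cube a l) \<and>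
     bmo_norm \<rho> U f < \<infinity>}"

definition bmo_closure ::
    "real \<Rightarrow> (real ^ 'n) set \<Rightarrow> (real ^ 'n \<Rightarrow> real) set \<Rightarrow> (real ^ 'n \<Rightarrow> real) set" where
  "bmo_closure \<rho> U A = {f \<in> bmo_space \<rho> U.
     \<forall>\<eta>>0. \<exists>g \<in> A \<inter> bmo_space \<rho> U. bmo_norm \<rho> U (\<lambda>x. f x - g x) < ennreal \<eta>}"

definition scale_param :: "nat \<Rightarrow> real \<Rightarrow> real \<Rightarrow> real" where
  "scale_param n \<epsilon> \<delta> = \<epsilon>\<^sup>2 * \<delta> / (320 * real n * (1 + sqrt (real n) * \<epsilon>))"

definition vanishes_at_infinity :: "real \<Rightarrow> (real ^ 'n) set \<Rightarrow> (real ^ 'n \<Rightarrow> real) \<Rightarrow> bool" where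
  "vanishes_at_infinity \<rho> \<Omega> f \<longleftrightarrow>
     ((\<lambda>R::real. bmo_norm \<rho> (\<Omega> - cball 0 R) f) \<longlongrightarrow> 0) at_top"

subsection \<open>Classes of approximating functions\<close>

text \<open>
  The support is closed in the whole space.  Its distance to the boundary of \<open>\<Omega>\<close> and the condition
  that it be a compact subset of \<open>\<Omega>\<close> are the same as for the closure relative to \<open>\<Omega>\<close>.
\<close>

definition supp :: "(real ^ 'n) set \<Rightarrow> (real ^ 'n \<Rightarrow> real) \<Rightarrow> (real ^ 'n) set" where
  "supp \<Omega> g = closure (support_on \<Omega> g)"

definition Lip_away :: "(real ^ 'n) set \<Rightarrow> (real ^ 'n \<Rightarrow> real) set" where
  "Lip_away \<Omega> = {g. bounded (g ` \<Omega>) \<and> (\<exists>L. L-lipschitz_on \<Omega> g) \<and>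
     edist (supp \<Omega> g) (frontier \<Omega>) > 0}"

definition Cc :: "(real ^ 'n) set \<Rightarrow> (real ^ 'n \<Rightarrow> real) set" where
  "Cc \<Omega> = {g. continuous_on \<Omega> g \<and> compact (supp \<Omega> g) \<and> supp \<Omega> g \<subseteq> \<Omega>}"

text \<open>\<open>k\<close>-fold continuous differentiability on an open set, by iterated directional derivatives.\<close>

primrec Ck_on :: "nat \<Rightarrow> (real ^ 'n) set \<Rightarrow> (real ^ 'n \<Rightarrow> real) \<Rightarrow> bool" where
  "Ck_on 0 S g \<longleftrightarrow> continuous_on S g"
| "Ck_on (Suc k) S g \<longleftrightarrow> (\<forall>x\<in>S. g differentiable (at x)) \<and>
     (\<forall>v. Ck_on k S (\<lambda>x. frechet_derivative g (at x) v))"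

definition Cc_infinity :: "(real ^ 'n) set \<Rightarrow> (real ^ 'n \<Rightarrow> real) set" where
  "Cc_infinity \<Omega> = {g. (\<forall>k. Ck_on k \<Omega> g) \<and> compact (supp \<Omega> g) \<and> supp \<Omega> g \<subseteq> \<Omega>}"

definition cmo :: "real \<Rightarrow> (real ^ 'n) set \<Rightarrow> (real ^ 'n \<Rightarrow> real) set" where
  "cmo \<rho> \<Omega> = bmo_closure \<rho> \<Omega> (Cc \<Omega>)"

end

theory Submission
  imports Defs
begin

text \<open>
  Replace \<open>f\<close> by its means \<open>u\<close> against a tent kernel whose radius at \<open>x\<close> is comparable to
  \<open>m x = min \<tau> (dist x (- \<Omega>))\<close>. If \<open>W\<close> bounds the oscillation of \<open>f\<close> below the scale \<open>\<tau>\<close>, a Vitali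
  covering gives \<open>f - u
      = O(W)\<close> in mean on all cubes that are not small compared with \<open>m\<close>, and \<open>u\<close> is
  Lipschitz with constant \<open>O(W / m)\<close>. Following the curves of the \<open>(\<epsilon>,\<delta>)\<close>-condition, one passes from \<open>x\<close>
  to a point with twice the distance to the boundary at the cost of changing \<open>u\<close> by \<open>O(W)\<close>; hence
  \<open>\<bar>u\<bar>
      \<le> M + O(W) * ln (\<tau> / m)\<close>. The barrier \<open>C * W * ln (\<tau> / m)\<close> has mean oscillation \<open>O(W)\<close> on every cube
  inside \<open>\<Omega>\<close> and eventually dominates \<open>\<bar>u\<bar>\<close>, so soft thresholding \<open>u\<close> at the barrier produces a bounded
  Lipschitz function that vanishes near the boundary. If \<open>f\<close> vanishes at infinity, the same estimates with small
  oscillation far out make this function uniformly small there, and a plain cutoff gives compact support.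
\<close>

subsection \<open>Cubes and mean oscillation\<close>

text \<open>Multiplying \<open>u\<close> by a cutoff near the boundary would fail: \<open>u\<close>
  may be unbounded there, and its size would multiply the oscillation of the cutoff. Truncation is
  1-Lipschitz both in the value and in the level, so thresholding costs only the oscillation of
  \<open>u\<close> plus that of the barrier. The logarithm fits both demands: it grows by a fixed
  amount per halving of the distance, as \<open>u\<close> may, and on a cube inside \<Omega> the
  distance to the complement of \<Omega> dominates the distance to the complement of the cube, so
  its mean oscillation is bounded without regularity of the boundary. The climb runs at two scales.
  Up to \<tau> a doubling costs a multiple of \<open>W\<close>, which keeps the barrier small. The
  bound \<open>M\<close> on the set where \<open>m x = \<tau>\<close> need only be finite: it comes
  from a climb up to \<open>n * \<rho>\<close>, where a cube of side \<rho> fits and the norm bounds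
  the mean of \<open>\<bar>f\<bar>\<close>, or from compactness if \<Omega> is bounded and may lack
  room for that climb. \<open>M\<close> affects only how close to the boundary the support comes and
  the Lipschitz constant, not the bound for \<open>f - g\<close>.\<close>

definition cub :: "real ^ 'n \<Rightarrow> real \<Rightarrow> (real ^ 'n) set" where
  "cub x h = cbox (\<chi> i. x $ i - h) (\<chi> i. x $ i + h)"

lemma mem_cub: "y \<in> cub x h \<longleftrightarrow> (\<forall>i. \<bar>y $ i - x $ i\<bar> \<le> h)"
  by (auto simp: cub_def mem_box_cart abs_le_iff algebra_simps)

lemma cub_eq_cube: "cub x h = cube (\<chi> i. x $ i - h) (2 * h)"
  by (simp add: cub_def cube_def add.commute)

lemma cube_eq_cub: "cube a l = cub (\<chi> i. a $ i + l / 2) (l / 2)"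
  by (simp add: cub_def cube_def add.commute)

lemma cub_lmeasurable [simp]: "cub x h \<in> lmeasurable"
  by (simp add: cub_def)

lemma cub_lebesgue [simp]: "cub x h \<in> sets lebesgue"
  by (simp add: cub_def)

lemma cube_lebesgue [simp]: "cube a l \<in> sets lebesgue"
  by (simp add: cube_def)

lemma measure_cub:
  fixes x :: "real ^ 'n"
  assumes "0 \<le> h"
  shows "measure lebesgue (cub x h) = (2 * h) ^ CARD('n)"
proof -
  have "measure lborel (cbox (\<chi> i. x $ i - h) (\<chi> i. x $ i + h)) = (2 * h) ^ CARD('n)"
    using assms by (subst content_cbox_cart) (auto simp: interval_ne_empty_cart)
  then show ?thesis by (simp add: cub_def)
qed

lemma emeasure_cub:
  fixes x :: "real ^ 'n"
  assumes "0 \<le> h"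
  shows "emeasure lebesgue (cub x h) = ennreal ((2 * h) ^ CARD('n))"
  by (subst emeasure_eq_measure2) (use measure_cub[OF assms, of x] in auto)

text \<open>Going through the l1 norm gives the factor \<open>CARD('n)\<close> where the sharp one
  is its square root; this keeps square roots out of \<open>tent_const\<close>,
  \<open>vitali_const\<close> and \<open>approx_const\<close>.\<close>

lemma dist_le_card_mult:
  fixes x y :: "real ^ 'n"
  assumes "\<And>i. \<bar>y $ i - x $ i\<bar> \<le> h"
  shows "dist x y \<le> real CARD('n) * h"
proof -
  have "dist x y = norm (y - x)" by (simp add: dist_norm norm_minus_commute)
  also have "\<dots> \<le> (\<Sum>i\<in>UNIV. \<bar>(y - x) $ i\<bar>)" by (rule norm_le_l1_cart)
  also have "\<dots> \<le> (\<Sum>i\<in>(UNIV::'n set). h)" by (intro sum_mono) (use assms in auto)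
  finally show ?thesis by simp
qed

lemma cub_subset_cball:
  fixes x :: "real ^ 'n"
  shows "cub x h \<subseteq> cball x (real CARD('n) * h)"
  by (auto simp: mem_cub dist_le_card_mult)

lemma cball_subset_cub:
  fixes x :: "real ^ 'n"
  shows "cball x h \<subseteq> cub x h"
proof
  fix y assume "y \<in> cball x h"
  then have "norm (y - x) \<le> h" by (simp add: dist_norm norm_minus_commute)
  then show "y \<in> cub x h"
    unfolding mem_cub by (metis component_le_norm_cart order_trans vector_minus_component)
qed

lemma cub_mono: "h \<le> h' \<Longrightarrow> cub x h \<subseteq> cub x h'"
  unfolding mem_cub subset_iff by (meson order_trans)

lemma centre_in_cub: "0 \<le> h \<Longrightarrow> x \<in> cub x h"
  by (simp add: mem_cub)

lemma absolutely_integrable_on_iff_integrable: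
  fixes f :: "real ^ 'n \<Rightarrow> real"
  assumes "Q \<in> sets lebesgue"
  shows "f absolutely_integrable_on Q \<longleftrightarrow> integrable (lebesgue_on Q) f"
  using assms by (simp add: integrable_restrict_space set_integrable_def)

lemma cube_mean_eq:
  assumes "Q \<in> sets lebesgue"
  shows "cube_mean Q f = (LINT x|lebesgue_on Q. f x) / measure lebesgue Q"
  using assms by (simp add: cube_mean_def integral_restrict_space set_lebesgue_integral_def)

text \<open>Valued in \<open>ennreal\<close> and not divided by the volume: bounds can be added over
  a covering before integrability is settled.\<close>

definition dev :: "(real ^ 'n) set \<Rightarrow> (real ^ 'n \<Rightarrow> real) \<Rightarrow> real \<Rightarrow> ennreal" where
  "dev Q f c = (\<integral>\<^sup>+x. ennreal \<bar>f x - c\<bar> \<partial>lebesgue_on Q)"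

lemma dev_eq_integral:
  assumes "integrable (lebesgue_on Q) (f :: real ^ 'n \<Rightarrow> real)" "emeasure lebesgue Q < \<infinity>" "Q \<in> sets lebesgue"
  shows "dev Q f c = ennreal (LINT x|lebesgue_on Q. \<bar>f x - c\<bar>)"
proof -
  interpret finite_measure "lebesgue_on Q"
    using assms by (simp add: finite_measure_lebesgue_on fmeasurable_def)
  show ?thesis unfolding dev_def
    by (rule nn_integral_eq_integral) (use assms in auto)
qed

text \<open>The mean lies within \<open>E\<close> of any constant whose mean deviation is at most
  \<open>E\<close>, so passing to the mean at most doubles the bound. Each later estimate may thus
  choose its own constant.\<close>

lemma cube_mean_dev_le:
  fixes x :: "real ^ 'n"
  assumes f: "integrable (lebesgue_on (cub x h)) f" and h: "0 < h" and E: "0 \<le> E"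
    and d: "dev (cub x h) f c \<le> ennreal (E * (2 * h) ^ CARD('n))"
  shows "cube_mean (cub x h) (\<lambda>y. \<bar>f y - cube_mean (cub x h) f\<bar>) \<le> 2 * E"
    and "cube_mean (cub x h) (\<lambda>y. \<bar>f y - c\<bar>) \<le> E"
proof -
  let ?M = "lebesgue_on (cub x h)" and ?m = "cube_mean (cub x h) f" and ?v = "(2 * h) ^ CARD('n)"
  interpret finite_measure ?M
    by (simp add: finite_measure_lebesgue_on)
  have v: "?v > 0" using h by simp
  have int: "integrable ?M (\<lambda>y. \<bar>f y - a\<bar>)" for a using f by auto
  have mM: "measure ?M (space ?M) = ?v"
    using h by (simp add: measure_restrict_space measure_cub)
  have "ennreal (LINT y|?M. \<bar>f y - c\<bar>) \<le> ennreal (E * ?v)"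
    using d by (subst (asm) dev_eq_integral) (use f h in \<open>auto simp: emeasure_cub simp del: emeasure_completion\<close>)
  then have I: "(LINT y|?M. \<bar>f y - c\<bar>) \<le> E * ?v"
    using E v by (simp add: ennreal_le_iff)
  then show "cube_mean (cub x h) (\<lambda>y. \<bar>f y - c\<bar>) \<le> E"
    using v h by (simp add: cube_mean_eq measure_cub pos_divide_le_eq)
  have "?m - c = (LINT y|?M. f y - c) / ?v"
    using f v h mM by (simp add: cube_mean_eq measure_cub diff_divide_distrib)
  then have "\<bar>?m - c\<bar> = \<bar>LINT y|?M. f y - c\<bar> / ?v" using v by simp
  also have "\<dots> \<le> (LINT y|?M. \<bar>f y - c\<bar>) / ?v"
    using v by (intro divide_right_mono integral_abs_bound) auto
  also have "\<dots> \<le> E" using I v by (simp add: field_simps)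
  finally have mc: "\<bar>?m - c\<bar> \<le> E" .
  have "(LINT y|?M. \<bar>f y - ?m\<bar>) \<le> (LINT y|?M. \<bar>f y - c\<bar> + E)"
    by (intro integral_mono) (use int mc in auto)
  also have "\<dots> = (LINT y|?M. \<bar>f y - c\<bar>) + E * ?v" using int[of c] mM
      by (simp add: mult.commute mult.left_commute)
  also have "\<dots> \<le> 2 * E * ?v" using I by (simp add: algebra_simps)
  finally show "cube_mean (cub x h) (\<lambda>y. \<bar>f y - ?m\<bar>) \<le> 2 * E"
    using v h by (simp add: cube_mean_eq measure_cub pos_divide_le_eq)
qed

lemma osc_le:
  assumes "\<And>x h. 0 < h \<Longrightarrow> 2 * h < t \<Longrightarrow> cub x h \<subseteq> U \<Longrightarrow>
      cube_mean (cub x h) (\<lambda>y. \<bar>f y - cube_mean (cub x h) f\<bar>) \<le> E"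
  shows "osc U f t \<le> ennreal E"
  unfolding osc_def using assms
  by (auto intro!: SUP_least ennreal_leI simp: cube_eq_cub)

lemma le_osc:
  assumes "0 < h" "2 * h < t" "cub x h \<subseteq> U"
  shows "ennreal (cube_mean (cub x h) (\<lambda>y. \<bar>f y - cube_mean (cub x h) f\<bar>)) \<le> osc U f t"
  unfolding osc_def using assms
  by (intro SUP_upper2[of "(\<chi> i. x $ i - h, 2 * h)"]) (auto simp: cub_eq_cube)

lemma bmo_norm_le:
  assumes "osc U f \<rho> \<le> ennreal E" "0 \<le> E" "0 \<le> E'"
    and "\<And>x h. 0 < h \<Longrightarrow> \<rho> \<le> 2 * h \<Longrightarrow> cub x h \<subseteq> U \<Longrightarrow> cube_mean (cub x h) (\<lambda>y. \<bar>f y\<bar>) \<le> E'"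
  shows "bmo_norm \<rho> U f \<le> ennreal (E + E')"
proof -
  have "(SUP (a, l) \<in> {(a, l). 0 < l \<and> \<rho> \<le> l \<and> cube a l \<subseteq> U}.
        ennreal (cube_mean (cube a l) (\<lambda>x. \<bar>f x\<bar>))) \<le> ennreal E'"
    using assms(4) by (auto intro!: SUP_least ennreal_leI simp: cube_eq_cub)
  with assms(1) have "bmo_norm \<rho> U f \<le> ennreal E + ennreal E'"
    unfolding bmo_norm_def by (rule add_mono)
  then show ?thesis using assms by simp
qed

lemma le_bmo_norm:
  assumes "0 < h" "\<rho> \<le> 2 * h" "cub x h \<subseteq> U"
  shows "ennreal (cube_mean (cub x h) (\<lambda>y. \<bar>f y\<bar>)) \<le> bmo_norm \<rho> U f"
proof -
  have "ennreal (cube_mean (cub x h) (\<lambda>y. \<bar>f y\<bar>)) \<le> (SUP (a, l) \<in> {(a, l). 0 < l \<and> \<rho>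
      \<le> l \<and> cube a l \<subseteq> U}.
        ennreal (cube_mean (cube a l) (\<lambda>x. \<bar>f x\<bar>)))"
    using assms by (intro SUP_upper2[of "(\<chi> i. x $ i - h, 2 * h)"]) (auto simp: cub_eq_cube)
  then show ?thesis unfolding bmo_norm_def by (rule add_increasing[rotated]) simp
qed

lemma osc_le_bmo_norm: "osc U f \<rho> \<le> bmo_norm \<rho> U f"
  unfolding bmo_norm_def by (rule add_increasing2) auto

lemma osc_mono: "U \<subseteq> V \<Longrightarrow> s \<le> t \<Longrightarrow> osc U f s \<le> osc V f t"
  unfolding osc_def by (rule SUP_subset_mono) auto

lemma bmo_norm_mono: "U \<subseteq> V \<Longrightarrow> bmo_norm \<rho> U f \<le> bmo_norm \<rho> V f"
  unfolding bmo_norm_def by (intro add_mono osc_mono SUP_subset_mono) auto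

lemma cube_mean_cong: "(\<And>x. x \<in> Q \<Longrightarrow> f x = g x) \<Longrightarrow> Q \<in> sets lebesgue \<Longrightarrow> cube_mean Q f = cube_mean Q g"
  unfolding cube_mean_def using set_lebesgue_integral_cong[of Q lebesgue f g] by simp

lemma bmo_norm_cong:
  assumes "\<And>x. x \<in> U \<Longrightarrow> f x = g x"
  shows "bmo_norm \<rho> U f = bmo_norm \<rho> U g"
proof -
  have *: "cube_mean (cube a l) f = cube_mean (cube a l) g"
    "cube_mean (cube a l) (\<lambda>x. \<bar>f x\<bar>) = cube_mean (cube a l) (\<lambda>x. \<bar>g x\<bar>)"
    "cube_mean (cube a l) (\<lambda>x. \<bar>f x - c\<bar>) = cube_mean (cube a l) (\<lambda>x. \<bar>g x - c\<bar>)"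
    if "cube a l \<subseteq> U" for a l c
    using that assms by (auto intro!: cube_mean_cong)
  show ?thesis
    unfolding bmo_norm_def osc_def
    by (intro arg_cong2[of _ _ _ _ "(+)"] SUP_cong) (auto simp: *)
qed

abbreviation locint :: "(real ^ 'n) set \<Rightarrow> (real ^ 'n \<Rightarrow> real) \<Rightarrow> bool" where
  "locint U f \<equiv> (\<forall>x h. 0 < h \<longrightarrow> cub x h \<subseteq> U \<longrightarrow> integrable (lebesgue_on (cub x h)) f)"

lemma bmo_space_iff: "f \<in> bmo_space \<rho> U \<longleftrightarrow> locint U f \<and> bmo_norm \<rho> U f < \<infinity>"
proof -
  have "(\<forall>a l. 0 < l \<longrightarrow> cube a l \<subseteq> U \<longrightarrow> f absolutely_integrable_on cube a l) \<longleftrightarrow> locint U f"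
  proof safe
    fix x h assume *: "\<forall>a l. 0 < l \<longrightarrow> cube a l \<subseteq> U \<longrightarrow> f absolutely_integrable_on cube a l"
      and "0 < (h::real)" "cub x h \<subseteq> U"
    then show "integrable (lebesgue_on (cub x h)) f"
      using *[rule_format, of "2 * h" "\<chi> i. x $ i - h"]
      by (simp add: absolutely_integrable_on_iff_integrable[symmetric] cub_eq_cube)
  next
    fix a l assume "locint U f" "0 < (l::real)" "cube a l \<subseteq> U"
    then show "f absolutely_integrable_on cube a l"
      by (simp add: absolutely_integrable_on_iff_integrable cube_eq_cub)
  qed
  then show ?thesis by (simp add: bmo_space_def)
qed

lemma cube_mean_triangle:
  assumes "integrable (lebesgue_on (cub x h)) (f :: real ^ 'n \<Rightarrow> real)"
    and "integrable (lebesgue_on (cub x h)) g" and h: "0 < h"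
  shows "cube_mean (cub x h) (\<lambda>y. \<bar>f y + g y\<bar>)
      \<le> cube_mean (cub x h) (\<lambda>y. \<bar>f y\<bar>) + cube_mean (cub x h) (\<lambda>y. \<bar>g y\<bar>)" (is ?a)
    and "cube_mean (cub x h) (\<lambda>y. \<bar>f y + g y - cube_mean (cub x h) (\<lambda>y. f y + g y)\<bar>)
      \<le> cube_mean (cub x h) (\<lambda>y. \<bar>f y - cube_mean (cub x h) f\<bar>) +
        cube_mean (cub x h) (\<lambda>y. \<bar>g y - cube_mean (cub x h) g\<bar>)" (is ?b)
proof -
  let ?M = "lebesgue_on (cub x h)"
  interpret finite_measure ?M
    by (simp add: finite_measure_lebesgue_on)
  have 1: "cube_mean (cub x h) (\<lambda>y. \<bar>F y + G y\<bar>)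
      \<le> cube_mean (cub x h) (\<lambda>y. \<bar>F y\<bar>) + cube_mean (cub x h) (\<lambda>y. \<bar>G y\<bar>)"
    if "integrable ?M F" "integrable ?M G" for F G :: "real ^ 'n \<Rightarrow> real"
  proof -
    have "(LINT y|?M. \<bar>F y + G y\<bar>) \<le> (LINT y|?M. \<bar>F y\<bar> + \<bar>G y\<bar>)"
      by (intro integral_mono) (use that in auto)
    also have "\<dots> = (LINT y|?M. \<bar>F y\<bar>) + (LINT y|?M. \<bar>G y\<bar>)" using that by simp
    finally show ?thesis
      by (simp add: cube_mean_eq divide_right_mono add_divide_distrib[symmetric])
  qed
  show ?a using 1 assms by blast
  have 2: "cube_mean (cub x h) (\<lambda>y. f y + g y) = cube_mean (cub x h) f + cube_mean (cub x h) g"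
    using assms by (simp add: cube_mean_eq add_divide_distrib)
  have "cube_mean (cub x h) (\<lambda>y. \<bar>(f y - cube_mean (cub x h) f) + (g y - cube_mean (cub x h) g)\<bar>)
      \<le> cube_mean (cub x h) (\<lambda>y. \<bar>f y - cube_mean (cub x h) f\<bar>) +
        cube_mean (cub x h) (\<lambda>y. \<bar>g y - cube_mean (cub x h) g\<bar>)"
    by (rule 1) (use assms in auto)
  then show ?b by (simp add: 2 algebra_simps)
qed

lemma cube_mean_abs_nonneg: "0 \<le> cube_mean (cub x h) (\<lambda>y. \<bar>f y\<bar>)"
  by (simp add: cube_mean_eq)

lemma osc_triangle:
  assumes "locint U f" "locint U g"
  shows "osc U (\<lambda>x. f x + g x) t \<le> osc U f t + osc U g t"
  unfolding osc_def[of U "\<lambda>x. f x + g x"]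
proof (rule SUP_least, clarify)
  fix a l assume l: "0 < (l::real)" "l < t" "cube a l \<subseteq> U"
  define x where "x = (\<chi> i. a $ i + l / 2)"
  have Q: "cube a l = cub x (l / 2)" by (simp add: x_def cube_eq_cub)
  let ?d = "\<lambda>f. cube_mean (cub x (l / 2)) (\<lambda>y. \<bar>f y - cube_mean (cub x (l / 2)) f\<bar>)"
  have "ennreal (?d (\<lambda>x. f x + g x)) \<le> ennreal (?d f + ?d g)"
    using l Q assms by (intro ennreal_leI cube_mean_triangle) auto
  also have "\<dots> = ennreal (?d f) + ennreal (?d g)"
    by (intro ennreal_plus cube_mean_abs_nonneg)
  also have "\<dots> \<le> osc U f t + osc U g t"
    using l Q by (intro add_mono le_osc) auto
  finally show "ennreal (cube_mean (cube a l) (\<lambda>y. \<bar>f y + g y - cube_mean (cube a l) (\<lambda>x. f x + g x)\<bar>))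
    \<le> osc U f t + osc U g t" unfolding Q .
qed

lemma bmo_norm_triangle:
  assumes "locint U f" "locint U g"
  shows "bmo_norm \<rho> U (\<lambda>x. f x + g x) \<le> bmo_norm \<rho> U f + bmo_norm \<rho> U g"
proof -
  let ?S = "\<lambda>f. (SUP (a, l) \<in> {(a, l). 0 < l \<and> \<rho> \<le> l \<and> cube a l \<subseteq> U}.
        ennreal (cube_mean (cube a l) (\<lambda>x. \<bar>f x\<bar>)))"
  have "?S (\<lambda>x. f x + g x) \<le> ?S f + ?S g"
  proof (rule SUP_least, clarify)
    fix a l assume l: "0 < (l::real)" "\<rho> \<le> l" "cube a l \<subseteq> U"
    define x where "x = (\<chi> i. a $ i + l / 2)"
    have Q: "cube a l = cub x (l / 2)" by (simp add: x_def cube_eq_cub)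
    have "ennreal (cube_mean (cub x (l / 2)) (\<lambda>x. \<bar>f x + g x\<bar>))
        \<le> ennreal (cube_mean (cub x (l / 2)) (\<lambda>x. \<bar>f x\<bar>) + cube_mean (cub x (l / 2)) (\<lambda>x. \<bar>g x\<bar>))"
      using l Q assms by (intro ennreal_leI cube_mean_triangle) auto
    also have "\<dots> = ennreal (cube_mean (cube a l) (\<lambda>x. \<bar>f x\<bar>)) + ennreal (cube_mean (cube a l) (\<lambda>x. \<bar>g x\<bar>))"
      using cube_mean_abs_nonneg Q by (subst ennreal_plus) auto
    also have "\<dots> \<le> ?S f + ?S g"
      using l by (intro add_mono SUP_upper2[of "(a, l)"]) auto
    finally show "ennreal (cube_mean (cube a l) (\<lambda>x. \<bar>f x + g x\<bar>)) \<le> ?S f + ?S g"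
      unfolding Q .
  qed
  moreover have "osc U (\<lambda>x. f x + g x) \<rho> \<le> osc U f \<rho> + osc U g \<rho>"
    using assms by (rule osc_triangle)
  ultimately show ?thesis unfolding bmo_norm_def
    using add_mono by (fastforce simp: ac_simps)
qed

lemma locint_diff: "locint U f \<Longrightarrow> locint U g \<Longrightarrow> locint U (\<lambda>x. f x - g x)"
  by auto

lemma locint_continuous:
  assumes "continuous_on U g"
  shows "locint U g"
proof safe
  fix x h assume "0 < (h::real)" "cub x h \<subseteq> U"
  then have "continuous_on (cub x h) g" using assms continuous_on_subset by blast
  then have "g absolutely_integrable_on cub x h"
    unfolding cub_def by (rule absolutely_integrable_continuous)
  then show "integrable (lebesgue_on (cub x h)) g"
    by (simp add: absolutely_integrable_on_iff_integrable)
qed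

lemma dev_le_bound:
  fixes x :: "real ^ 'n"
  assumes "\<And>y. y \<in> cub x h \<Longrightarrow> \<bar>f y - c\<bar> \<le> E" "0 \<le> h" "0 \<le> E"
  shows "dev (cub x h) f c \<le> ennreal (E * (2 * h) ^ CARD('n))"
proof -
  have "dev (cub x h) f c \<le> (\<integral>\<^sup>+y. ennreal E \<partial>lebesgue_on (cub x h))"
    unfolding dev_def by (intro nn_integral_mono ennreal_leI) (use assms in auto)
  also have "\<dots> = ennreal (E * (2 * h) ^ CARD('n))"
    using assms by (simp add: emeasure_restrict_space emeasure_cub ennreal_mult'' del: emeasure_completion)
  finally show ?thesis .
qed

lemma osc_le_dev:
  fixes U :: "(real ^ 'n) set"
  assumes "locint U f" "0 \<le> E"
    and "\<And>x h. 0 < h \<Longrightarrow> 2 * h < t \<Longrightarrow> cub x h \<subseteq> U \<Longrightarrow>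
      \<exists>c. dev (cub x h) f c \<le> ennreal (E * (2 * h) ^ CARD('n))"
  shows "osc U f t \<le> ennreal (2 * E)"
proof (rule osc_le)
  fix x h assume *: "0 < h" "2 * h < t" "cub x h \<subseteq> U"
  then obtain c where "dev (cub x h) f c \<le> ennreal (E * (2 * h) ^ CARD('n))"
    using assms(3) by blast
  then show "cube_mean (cub x h) (\<lambda>y. \<bar>f y - cube_mean (cub x h) f\<bar>) \<le> 2 * E"
    using * assms by (intro cube_mean_dev_le(1)) auto
qed

text \<open>On small cubes any constant will do, at the price of a factor 2; on cubes of side at
  least \<rho> the norm measures \<open>f\<close> itself, which fixes the constant \<open>0\<close>.
  Hence \<open>3 = 2 + 1\<close>.\<close>

lemma bmo_norm_le_dev:
  fixes U :: "(real ^ 'n) set"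
  assumes "locint U f" "0 \<le> E"
    and "\<And>x h. 0 < h \<Longrightarrow> 2 * h < \<rho> \<Longrightarrow> cub x h \<subseteq> U \<Longrightarrow>
      \<exists>c. dev (cub x h) f c \<le> ennreal (E * (2 * h) ^ CARD('n))"
    and "\<And>x h. 0 < h \<Longrightarrow> \<rho> \<le> 2 * h \<Longrightarrow> cub x h \<subseteq> U \<Longrightarrow>
      dev (cub x h) f 0 \<le> ennreal (E * (2 * h) ^ CARD('n))"
  shows "bmo_norm \<rho> U f \<le> ennreal (3 * E)"
proof -
  have "bmo_norm \<rho> U f \<le> ennreal (2 * E + E)"
  proof (rule bmo_norm_le)
    show "osc U f \<rho> \<le> ennreal (2 * E)" by (rule osc_le_dev) (use assms in auto)
    fix x h assume "0 < h" "\<rho> \<le> 2 * h" "cub x h \<subseteq> U"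
    then show "cube_mean (cub x h) (\<lambda>y. \<bar>f y\<bar>) \<le> E"
      using cube_mean_dev_le(2)[of x h f E 0] assms by auto
  qed (use assms in auto)
  then show ?thesis by simp
qed

lemma bmo_norm_le_bound:
  fixes U :: "(real ^ 'n) set"
  assumes "locint U f" "\<And>x. x \<in> U \<Longrightarrow> \<bar>f x\<bar> \<le> E" "0 \<le> E"
  shows "bmo_norm \<rho> U f \<le> ennreal (3 * E)"
proof (rule bmo_norm_le_dev[OF assms(1,3)])
  show *: "dev (cub x h) f 0 \<le> ennreal (E * (2 * h) ^ CARD('n))" if "0 < h" "cub x h \<subseteq> U" for x h
    by (rule dev_le_bound) (use assms(2,3) that in auto)
  show "\<exists>c. dev (cub x h) f c \<le> ennreal (E * (2 * h) ^ CARD('n))" if "0 < h" "cub x h \<subseteq> U" for x h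
    using * that by blast
qed

lemma dev_mean_le_osc:
  fixes x :: "real ^ 'n"
  assumes "integrable (lebesgue_on (cub x h)) f" "0 < h" "2 * h < t" "cub x h \<subseteq> U"
    and W: "osc U f t \<le> ennreal W" "0 \<le> W"
  shows "(LINT y|lebesgue_on (cub x h). \<bar>f y - cube_mean (cub x h) f\<bar>) \<le> W * (2 * h) ^ CARD('n)"
    and "dev (cub x h) f (cube_mean (cub x h) f) \<le> ennreal (W * (2 * h) ^ CARD('n))"
proof -
  have "ennreal (cube_mean (cub x h) (\<lambda>y. \<bar>f y - cube_mean (cub x h) f\<bar>)) \<le> ennreal W"
    using order_trans[OF le_osc[OF assms(2-4), of f] W(1)] .
  then have "cube_mean (cub x h) (\<lambda>y. \<bar>f y - cube_mean (cub x h) f\<bar>) \<le> W"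
    using W by (simp add: ennreal_le_iff)
  then show *: "(LINT y|lebesgue_on (cub x h). \<bar>f y - cube_mean (cub x h) f\<bar>)
      \<le> W * (2 * h) ^ CARD('n)"
    using assms(2) by (subst (asm) (1) cube_mean_eq) (auto simp: measure_cub field_simps)
  show "dev (cub x h) f (cube_mean (cub x h) f) \<le> ennreal (W * (2 * h) ^ CARD('n))"
    by (subst dev_eq_integral) (use assms * in \<open>auto simp: emeasure_cub intro!: ennreal_leI simp del: emeasure_completion\<close>)
qed

subsection \<open>Means against a tent kernel\<close>

text \<open>A cone is Lipschitz in centre and radius at once (\<open>tent_diff\<close>), so its
  averages vary in a controlled way when the radius depends on the point. The indicator of a ball
  would jump.\<close>

definition tent :: "real \<Rightarrow> real ^ 'n \<Rightarrow> real ^ 'n \<Rightarrow> real" where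
  "tent r x y = max 0 (r - dist x y)"

definition tent_mean :: "real \<Rightarrow> (real ^ 'n \<Rightarrow> real) \<Rightarrow> real ^ 'n \<Rightarrow> real" where
  "tent_mean r f x = (LINT y|lebesgue. tent r x y * f y) / (LINT y|lebesgue. tent r x y)"

lemma tent_nonneg: "0 \<le> tent r x y"
  by (simp add: tent_def)

lemma tent_le: "0 \<le> r \<Longrightarrow> tent r x y \<le> r"
  by (simp add: tent_def)

lemma tent_diff: "\<bar>tent r x y - tent r' x' y\<bar> \<le> \<bar>r - r'\<bar> + dist x x'"
proof -
  have "\<bar>dist x y - dist x' y\<bar> \<le> dist x x'" by (metis abs_dist_diff_le dist_commute)
  then show ?thesis unfolding tent_def by linarith
qed

lemma tent_measurable [measurable]: "tent r x \<in> borel_measurable (lebesgue_on S)"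
proof -
  have "continuous_on UNIV (tent r x)" unfolding tent_def[abs_def] by (intro continuous_intros)
  then have "tent r x \<in> borel_measurable borel" by (rule borel_measurable_continuous_onI)
  then have "tent r x \<in> borel_measurable lebesgue" by (simp add: measurable_completion)
  then show ?thesis by (rule measurable_restrict_space1)
qed

lemma integrable_tent_mult:
  assumes "integrable (lebesgue_on S) f" "0 \<le> r"
  shows "integrable (lebesgue_on S) (\<lambda>y. tent r x y * f y)"
proof (rule Bochner_Integration.integrable_bound[of _ "\<lambda>y. r * f y"])
  show "integrable (lebesgue_on S) (\<lambda>y. r * f y)" using assms by auto
  show "(\<lambda>y. tent r x y * f y) \<in> borel_measurable (lebesgue_on S)"
    using assms(1) by measurable
  show "AE y in lebesgue_on S. norm (tent r x y * f y) \<le> norm (r * f y)"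
    using assms tent_le[of r x] tent_nonneg[of r x]
        by (auto simp: abs_mult intro!: AE_I2 mult_right_mono)
qed

lemma integral_tent_mult:
  assumes "cball x r \<subseteq> S" "S \<in> sets lebesgue"
  shows "(LINT y|lebesgue. tent r x y * f y) = (LINT y|lebesgue_on S. tent r x y * f y)"
proof -
  have "tent r x y = 0" if "y \<notin> S" for y using that assms
      by (force simp: tent_def mem_cball subset_iff)
  then have "(\<lambda>y. tent r x y * f y) = (\<lambda>y. indicator S y *\<^sub>R (tent r x y * f y))"
    by (intro ext) (auto split: split_indicator)
  then show ?thesis using assms by (subst integral_restrict_space) auto
qed

text \<open>The kernel is at least \<open>r / 2\<close> on the cube of half side
  \<open>r / (2 * CARD('n))\<close>, which lies in the ball of radius \<open>r / 2\<close>.\<close>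

lemma integral_tent_lower:
  fixes x :: "real ^ 'n"
  assumes "0 < r"
  shows "(r / 2) * (r / real CARD('n)) ^ CARD('n) \<le> (LINT y|lebesgue. tent r x y)"
proof -
  let ?n = "real CARD('n)"
  let ?C = "cub x (r / (2 * ?n))"
  have n: "?n \<ge> 1" by simp
  have C: "?C \<subseteq> cball x (r / 2)" using cub_subset_cball[of x "r / (2 * ?n)"] by simp
  interpret finite_measure "lebesgue_on (cub x r)" by (simp add: finite_measure_lebesgue_on)
  have S: "cball x r \<subseteq> cub x r" by (rule cball_subset_cub)
  have CS: "?C \<subseteq> cub x r"
    using C S assms subset_cball[of "r / 2" r x] by force
  have i: "integrable (lebesgue_on (cub x r)) (tent r x)"
    using integrable_tent_mult[of "cub x r" "\<lambda>_. 1" r x] assms by auto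
  have "(r / 2) * (r / ?n) ^ CARD('n) = (r / 2) * measure lebesgue ?C"
    using assms by (simp add: measure_cub)
  also have "\<dots> = (LINT y|lebesgue_on (cub x r). (r / 2) * indicator ?C y)"
    using CS by (simp add: measure_restrict_space Int_absorb1 Int_absorb2)
  also have "\<dots> \<le> (LINT y|lebesgue_on (cub x r). tent r x y)"
  proof (rule integral_mono[OF _ i])
    show "integrable (lebesgue_on (cub x r)) (\<lambda>y. (r / 2) * indicator ?C y)"
      by (intro integrable_mult_right integrable_real_indicator)
         (auto simp: CS sets_restrict_space_iff emeasure_finite less_top[symmetric])
    show "(r / 2) * indicator ?C y \<le> tent r x y" for y
    proof (cases "y \<in> ?C")
      case True
      then have "dist x y \<le> r / 2" using C by auto
      then show ?thesis using True unfolding tent_def by (simp add: max_def)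
    qed (simp add: tent_nonneg)
  qed
  also have "\<dots> = (LINT y|lebesgue. tent r x y)"
    using integral_tent_mult[OF S, of "\<lambda>_. 1"] by simp
  finally show ?thesis .
qed

text \<open>\<open>32 * n^2\<close> is the product of the ratios \<open>8 * n\<close> and
  \<open>4 * n\<close> that arise when the volume \<open>(4 * r) ^ n\<close> is compared with the
  lower bounds for the masses of the two kernels; \<open>28 = 4 + 24\<close> adds the change of the
  numerator and the change of the mass.\<close>

definition tent_const :: "nat \<Rightarrow> real" where
  "tent_const n = 28 * (32 * real n ^ 2) ^ n"

text \<open>Both kernels live in \<open>cub x (2 * r)\<close>, and subtracting the constant
  \<open>m\<close> leaves a function of small integral there; this gives the first bound. For the
  second, kernel and mass change by at most \<open>2 * dist x x'\<close> at each point of that cube,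
  which yields the factor \<open>dist x x' / r\<close>.\<close>

lemma tent_mean_estimates:
  fixes x x' :: "real ^ 'n"
  assumes f: "integrable (lebesgue_on (cub x (2 * r))) f"
    and W: "(LINT y|lebesgue_on (cub x (2 * r)). \<bar>f y - m\<bar>) \<le> W * (4 * r) ^ CARD('n)"
    and r: "0 < r" "\<bar>r - r'\<bar> \<le> dist x x'" "dist x x' \<le> r / 2"
  shows "\<bar>tent_mean r' f x' - m\<bar> \<le> tent_const CARD('n) * W"
    and "\<bar>tent_mean r f x - tent_mean r' f x'\<bar> \<le> tent_const CARD('n) * W * (dist x x' / r)"
proof -
  let ?n = "real CARD('n)" and ?N = "CARD('n)"
  let ?M = "lebesgue_on (cub x (2 * r))"
  define h where "h = dist x x'"
  define A where "A = (LINT y|?M. \<bar>f y - m\<bar>)"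
  have A0: "0 \<le> A" by (simp add: A_def)
  have n1: "?n \<ge> 1" by simp
  interpret finite_measure ?M by (simp add: finite_measure_lebesgue_on)
  have r': "r / 2 \<le> r'" "r' \<le> 3 / 2 * r" "0 < r'" using r by auto
  have sub: "cball x r \<subseteq> cub x (2 * r)" "cball x' r' \<subseteq> cub x (2 * r)"
  proof -
    show "cball x r \<subseteq> cub x (2 * r)"
      using cball_subset_cub[of x "2 * r"] subset_cball[of r "2 * r" x] r by auto
    have "cball x' r' \<subseteq> cball x (2 * r)"
      unfolding cball_subset_cball_iff using r r' by (auto simp: dist_commute)
    then show "cball x' r' \<subseteq> cub x (2 * r)" using cball_subset_cub[of x "2 * r"] by auto
  qed
  have fm: "integrable ?M (\<lambda>y. f y - m)" using f by simp
  define I where "I = (LINT y|lebesgue. tent r x y)"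
  define I' where "I' = (LINT y|lebesgue. tent r' x' y)"
  define F where "F = (LINT y|?M. tent r x y * (f y - m))"
  define F' where "F' = (LINT y|?M. tent r' x' y * (f y - m))"
  have one: "integrable ?M (\<lambda>_. 1::real)" by simp
  have IM: "I = (LINT y|?M. tent r x y)" "I' = (LINT y|?M. tent r' x' y)"
    using integral_tent_mult[OF sub(1), of "\<lambda>_. 1"] integral_tent_mult[OF sub(2), of "\<lambda>_. 1"]
    by (auto simp: I_def I'_def)
  have int1: "integrable ?M (tent r x)" "integrable ?M (tent r' x')"
    using integrable_tent_mult[OF one, of r x] integrable_tent_mult[OF one, of r' x'] r r' by auto
  have int2: "integrable ?M (\<lambda>y. tent r x y * (f y - m))" "integrable ?M (\<lambda>y. tent r' x' y * (f y - m))"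
    using integrable_tent_mult[OF fm] r r' by auto
  have int3: "integrable ?M (\<lambda>y. tent r x y * f y)" "integrable ?M (\<lambda>y. tent r' x' y * f y)"
    using integrable_tent_mult[OF f] r r' by auto
  have lo: "(r / 2) * (r / ?n) ^ ?N \<le> I" "(r' / 2) * (r' / ?n) ^ ?N \<le> I'"
    unfolding I_def I'_def using integral_tent_lower r r' by blast+
  have "(r / 4) * (r / (2 * ?n)) ^ ?N \<le> (r' / 2) * (r' / ?n) ^ ?N"
    using r r' n1 by (intro mult_mono power_mono) (auto simp: field_simps)
  with lo have lo': "(r / 4) * (r / (2 * ?n)) ^ ?N \<le> I'" by linarith
  have pos: "0 < (r / 2) * (r / ?n) ^ ?N" "0 < (r / 4) * (r / (2 * ?n)) ^ ?N" using r by auto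
  then have I0: "0 < I" "0 < I'" using lo lo' by linarith+
  have "F = (LINT y|?M. tent r x y * f y) - m * I"
    unfolding F_def IM using int1 int3 by (simp add: right_diff_distrib mult.commute[of _ m])
  then have tm: "tent_mean r f x - m = F / I"
    unfolding tent_mean_def integral_tent_mult[OF sub(1) cub_lebesgue] I_def[symmetric]
    using I0 by (simp add: field_simps)
  have "F' = (LINT y|?M. tent r' x' y * f y) - m * I'"
    unfolding F'_def IM using int1 int3 by (simp add: right_diff_distrib mult.commute[of _ m])
  then have tm': "tent_mean r' f x' - m = F' / I'"
    unfolding tent_mean_def integral_tent_mult[OF sub(2) cub_lebesgue] I'_def[symmetric]
    using I0 by (simp add: field_simps)
  have "\<bar>F'\<bar> \<le> (LINT y|?M. \<bar>tent r' x' y * (f y - m)\<bar>)"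
    unfolding F'_def by (rule integral_abs_bound)
  also have "\<dots> \<le> (LINT y|?M. r' * \<bar>f y - m\<bar>)"
  proof (rule integral_mono)
    show "integrable ?M (\<lambda>y. \<bar>tent r' x' y * (f y - m)\<bar>)" using int2(2) by (rule integrable_abs)
    show "\<bar>tent r' x' y * (f y - m)\<bar> \<le> r' * \<bar>f y - m\<bar>" for y
      using r' tent_nonneg[of r' x' y] tent_le[of r' x' y]
      by (auto simp: abs_mult intro!: mult_right_mono)
  qed (use fm in auto)
  also have "\<dots> = r' * A" by (simp add: A_def)
  finally have F': "\<bar>F'\<bar> \<le> 3 / 2 * r * A" using r' A0 by (meson mult_right_mono order_trans)
  have td: "\<bar>tent r x y - tent r' x' y\<bar> \<le> 2 * h" for y
    using tent_diff[of r x y r' x'] r by (simp add: h_def)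
  have "F - F' = (LINT y|?M. (tent r x y - tent r' x' y) * (f y - m))"
    unfolding F_def F'_def using int2
        by (subst Bochner_Integration.integral_diff[symmetric]) (auto simp: left_diff_distrib)
  then have "\<bar>F - F'\<bar> \<le> (LINT y|?M. \<bar>(tent r x y - tent r' x' y) * (f y - m)\<bar>)"
    using integral_abs_bound by metis
  also have "\<dots> \<le> (LINT y|?M. 2 * h * \<bar>f y - m\<bar>)"
  proof (rule integral_mono)
    have "integrable ?M (\<lambda>y. tent r x y * (f y - m) - tent r' x' y * (f y - m))"
      using int2 by (rule Bochner_Integration.integrable_diff)
    then show "integrable ?M (\<lambda>y. \<bar>(tent r x y - tent r' x' y) * (f y - m)\<bar>)"
      by (simp add: left_diff_distrib)
    show "\<bar>(tent r x y - tent r' x' y) * (f y - m)\<bar> \<le> 2 * h * \<bar>f y - m\<bar>" for y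
      using td by (simp add: abs_mult mult_right_mono)
  qed (use fm in auto)
  also have "\<dots> = 2 * h * A" by (simp add: A_def)
  finally have FF: "\<bar>F - F'\<bar> \<le> 2 * h * A" .
  have "I - I' = (LINT y|?M. tent r x y - tent r' x' y)"
    unfolding IM using int1 by simp
  then have "\<bar>I - I'\<bar> \<le> (LINT y|?M. \<bar>tent r x y - tent r' x' y\<bar>)"
    using integral_abs_bound by metis
  also have "\<dots> \<le> (LINT y|?M. 2 * h)"
    using int1 td by (intro integral_mono) auto
  also have "\<dots> = 2 * h * (4 * r) ^ ?N"
    using r by (simp add: measure_restrict_space measure_cub)
  finally have II: "\<bar>I - I'\<bar> \<le> 2 * h * (4 * r) ^ ?N" .
  have h0: "0 \<le> h" by (simp add: h_def)
  have AW: "A \<le> W * (4 * r) ^ ?N" using W A_def by simp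
  have W0: "0 \<le> W" using A0 AW r
      by (metis mult_neg_pos not_le order_trans zero_less_mult_iff zero_less_numeral zero_less_power)
  have AW': "0 \<le> W * (4 * r) ^ ?N" using A0 AW by linarith
  have "\<bar>F' / I'\<bar> \<le> (3 / 2 * r * (W * (4 * r) ^ ?N)) / ((r / 4) * (r / (2 * ?n)) ^ ?N)"
    unfolding abs_divide
  proof (rule frac_le)
    show "\<bar>F'\<bar> \<le> 3 / 2 * r * (W * (4 * r) ^ ?N)"
      using r by (intro order_trans[OF F'] mult_left_mono AW) auto
    show "r / 4 * (r / (2 * ?n)) ^ ?N \<le> \<bar>I'\<bar>" using lo' I0 by linarith
  qed (use pos AW' r h0 in auto)
  also have "\<dots> = 6 * (8 * ?n) ^ ?N * W"
  proof -
    have "4 * r = (8 * ?n) * (r / (2 * ?n))" using n1 by simp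
    then have "(4 * r) ^ ?N = (8 * ?n) ^ ?N * (r / (2 * ?n)) ^ ?N"
      using power_mult_distrib by metis
    then show ?thesis using r by simp
  qed
  finally have e1: "\<bar>F' / I'\<bar> \<le> 6 * (8 * ?n) ^ ?N * W" .
  have q: "(4 * r) ^ ?N = (4 * ?n) ^ ?N * (r / ?n) ^ ?N"
  proof -
    have "4 * r = (4 * ?n) * (r / ?n)" using n1 by simp
    then show ?thesis using power_mult_distrib by metis
  qed
  have "\<bar>(F - F') / I\<bar> \<le> (2 * h * (W * (4 * r) ^ ?N)) / ((r / 2) * (r / ?n) ^ ?N)"
    unfolding abs_divide
  proof (rule frac_le)
    show "\<bar>F - F'\<bar> \<le> 2 * h * (W * (4 * r) ^ ?N)"
      using h0 by (intro order_trans[OF FF] mult_left_mono AW) auto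
    show "r / 2 * (r / ?n) ^ ?N \<le> \<bar>I\<bar>" using lo I0 by linarith
  qed (use pos AW' r h0 in auto)
  also have "\<dots> = 4 * (4 * ?n) ^ ?N * W * (h / r)" unfolding q using r by simp
  finally have e2: "\<bar>(F - F') / I\<bar> \<le> 4 * (4 * ?n) ^ ?N * W * (h / r)" .
  have "\<bar>(I' - I) / I\<bar> \<le> (2 * h * (4 * r) ^ ?N) / ((r / 2) * (r / ?n) ^ ?N)"
    unfolding abs_divide
  proof (rule frac_le)
    show "\<bar>I' - I\<bar> \<le> 2 * h * (4 * r) ^ ?N" using II by linarith
    show "r / 2 * (r / ?n) ^ ?N \<le> \<bar>I\<bar>" using lo I0 by linarith
  qed (use pos AW' r h0 in auto)
  also have "\<dots> = 4 * (4 * ?n) ^ ?N * (h / r)" unfolding q using r by simp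
  finally have e3: "\<bar>(I' - I) / I\<bar> \<le> 4 * (4 * ?n) ^ ?N * (h / r)" .
  have p1: "(1::real) \<le> (4 * ?n) ^ ?N" "(1::real) \<le> (8 * ?n) ^ ?N"
      by (rule one_le_power, use n1 in linarith)+
  have kk: "(32 * ?n\<^sup>2) ^ ?N = (8 * ?n) ^ ?N * (4 * ?n) ^ ?N"
    unfolding power_mult_distrib[symmetric] by (simp add: power2_eq_square)
  have k1: "6 * (8 * ?n) ^ ?N \<le> tent_const ?N"
  proof -
    have "(8 * ?n) ^ ?N * 1 \<le> (8 * ?n) ^ ?N * (4 * ?n) ^ ?N" using p1 by (intro mult_left_mono) auto
    moreover have "0 \<le> (8 * ?n) ^ ?N" using p1 by linarith
    ultimately show ?thesis unfolding tent_const_def kk by linarith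
  qed
  show "\<bar>tent_mean r' f x' - m\<bar> \<le> tent_const ?N * W"
    unfolding tm' using e1 mult_right_mono[OF k1 W0] by linarith
  have hr: "0 \<le> h / r" using h0 r by simp
  have "tent_mean r f x - tent_mean r' f x' = F / I - F' / I'" using tm tm' by linarith
  \<comment> \<open>Split so that the change of mass is multiplied by \<open>F' / I'\<close>, which
    the first estimate already bounds.\<close>
  also have "\<dots> = (F - F') / I + (F' / I') * ((I' - I) / I)"
    using I0 by (simp add: field_simps)
  finally have "\<bar>tent_mean r f x - tent_mean r' f x'\<bar> \<le> \<bar>(F - F') / I\<bar> + \<bar>F' / I'\<bar> * \<bar>(I' - I) / I\<bar>"
    by (metis abs_mult abs_triangle_ineq)
  also have "\<dots> \<le> 4 * (4 * ?n) ^ ?N * W * (h / r) + (6 * (8 * ?n) ^ ?N * W) * (4 * (4 * ?n) ^ ?N * (h / r))"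
    by (intro add_mono mult_mono e1 e2 e3) (use p1 W0 in auto)
  also have "\<dots> = (4 * (4 * ?n) ^ ?N + 24 * ((8 * ?n) ^ ?N * (4 * ?n) ^ ?N)) * (W * (h / r))"
    by (simp add: algebra_simps)
  also have "\<dots> \<le> tent_const ?N * (W * (h / r))"
  proof (rule mult_right_mono)
    have "1 * (4 * ?n) ^ ?N \<le> (8 * ?n) ^ ?N * (4 * ?n) ^ ?N" using p1
        by (intro mult_right_mono) auto
    then show "4 * (4 * ?n) ^ ?N + 24 * ((8 * ?n) ^ ?N * (4 * ?n) ^ ?N) \<le> tent_const ?N"
      unfolding tent_const_def kk by linarith
  qed (rule mult_nonneg_nonneg[OF W0 hr])
  finally show "\<bar>tent_mean r f x - tent_mean r' f x'\<bar> \<le> tent_const ?N * W * (dist x x' / r)"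
    by (simp add: h_def mult.assoc)
qed

subsection \<open>Smoothing at the scale of the distance to the boundary\<close>

text \<open>\<open>infdist\<close> to the empty set is \<open>0\<close>, while the convention asks
  for infinity; hence the separate case of the whole space. The cap \<open>T\<close> keeps the scale
  bounded far from the boundary.\<close>

definition bdist :: "real \<Rightarrow> 'a::metric_space set \<Rightarrow> 'a \<Rightarrow> real" where
  "bdist T \<Omega> x = (if \<Omega> = UNIV then T else min T (infdist x (- \<Omega>)))"

lemma bdist_le: "bdist T \<Omega> x \<le> T"
  by (simp add: bdist_def)

lemma bdist_lipschitz: "\<bar>bdist T \<Omega> x - bdist T \<Omega> y\<bar> \<le> dist x y"
  using infdist_triangle_abs[of x "- \<Omega>" y] by (auto simp: bdist_def)

lemma bdist_pos:
  assumes "open \<Omega>" "0 < T" "x \<in> \<Omega>"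
  shows "0 < bdist T \<Omega> x"
  using assms infdist_pos_not_in_closed[of "- \<Omega>" x] by (auto simp: bdist_def)

lemma ball_bdist_subset: "ball x (bdist T \<Omega> x) \<subseteq> \<Omega>"
  using infdist_le[of _ "- \<Omega>" x] by (force simp: bdist_def split: if_splits)

lemma bdist_ge:
  assumes "ball x e \<subseteq> \<Omega>"
  shows "min T e \<le> bdist T \<Omega> x"
proof (cases "\<Omega> = UNIV")
  case False
  then have "e \<le> infdist x (- \<Omega>)"
  proof (subst infdist_notempty)
    show "e \<le> (INF a\<in>- \<Omega>. dist x a)"
      using assms False by (intro cINF_greatest) (auto simp flip: not_less)
  qed (use False in auto)
  then show ?thesis using False by (auto simp: bdist_def)
qed (simp add: bdist_def)

lemma bdist_eq_min: "S \<le> T \<Longrightarrow> bdist S \<Omega> x = min S (bdist T \<Omega> x)"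
  by (auto simp: bdist_def)

text \<open>The divisor puts the cube of half side \<open>2 * r x\<close> well inside the ball of
  radius \<open>m x\<close>, hence inside \<Omega>, and makes the radius 1/8-Lipschitz, which the
  comparison of kernels requires.\<close>

definition smoothing_radius :: "real \<Rightarrow> (real ^ 'n) set \<Rightarrow> real ^ 'n \<Rightarrow> real" where
  "smoothing_radius \<tau> \<Omega> x = bdist \<tau> \<Omega> x / (8 * real CARD('n))"

definition smoothed :: "real \<Rightarrow> (real ^ 'n) set \<Rightarrow> (real ^ 'n \<Rightarrow> real) \<Rightarrow> real ^ 'n \<Rightarrow> real" where
  "smoothed \<tau> \<Omega> f x = tent_mean (smoothing_radius \<tau> \<Omega> x) f x"

text \<open>\<open>20 * k\<close> compares the side \<open>4 * r i\<close> with that of the cube of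
  half side \<open>r i / (10 * k)\<close> inside a Vitali ball; \<open>1 + k\<close> is the dilation
  of the given cube that contains all these small cubes.\<close>

definition vitali_const :: "nat \<Rightarrow> real" where
  "vitali_const k = (1 + tent_const k) * (20 * real k * (1 + real k)) ^ k"

locale smoothing =
  fixes \<Omega> :: "(real ^ 'n) set" and f :: "real ^ 'n \<Rightarrow> real" and \<tau> :: real
  assumes open_dom: "open \<Omega>" and \<tau>_pos: "0 < \<tau>" and locint_f: "locint \<Omega> f"
begin

abbreviation "m \<equiv> bdist \<tau> \<Omega>"
abbreviation "r \<equiv> smoothing_radius \<tau> \<Omega>"
abbreviation "u \<equiv> smoothed \<tau> \<Omega> f"

lemma n_ge_1: "real CARD('n) \<ge> 1" by simp

lemma m_pos: "x \<in> \<Omega> \<Longrightarrow> 0 < m x"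
  using bdist_pos[OF open_dom \<tau>_pos] .

lemma m_eq: "m x = 8 * real CARD('n) * r x"
  by (simp add: smoothing_radius_def)

lemma r_pos: "x \<in> \<Omega> \<Longrightarrow> 0 < r x"
  using m_pos by (simp add: smoothing_radius_def)

lemma r_le: "r x \<le> m x / 8" if "x \<in> \<Omega>"
proof -
  have "1 * r x \<le> real CARD('n) * r x" using r_pos[OF that] n_ge_1 by (intro mult_right_mono) auto
  then show ?thesis by (simp add: m_eq)
qed

lemma r_lipschitz: "\<bar>r x - r y\<bar> \<le> dist x y / 8"
proof -
  have "\<bar>r x - r y\<bar> = \<bar>m x - m y\<bar> / (8 * real CARD('n))"
    by (simp add: smoothing_radius_def diff_divide_distrib[symmetric])
  also have "\<dots> \<le> dist x y / (8 * real CARD('n))" by (intro divide_right_mono bdist_lipschitz) auto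
  also have "\<dots> \<le> dist x y / 8" using n_ge_1 by (intro divide_left_mono) auto
  finally show ?thesis .
qed

lemma cub_r_subset: "cub x (2 * r x) \<subseteq> ball x (m x)" if "x \<in> \<Omega>"
proof -
  have "real CARD('n) * (2 * r x) < m x" using r_pos[OF that] m_eq[of x] by simp
  then have "cball x (real CARD('n) * (2 * r x)) \<subseteq> ball x (m x)" by auto
  with cub_subset_cball show ?thesis by (rule subset_trans)
qed

lemma cub_r_subset_dom: "x \<in> \<Omega> \<Longrightarrow> cub x (2 * r x) \<subseteq> \<Omega>"
  using cub_r_subset ball_bdist_subset by blast

lemma int_f: "x \<in> \<Omega> \<Longrightarrow> integrable (lebesgue_on (cub x (2 * r x))) f"
  using locint_f cub_r_subset_dom[of x] r_pos[of x] by auto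

lemma r_small: "4 * r x < \<tau>" if "x \<in> \<Omega>"
  using r_le[OF that] m_pos[OF that] bdist_le[of \<tau> \<Omega> x] by simp

text \<open>The set \<open>U\<close> allows the oscillation to be measured only near
  \<open>x\<close>: with \<Omega> it is the global bound, with \<Omega> minus a large ball the
  smaller one far out.\<close>

lemma smoothed_estimates:
  assumes x: "x \<in> \<Omega>" and W: "osc U f \<tau> \<le> ennreal W" "0 \<le> W"
    and U: "cub x (2 * r x) \<subseteq> U" and y: "dist x y \<le> r x / 2"
  shows "\<bar>u y - cube_mean (cub x (2 * r x)) f\<bar> \<le> tent_const CARD('n) * W"
    and "\<bar>u x - u y\<bar> \<le> tent_const CARD('n) * W * (dist x y / r x)"
proof -
  have 1: "(LINT y|lebesgue_on (cub x (2 * r x)). \<bar>f y - cube_mean (cub x (2 * r x)) f\<bar>)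
      \<le> W * (4 * r x) ^ CARD('n)"
    using dev_mean_le_osc(1)[OF int_f[OF x] _ _ U W] r_pos[OF x] r_small[OF x] by simp
  have "\<bar>r x - r y\<bar> \<le> dist x y" using r_lipschitz[of x y] zero_le_dist[of x y] by linarith
  from tent_mean_estimates[OF int_f[OF x] 1 r_pos[OF x] this y]
  show "\<bar>u y - cube_mean (cub x (2 * r x)) f\<bar> \<le> tent_const CARD('n) * W"
    and "\<bar>u x - u y\<bar> \<le> tent_const CARD('n) * W * (dist x y / r x)" by (simp_all add: smoothed_def)
qed

lemma smoothed_abs_le:
  assumes x: "x \<in> \<Omega>" and B: "(LINT y|lebesgue_on (cub x (2 * r x)). \<bar>f y\<bar>)
      \<le> B * (4 * r x) ^ CARD('n)"
  shows "\<bar>u x\<bar> \<le> tent_const CARD('n) * B"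
  using tent_mean_estimates(1)[OF int_f[OF x], of 0 B "r x" x] B r_pos[OF x]
      by (simp add: smoothed_def)

text \<open>No bound on the oscillation is at hand here, so the kernel estimate is applied with the
  constant \<open>0\<close> and the mean of \<open>\<bar>f\<bar>\<close> on one cube around
  \<open>x\<close>.\<close>

lemma continuous_smoothed: "continuous_on \<Omega> u"
  unfolding continuous_on_iff
proof (intro ballI allI impI)
  fix x and e :: real assume x: "x \<in> \<Omega>" and e: "0 < e"
  let ?A = "LINT y|lebesgue_on (cub x (2 * r x)). \<bar>f y\<bar>"
  define W where "W = ?A / (4 * r x) ^ CARD('n)"
  note rx = r_pos[OF x]
  have A: "(LINT y|lebesgue_on (cub x (2 * r x)). \<bar>f y - 0\<bar>) \<le> W * (4 * r x) ^ CARD('n)"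
    using rx by (simp add: W_def)
  define C where "C = tent_const CARD('n) * W / r x"
  have C0: "0 \<le> C" using rx by (simp add: C_def W_def tent_const_def)
  show "\<exists>d>0. \<forall>x'\<in>\<Omega>. dist x' x < d \<longrightarrow> dist (u x') (u x) < e"
  proof (intro exI[of _ "min (r x / 2) (e / (C + 1))"] conjI ballI impI)
    fix y assume "dist y x < min (r x / 2) (e / (C + 1))"
    then have d: "dist x y \<le> r x / 2" "dist x y < e / (C + 1)" by (auto simp: dist_commute)
    have "\<bar>r x - r y\<bar> \<le> dist x y" using r_lipschitz[of x y] zero_le_dist[of x y] by linarith
    then have "\<bar>u x - u y\<bar> \<le> tent_const CARD('n) * W * (dist x y / r x)"
      using tent_mean_estimates(2)[OF int_f[OF x] A rx _ d(1)] by (simp add: smoothed_def)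
    also have "\<dots> = C * dist x y" by (simp add: C_def)
    also have "\<dots> \<le> (C + 1) * dist x y" by (intro mult_right_mono) auto
    also have "\<dots> < e" using d(2) C0 by (simp add: field_simps)
    finally show "dist (u y) (u x) < e" by (simp add: dist_real_def abs_minus_commute)
  qed (use rx e C0 in auto)
qed

lemma measurable_smoothed:
  assumes "Q \<subseteq> \<Omega>" "Q \<in> sets lebesgue"
  shows "u \<in> borel_measurable (lebesgue_on Q)"
  using assms continuous_smoothed continuous_imp_measurable_on_sets_lebesgue continuous_on_subset by blast

text \<open>A Vitali covering of the cube by balls on which \<open>r\<close> is essentially constant.\<close>

lemma dev_smoothed:
  assumes W: "osc \<Omega> f \<tau> \<le> ennreal W" "0 \<le> W"
    and h: "0 < h" and Q: "cub q h \<subseteq> \<Omega>" and big: "r q \<le> 2 * real CARD('n) * h"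
  shows "dev (cub q h) (\<lambda>x. f x - u x) 0 \<le> ennreal (vitali_const CARD('n) * W * (2 * h) ^ CARD('n))"
proof -
  let ?Q = "cub q h"
  let ?F = "\<lambda>x. ennreal \<bar>f x - u x\<bar>"
  \<comment> \<open>The Vitali lemma asks for uniformly bounded radii; \<open>big\<close> and the
    Lipschitz bound for \<open>r\<close> supply them.\<close>
  have rQ: "r x \<le> 4 * real CARD('n) * h" if "x \<in> ?Q" for x
  proof -
    have "dist q x \<le> real CARD('n) * h" using that cub_subset_cball[of q h] by auto
    then have "r x \<le> r q + real CARD('n) * h / 8" using r_lipschitz[of q x] by linarith
    moreover have "0 \<le> real CARD('n) * h" using h by simp
    ultimately show ?thesis using big by linarith
  qed
  have cov: "?Q \<subseteq> (\<Union>x\<in>?Q. cball x (r x / 10))" 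
    using r_pos Q by (force intro: less_imp_le)
  obtain C where C: "countable C" "C \<subseteq> ?Q"
      "pairwise (\<lambda>i j. disjnt (cball i (r i / 10)) (cball j (r j / 10))) C"
      "?Q \<subseteq> (\<Union>i\<in>C. cball i (5 * (r i / 10)))"
    using r_pos rQ Q by (rule_tac Vitali_covering_lemma_cballs[OF cov, of "4 * real CARD('n) * h"]) force+
  \<comment> \<open>Five times the Vitali radius \<open>r i / 10\<close> is \<open>r i / 2\<close>,
    the range in which \<open>smoothed_estimates\<close> applies.\<close>
  define E where "E i = cball i (r i / 2)" for i
  have EQ: "?Q \<subseteq> (\<Union>i\<in>C. E i)" using C(4) by (simp add: E_def)
  have fu: "(\<lambda>x. f x - u x) \<in> borel_measurable (lebesgue_on ?Q)"
    using measurable_smoothed[OF Q] locint_f h Q by (intro borel_measurable_diff) auto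
  then have F: "?F \<in> borel_measurable (lebesgue_on ?Q)" by measurable
  have Em: "E i \<inter> ?Q \<in> sets (lebesgue_on ?Q)" for i
    by (auto simp: sets_restrict_space_iff E_def)
  define K where "K = (1 + tent_const CARD('n)) * W"
  have K0: "0 \<le> K" using W by (simp add: K_def tent_const_def)
  have piece: "(\<integral>\<^sup>+x. ?F x * indicator (E i \<inter> ?Q) x \<partial>lebesgue_on ?Q)
      \<le> ennreal (K * (20 * real CARD('n)) ^ CARD('n)) * emeasure lebesgue (cub i (r i / (10 * real CARD('n))))" if i: "i \<in> C" for i
  proof -
    have iQ: "i \<in> \<Omega>" using i C Q by auto
    let ?S = "cub i (2 * r i)" and ?m = "cube_mean (cub i (2 * r i)) f"
    note ri = r_pos[OF iQ]
    have "(\<integral>\<^sup>+x. ?F x * indicator (E i \<inter> ?Q) x \<partial>lebesgue_on ?Q)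
        = (\<integral>\<^sup>+x. ?F x * indicator (E i \<inter> ?Q) x \<partial>lebesgue)"
      by (subst nn_integral_restrict_space) (auto intro!: nn_integral_cong split: split_indicator)
    also have "\<dots> \<le> (\<integral>\<^sup>+x. (ennreal \<bar>f x - ?m\<bar> + ennreal (tent_const CARD('n) * W)) * indicator ?S x \<partial>lebesgue)"
    proof (rule nn_integral_mono)
      fix x
      show "?F x * indicator (E i \<inter> ?Q) x
          \<le> (ennreal \<bar>f x - ?m\<bar> + ennreal (tent_const CARD('n) * W)) * indicator ?S x"
      proof (cases "x \<in> E i")
        case True
        then have d: "dist i x \<le> r i / 2" by (simp add: E_def)
        have "x \<in> ?S" using d ri cball_subset_cub[of i "2 * r i"] by auto
        moreover have "\<bar>f x - u x\<bar> \<le> \<bar>f x - ?m\<bar> + tent_const CARD('n) * W"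
          using smoothed_estimates(1)[OF iQ W cub_r_subset_dom[OF iQ] d] by linarith
        then have "?F x \<le> ennreal (\<bar>f x - ?m\<bar> + tent_const CARD('n) * W)" by (rule ennreal_leI)
        ultimately show ?thesis using W by (auto simp: tent_const_def split: split_indicator)
      qed auto
    qed
    also have "\<dots> = (\<integral>\<^sup>+x. ennreal \<bar>f x - ?m\<bar> + ennreal (tent_const CARD('n) * W) \<partial>lebesgue_on ?S)"
      by (subst nn_integral_restrict_space) auto
    also have "\<dots> = dev ?S f ?m + ennreal (tent_const CARD('n) * W) * emeasure lebesgue ?S"
      unfolding dev_def using int_f[OF iQ] ri
      by (subst nn_integral_add) (auto simp: emeasure_restrict_space simp del: emeasure_completion)
    also have "\<dots> \<le> ennreal (W * (2 * (2 * r i)) ^ CARD('n)) + ennreal (tent_const CARD('n) * W) * emeasure lebesgue ?S"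
      using ri r_small[OF iQ]
      by (intro add_right_mono dev_mean_le_osc(2)[OF int_f[OF iQ] _ _ cub_r_subset_dom[OF iQ] W]) auto
    also have "\<dots> = ennreal (K * (4 * r i) ^ CARD('n))"
      using ri W by (simp add: emeasure_cub K_def ennreal_mult'[symmetric] ennreal_plus[symmetric] tent_const_def
          algebra_simps del: emeasure_completion ennreal_plus)
    also have "\<dots> = ennreal (K * (20 * real CARD('n)) ^ CARD('n)) * ennreal ((2 * (r i / (10 * real CARD('n)))) ^ CARD('n))"
    proof -
      have e: "4 * r i = (20 * real CARD('n)) * (2 * (r i / (10 * real CARD('n))))" by simp
      have "(4 * r i) ^ CARD('n)
          = (20 * real CARD('n)) ^ CARD('n) * (2 * (r i / (10 * real CARD('n)))) ^ CARD('n)"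
        unfolding e by (rule power_mult_distrib)
      then have p: "K * (4 * r i) ^ CARD('n)
          = K * (20 * real CARD('n)) ^ CARD('n) * (2 * (r i / (10 * real CARD('n)))) ^ CARD('n)" by simp
      have "0 \<le> 2 * (r i / (10 * real CARD('n)))" using ri by simp
      then show ?thesis unfolding p by (intro ennreal_mult'' zero_le_power)
    qed
    also have "\<dots> = ennreal (K * (20 * real CARD('n)) ^ CARD('n)) * emeasure lebesgue (cub i (r i / (10 * real CARD('n))))"
      using ri by (subst emeasure_cub) auto
    finally show ?thesis .
  qed
  have sub: "cub i (r i / (10 * real CARD('n))) \<subseteq> cball i (r i / 10)" for i :: "real ^ 'n"
    using cub_subset_cball[of i "r i / (10 * real CARD('n))"] by simp
  have disj: "disjoint_family_on (\<lambda>i. cub i (r i / (10 * real CARD('n)))) C"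
    using C(3) sub unfolding disjoint_family_on_def pairwise_def disjnt_def by blast
  \<comment> \<open>The disjoint small cubes may leave \<open>?Q\<close> but stay in a fixed dilate
    of it, whose volume bounds the sum of theirs.\<close>
  have subQ: "cub i (r i / (10 * real CARD('n))) \<subseteq> cub q ((1 + real CARD('n)) * h)" if "i \<in> C" for i
  proof
    fix x assume x: "x \<in> cub i (r i / (10 * real CARD('n)))"
    have "r i / (10 * real CARD('n)) \<le> (4 * real CARD('n) * h) / (10 * real CARD('n))"
        using C(2) that rQ by (intro divide_right_mono) auto
    also have "\<dots> \<le> 1 * h" using h by simp
    also have "\<dots> \<le> real CARD('n) * h" using h n_ge_1 by (intro mult_right_mono) auto
    finally have *: "r i / (10 * real CARD('n)) \<le> real CARD('n) * h" .
    have 1: "\<bar>i $ j - q $ j\<bar> \<le> h" for j using C(2) that by (auto simp: mem_cub)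
    have 2: "\<bar>x $ j - i $ j\<bar> \<le> real CARD('n) * h" for j using x * unfolding mem_cub
        by (meson order_trans)
    have "\<bar>x $ j - q $ j\<bar> \<le> h + real CARD('n) * h" for j
      using 1[of j] 2[of j] by linarith
    then show "x \<in> cub q ((1 + real CARD('n)) * h)"
      unfolding mem_cub by (simp add: distrib_right)
  qed
  have "dev ?Q (\<lambda>x. f x - u x) 0 = (\<integral>\<^sup>+x. ?F x \<partial>lebesgue_on ?Q)"
    by (simp add: dev_def)
  \<comment> \<open>The sum over the covering is written as an integral over
    \<open>count_space C\<close>; countability of \<open>C\<close> then permits exchanging it with
    the integral over the cube.\<close>
  also have "\<dots> \<le> (\<integral>\<^sup>+x. \<integral>\<^sup>+i. ?F x * indicator (E i \<inter> ?Q) x \<partial>count_space C \<partial>lebesgue_on ?Q)"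
  proof (rule nn_integral_mono)
    fix x assume "x \<in> space (lebesgue_on ?Q)"
    then have "x \<in> ?Q" by simp
    with EQ obtain i where i: "i \<in> C" "x \<in> E i" by blast
    have "?F x = (\<integral>\<^sup>+j. ?F x * indicator {i} j \<partial>count_space C)"
      using i by (subst nn_integral_cmult_indicator) auto
    also have "\<dots> \<le> (\<integral>\<^sup>+j. ?F x * indicator (E j \<inter> ?Q) x \<partial>count_space C)"
      using i \<open>x \<in> ?Q\<close> by (intro nn_integral_mono) (auto split: split_indicator)
    finally show "?F x \<le> (\<integral>\<^sup>+i. ?F x * indicator (E i \<inter> ?Q) x \<partial>count_space C)" .
  qed
  also have "\<dots> = (\<integral>\<^sup>+i. \<integral>\<^sup>+x. ?F x * indicator (E i \<inter> ?Q) x \<partial>lebesgue_on ?Q \<partial>count_space C)"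
    by (intro nn_integral_count_space_nn_integral C borel_measurable_times_ennreal F
        borel_measurable_indicator Em)
  also have "\<dots> \<le> (\<integral>\<^sup>+i. ennreal (K * (20 * real CARD('n)) ^ CARD('n)) * emeasure lebesgue (cub i (r i / (10 * real CARD('n)))) \<partial>count_space C)"
    using piece by (intro nn_integral_mono) auto
  also have "\<dots> = ennreal (K * (20 * real CARD('n)) ^ CARD('n)) * (\<integral>\<^sup>+i. emeasure lebesgue (cub i (r i / (10 * real CARD('n)))) \<partial>count_space C)"
    by (rule nn_integral_cmult) auto
  also have "(\<integral>\<^sup>+i. emeasure lebesgue (cub i (r i / (10 * real CARD('n)))) \<partial>count_space C)
      = emeasure lebesgue (\<Union>i\<in>C. cub i (r i / (10 * real CARD('n))))"
    by (rule emeasure_UN_countable[symmetric]) (use C disj in auto)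
  also have "\<dots> \<le> emeasure lebesgue (cub q ((1 + real CARD('n)) * h))"
    using subQ by (intro emeasure_mono) auto
  also have "\<dots> = ennreal ((2 * ((1 + real CARD('n)) * h)) ^ CARD('n))"
    using h by (intro emeasure_cub) auto
  also have "ennreal (K * (20 * real CARD('n)) ^ CARD('n)) * \<dots>
      = ennreal (vitali_const CARD('n) * W * (2 * h) ^ CARD('n))"
  proof -
    have "(K * (20 * real CARD('n)) ^ CARD('n)) * (2 * ((1 + real CARD('n)) * h)) ^ CARD('n)
        = vitali_const CARD('n) * W * (2 * h) ^ CARD('n)"
      unfolding K_def vitali_const_def by (simp only: power_mult_distrib) (simp add: algebra_simps)
    note eq = this
    have "0 \<le> 2 * ((1 + real CARD('n)) * h)" using h by simp
    then show ?thesis unfolding eq[symmetric] by (intro ennreal_mult''[symmetric] zero_le_power)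
  qed
  finally show ?thesis by (simp add: mult_left_mono)
qed

end

subsection \<open>Soft thresholding with a logarithmic barrier\<close>

definition truncate :: "real \<Rightarrow> real \<Rightarrow> real" where
  "truncate a k = max (- k) (min k a)"

text \<open>Joint nonexpansiveness is what makes thresholding at a variable level cheap:
  oscillations of value and level add and are never multiplied by the size of the function.\<close>

lemma truncate_diff: "\<bar>truncate a k - truncate b l\<bar> \<le> \<bar>a - b\<bar> + \<bar>k - l\<bar>"
  unfolding truncate_def by linarith

lemma abs_truncate_le: "0 \<le> k \<Longrightarrow> \<bar>truncate a k\<bar> \<le> k"
  unfolding truncate_def by linarith

lemma abs_diff_truncate: "0 \<le> k \<Longrightarrow> \<bar>a - truncate a k\<bar> = max 0 (\<bar>a\<bar> - k)"
  unfolding truncate_def by linarith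

context smoothing
begin

lemma measurable_m: "Q \<in> sets lebesgue \<Longrightarrow> m \<in> borel_measurable (lebesgue_on Q)"
proof (rule continuous_imp_measurable_on_sets_lebesgue)
  show "continuous_on Q m"
    unfolding continuous_on_iff
  proof (intro ballI allI impI)
    fix x e assume "0 < (e::real)"
    then show "\<exists>d>0. \<forall>y\<in>Q. dist y x < d \<longrightarrow> dist (m y) (m x) < e"
      using bdist_lipschitz[of \<tau> \<Omega>] unfolding dist_real_def
          by (intro exI[of _ e]) (meson le_less_trans)
  qed
qed

text \<open>The cube is exhausted by the concentric cubes \<open>cub q (h * (1 - (1/2) ^ k))\<close>, whose
  points have distance at least \<open>h * (1/2) ^ k\<close> to the complement of \<open>\<Omega>\<close>.\<close>

lemma log_bdist_integral:
  assumes h: "0 < h" and Q: "cub q h \<subseteq> \<Omega>" and l: "0 < l" "l \<le> \<tau>" "l \<le> c * h" and c: "1 \<le> c"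
  shows "(\<integral>\<^sup>+x. ennreal (ln (l / m x)) \<partial>lebesgue_on (cub q h))
    \<le> ennreal ((ln c + 2 * real CARD('n)) * (2 * h) ^ CARD('n))"
proof -
  let ?Q = "cub q h" and ?n = "real CARD('n)" and ?N = "CARD('n)"
  define S where "S k = cub q (h * (1 - (1/2) ^ k))" for k :: nat
  have p: "0 \<le> 1 - (1/2::real) ^ k" "1 - (1/2::real) ^ k \<le> 1" for k :: nat
    by (auto simp: power_le_one)
  have SQ: "S k \<subseteq> ?Q" for k unfolding S_def using h p[of k]
      by (intro cub_mono) (auto simp: mult_left_le)
  have point: "ennreal (ln (l / m x))
      \<le> ennreal (ln c) + (\<Sum>k. indicator (?Q - S k) x)" if x: "x \<in> ?Q" for x
  proof (cases "\<exists>k. x \<in> S k")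
    \<comment> \<open>Such points lie on the boundary of the cube. Every shell contains them, so the
      right side is infinite.\<close>
    case False
    then have "indicator (?Q - S k) x = (1::ennreal)" for k using x by auto
    then have "(\<Sum>k. indicator (?Q - S k) x :: ennreal) = (\<Sum>k::nat. 1)" by simp
    also have "\<dots> = top" using nn_integral_count_space_nat[of "\<lambda>_. 1"] by simp
    finally show ?thesis by simp
  next
    case True
    \<comment> \<open>\<open>x\<close> lies outside the first \<open>k\<close> cubes, so the sum is
      at least \<open>k\<close>; and a ball of radius \<open>h * (1/2) ^ k\<close> around
      \<open>x\<close> fits into the cube, so the logarithm is at most
      \<open>ln c + k * ln 2\<close>.\<close>
    define k where "k = (LEAST k. x \<in> S k)"
    have xk: "x \<in> S k" unfolding k_def using True by (rule LeastI_ex)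
    have j: "x \<notin> S j" if "j < k" for j using that not_less_Least unfolding k_def by blast
    have "ball x (h * (1/2) ^ k) \<subseteq> ?Q"
    proof
      fix y assume "y \<in> ball x (h * (1/2) ^ k)"
      then have "y \<in> cub x (h * (1/2) ^ k)" using cball_subset_cub[of x "h * (1/2) ^ k"] by auto
      then have *: "\<bar>y $ i - x $ i\<bar> \<le> h * (1/2) ^ k" "\<bar>x $ i - q $ i\<bar> \<le> h * (1 - (1/2) ^ k)" for i
        using xk by (auto simp: mem_cub S_def)
      then have "\<bar>y $ i - q $ i\<bar> \<le> h * (1/2) ^ k + h * (1 - (1/2) ^ k)" for i
        using *[of i] by linarith
      then show "y \<in> ?Q" by (simp add: mem_cub algebra_simps)
    qed
    then have mx: "min \<tau> (h * (1/2) ^ k) \<le> m x" using Q by (intro bdist_ge) auto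
    have m0: "0 < m x" using x Q m_pos by auto
    have "l \<le> c * 2 ^ k * m x"
    proof (cases "\<tau> \<le> h * (1/2) ^ k")
      case True
      then have "l \<le> 1 * m x" using l mx by simp
      also have "\<dots> \<le> c * 2 ^ k * m x"
        using c m0 by (intro mult_right_mono) (auto intro: order_trans[OF c] simp: mult_le_cancel_left1)
      finally show ?thesis .
    next
      case False
      then have "h * (1/2) ^ k \<le> m x" using mx by simp
      then have "c * 2 ^ k * (h * (1/2) ^ k) \<le> c * 2 ^ k * m x" using c
          by (intro mult_left_mono) auto
      also have "c * 2 ^ k * (h * (1/2) ^ k) = c * h" by (simp add: power_one_over)
      finally show ?thesis using l by linarith
    qed
    then have "ln (l / m x) \<le> ln (c * 2 ^ k)"
      using m0 l c by (subst ln_le_cancel_iff) (auto simp: field_simps)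
    also have "\<dots> = ln c + k * ln 2" using c by (simp add: ln_mult ln_realpow)
    also have "\<dots> \<le> ln c + k" using ln_2_less_1 by (simp add: mult_left_le)
    finally have "ennreal (ln (l / m x)) \<le> ennreal (ln c + k)" by (rule ennreal_leI)
    also have "\<dots> = ennreal (ln c) + of_nat k" using c by (simp add: ennreal_of_nat_eq_real_of_nat)
    also have "of_nat k = (\<Sum>j<k. indicator (?Q - S j) x :: ennreal)" using j x by simp
    also have "\<dots> \<le> (\<Sum>j. indicator (?Q - S j) x)" by (rule sum_le_suminf) auto
    finally show ?thesis by (simp add: add_left_mono)
  qed
  \<comment> \<open>By Bernoulli, \<open>1 - (1 - t) ^ n \<le> n * t\<close>. Summing over
    \<open>t = (1/2) ^ k\<close> gives the \<open>2 * n\<close> of the conclusion.\<close>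
  have shell: "emeasure lebesgue (?Q - S k) \<le> ennreal (?n * (2 * h) ^ ?N * (1/2) ^ k)" for k
  proof -
    have "emeasure lebesgue (?Q - S k)
        = ennreal ((2 * h) ^ ?N) - ennreal ((2 * (h * (1 - (1/2) ^ k))) ^ ?N)"
      using SQ[of k] h p[of k] unfolding S_def
      by (subst emeasure_Diff) (auto simp: emeasure_cub simp del: emeasure_completion power_mult_distrib)
    also have "\<dots> = ennreal ((2 * h) ^ ?N - (2 * h) ^ ?N * (1 - (1/2) ^ k) ^ ?N)"
      using h p[of k] by (subst ennreal_minus) (auto simp: power_mult_distrib mult.assoc)
    also have "\<dots> \<le> ennreal (?n * (2 * h) ^ ?N * (1/2) ^ k)"
    proof (rule ennreal_leI)
      have "1 + ?n * (- ((1/2) ^ k)) \<le> (1 + (- ((1/2::real) ^ k))) ^ ?N"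
        using p[of k] by (intro Bernoulli_inequality) auto
      then have "(2 * h) ^ ?N * (1 + ?n * (- ((1/2) ^ k)))
          \<le> (2 * h) ^ ?N * (1 - (1/2::real) ^ k) ^ ?N"
        using h by (intro mult_left_mono) auto
      then show "(2 * h) ^ ?N - (2 * h) ^ ?N * (1 - (1/2) ^ k) ^ ?N \<le> ?n * (2 * h) ^ ?N * (1/2) ^ k"
        by (simp add: algebra_simps)
    qed
    finally show ?thesis .
  qed
  have meas: "?Q - S k \<in> sets (lebesgue_on ?Q)" for k
    by (auto simp: sets_restrict_space_iff S_def)
  have "(\<integral>\<^sup>+x. ennreal (ln (l / m x)) \<partial>lebesgue_on ?Q)
      \<le> (\<integral>\<^sup>+x. ennreal (ln c) + (\<Sum>k. indicator (?Q - S k) x) \<partial>lebesgue_on ?Q)"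
    using point by (intro nn_integral_mono) auto
  also have "\<dots> = (\<integral>\<^sup>+x. ennreal (ln c) \<partial>lebesgue_on ?Q) + (\<Sum>k. \<integral>\<^sup>+x. indicator (?Q - S k) x \<partial>lebesgue_on ?Q)"
    using meas by (subst nn_integral_add, simp, intro borel_measurable_suminf_order borel_measurable_indicator, simp)
       (subst nn_integral_suminf, auto)
  also have "(\<integral>\<^sup>+x. ennreal (ln c) \<partial>lebesgue_on ?Q) = ennreal (ln c * (2 * h) ^ ?N)"
    using h c by (simp add: emeasure_restrict_space emeasure_cub ennreal_mult'' del: emeasure_completion)
  also have "(\<lambda>k. \<integral>\<^sup>+x. indicator (?Q - S k) x \<partial>lebesgue_on ?Q)
      = (\<lambda>k. emeasure lebesgue (?Q - S k))"
    using meas by (intro ext) (simp add: emeasure_restrict_space del: emeasure_completion)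
  also have "(\<Sum>k. emeasure lebesgue (?Q - S k)) \<le> (\<Sum>k. ennreal (?n * (2 * h) ^ ?N * (1/2) ^ k))"
    by (intro suminf_le shell) auto
  also have "\<dots> = ennreal (?n * (2 * h) ^ ?N * 2)"
  proof (rule suminf_ennreal_eq)
    show "(\<lambda>k. ?n * (2 * h) ^ ?N * (1/2) ^ k) sums (?n * (2 * h) ^ ?N * 2)"
      using geometric_sums[of "1/2::real"] by (intro sums_mult) auto
  qed (use h in auto)
  also have "ennreal (ln c * (2 * h) ^ ?N) + ennreal (?n * (2 * h) ^ ?N * 2)
      = ennreal ((ln c + 2 * ?n) * (2 * h) ^ ?N)"
    using h c by (subst ennreal_plus[symmetric]) (auto simp: algebra_simps)
  finally show ?thesis by (simp add: add_left_mono)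
qed

end

section \<open>Mean oscillation of the error left by soft thresholding\<close>

lemma abs_diff_shift_le: "\<bar>a - (b - t) - 0\<bar> \<le> 2 * \<bar>a - b\<bar> + \<bar>t :: real\<bar>"
  by (smt (verit))

text \<open>Dominates every factor in the next two estimates: \<open>W\<close> is multiplied by
  \<open>1 + 2 * tent_const k\<close> on small cubes and by \<open>2 * vitali_const k + 1\<close> on
  large ones, \<open>B\<close> by \<open>1\<close> and by
  \<open>ln (32 * k^2) + 2 * k\<close>.\<close>

definition approx_const :: "nat \<Rightarrow> real" where
  "approx_const k = 2 * vitali_const k + 2 * tent_const k + 32 * (real k)\<^sup>2 + 2 * real k + 1"

lemma tent_const_nonneg: "0 \<le> tent_const k" by (simp add: tent_const_def)
lemma vitali_const_nonneg: "0 \<le> vitali_const k" by (simp add: vitali_const_def tent_const_nonneg)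

context smoothing
begin

text \<open>Zero where the distance to the boundary is at least \<tau>, and larger by
  \<open>B * ln 2\<close> for each halving of \<open>m x\<close>, in step with the growth of
  \<open>u\<close> along a climb.\<close>

definition barrier :: "real \<Rightarrow> real ^ 'n \<Rightarrow> real" where
  "barrier B x = B * ln (\<tau> / m x)"

definition soft_threshold :: "real \<Rightarrow> real ^ 'n \<Rightarrow> real" where
  "soft_threshold B x = u x - truncate (u x) (barrier B x)"

lemma barrier_nonneg: "0 \<le> B \<Longrightarrow> x \<in> \<Omega> \<Longrightarrow> 0 \<le> barrier B x"
  using m_pos[of x] bdist_le[of \<tau> \<Omega> x] by (simp add: barrier_def)

lemma ln_diff_le:
  assumes "0 < a" "a \<le> (b::real)"
  shows "\<bar>ln a - ln b\<bar> \<le> (b - a) / a"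
proof -
  have "ln b - ln a = ln (b / a)" using assms by (simp add: ln_div)
  also have "\<dots> \<le> b / a - 1" using assms by (intro ln_le_minus_one) auto
  also have "\<dots> = (b - a) / a" using assms by (simp add: field_simps)
  finally show ?thesis using assms by simp
qed

lemma barrier_lipschitz:
  assumes "x \<in> \<Omega>" "y \<in> \<Omega>" "0 \<le> B" "0 < a" "a \<le> m x" "a \<le> m y"
  shows "\<bar>barrier B x - barrier B y\<bar> \<le> B * (dist x y / a)"
proof -
  have m: "0 < m x" "0 < m y" using assms by auto
  have "\<bar>ln (m x) - ln (m y)\<bar> \<le> \<bar>m x - m y\<bar> / min (m x) (m y)"
    using ln_diff_le[of "m x" "m y"] ln_diff_le[of "m y" "m x"] m
    by (auto simp: min_def abs_minus_commute)
  also have "\<dots> \<le> dist x y / a"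
    using assms bdist_lipschitz[of \<tau> \<Omega> x y] by (intro frac_le) auto
  finally have "B * \<bar>ln (m x) - ln (m y)\<bar> \<le> B * (dist x y / a)" using assms
      by (intro mult_left_mono)
  moreover have "barrier B x - barrier B y = B * (ln (m y) - ln (m x))"
    using m \<tau>_pos by (simp add: barrier_def ln_div algebra_simps)
  ultimately show ?thesis using assms by (simp add: abs_mult abs_minus_commute)
qed

text \<open>Such a cube lies within \<open>r q / 2\<close> of its centre, where \<open>u\<close>
  varies by \<open>O(W)\<close> and the barrier by at most \<open>B\<close>. Hence subtracting the
  thresholded function from \<open>f\<close> is nearly subtracting a constant.\<close>

lemma dev_small_cube:
  assumes W: "osc \<Omega> f \<tau> \<le> ennreal W" "0 \<le> W" and B: "0 \<le> B"
    and h: "0 < h" and Q: "cub q h \<subseteq> \<Omega>" and small: "2 * real CARD('n) * h < r q"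
  shows "\<exists>c. dev (cub q h) (\<lambda>x. f x - soft_threshold B x) c
      \<le> ennreal (approx_const CARD('n) * (W + B) * (2 * h) ^ CARD('n))"
proof -
  let ?Q = "cub q h" and ?n = "real CARD('n)" and ?N = "CARD('n)"
  let ?m = "cube_mean (cub q h) f"
  have q: "q \<in> \<Omega>" using Q centre_in_cub[of h q] h by auto
  note rq = r_pos[OF q]
  have "1 * h \<le> ?n * h" using h n_ge_1 by (intro mult_right_mono) auto
  then have "2 * h \<le> r q" using small by simp
  then have ht: "2 * h < \<tau>" using r_small[OF q] rq by linarith
  \<comment> \<open>This is \<open>?m - soft_threshold B q\<close>.\<close>
  define c where "c = ?m - truncate (u q) (barrier B q) * (-1) - u q"
  define K where "K = (2 * tent_const ?N) * W + B"
  have K0: "0 \<le> K" using W B tent_const_nonneg[of ?N] by (simp add: K_def)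
  have pt: "\<bar>f x - soft_threshold B x - c\<bar> \<le> \<bar>f x - ?m\<bar> + K" if x: "x \<in> ?Q" for x
  proof -
    have xO: "x \<in> \<Omega>" using x Q by auto
    have d: "dist q x \<le> r q / 2" using x cub_subset_cball[of q h] small by auto
    have 1: "\<bar>u q - u x\<bar> \<le> tent_const ?N * W * (1/2)"
    proof -
      have "\<bar>u q - u x\<bar> \<le> tent_const ?N * W * (dist q x / r q)"
        by (rule smoothed_estimates(2)[OF q W cub_r_subset_dom[OF q] d])
      also have "\<dots> \<le> tent_const ?N * W * (1/2)"
        using d rq tent_const_nonneg[of ?N] W by (intro mult_left_mono) (auto simp: field_simps)
      finally show ?thesis .
    qed
    have mx: "m q / 2 \<le> m x" using bdist_lipschitz[of \<tau> \<Omega> q x] d r_le[OF q] m_pos[OF q] by linarith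
    have 2: "\<bar>barrier B q - barrier B x\<bar> \<le> B"
    proof -
      have "\<bar>barrier B q - barrier B x\<bar> \<le> B * (dist q x / (m q / 2))"
        using m_pos[OF q] mx by (intro barrier_lipschitz q xO B) auto
      also have "\<dots> \<le> B * 1" using d r_le[OF q] m_pos[OF q] B
          by (intro mult_left_mono) (auto simp: field_simps)
      finally show ?thesis by simp
    qed
    have "0 \<le> tent_const ?N * W" using tent_const_nonneg[of ?N] W by simp
    then show ?thesis
      using 1 2 truncate_diff[of "u q" "barrier B q" "u x" "barrier B x"]
      unfolding soft_threshold_def c_def K_def mult.assoc by linarith
  qed
  have "dev ?Q (\<lambda>x. f x - soft_threshold B x) c
      \<le> (\<integral>\<^sup>+x. ennreal \<bar>f x - ?m\<bar> + ennreal K \<partial>lebesgue_on ?Q)"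
    unfolding dev_def
  proof (rule nn_integral_mono)
    fix x assume "x \<in> space (lebesgue_on ?Q)"
    then have "ennreal \<bar>f x - soft_threshold B x - c\<bar> \<le> ennreal (\<bar>f x - ?m\<bar> + K)"
      using pt by (intro ennreal_leI) auto
    then show "ennreal \<bar>f x - soft_threshold B x - c\<bar> \<le> ennreal \<bar>f x - ?m\<bar> + ennreal K"
        using K0 by simp
  qed
  also have "\<dots> = dev ?Q f ?m + ennreal K * emeasure lebesgue ?Q"
  proof -
    have [measurable]: "f \<in> borel_measurable (lebesgue_on ?Q)"
      using locint_f h Q by (meson borel_measurable_integrable)
    show ?thesis unfolding dev_def
      by (subst nn_integral_add) (auto simp: emeasure_restrict_space simp del: emeasure_completion)
  qed
  also have "\<dots> \<le> ennreal (W * (2 * h) ^ ?N) + ennreal K * emeasure lebesgue ?Q"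
    using h ht Q locint_f by (intro add_right_mono dev_mean_le_osc(2)[OF _ _ _ Q W]) auto
  also have "\<dots> = ennreal ((W + K) * (2 * h) ^ ?N)"
    using h W K0 by (simp add: emeasure_cub ennreal_mult'[symmetric] ennreal_plus[symmetric]
        algebra_simps del: emeasure_completion ennreal_plus)
  also have "\<dots> \<le> ennreal (approx_const ?N * (W + B) * (2 * h) ^ ?N)"
  proof (intro ennreal_leI mult_right_mono)
    have "(1 + 2 * tent_const ?N) * W \<le> approx_const ?N * W"
      using vitali_const_nonneg[of ?N] W(2) unfolding approx_const_def
          by (intro mult_right_mono) auto
    moreover have "1 * B \<le> approx_const ?N * B"
      using vitali_const_nonneg[of ?N] tent_const_nonneg[of ?N] B unfolding approx_const_def
          by (intro mult_right_mono) auto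
    ultimately show "W + K \<le> approx_const ?N * (W + B)" unfolding K_def by (simp add: algebra_simps)
  qed (use h in auto)
  finally show ?thesis by blast
qed

text \<open>Here \<open>f - u\<close> is small in mean by the covering, so only the truncated part
  of \<open>u\<close> remains. It is compared with the mean of \<open>f\<close> truncated at one
  constant level; the excess of the barrier over that level is \<open>B * ln (l / m x)\<close>,
  whose integral is known. The alternative \<open>c = 0\<close> serves the mean part of the
  norm.\<close>

lemma dev_large_cube:
  assumes W: "osc \<Omega> f \<tau> \<le> ennreal W" "0 \<le> W" and B: "0 \<le> B"
    and h: "0 < h" and Q: "cub q h \<subseteq> \<Omega>" and big: "r q \<le> 2 * real CARD('n) * h"
  shows "\<exists>c. (\<tau> \<le> 2 * h \<longrightarrow> c = 0) \<and>
    dev (cub q h) (\<lambda>x. f x - soft_threshold B x) c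
        \<le> ennreal (approx_const CARD('n) * (W + B) * (2 * h) ^ CARD('n))"
proof -
  let ?Q = "cub q h" and ?n = "real CARD('n)" and ?N = "CARD('n)"
  let ?m = "cube_mean (cub q h) f"
  \<comment> \<open>From \<open>r x \<le> 4 * n * h\<close> on the cube and
    \<open>m x = 8 * n * r x\<close> one gets \<open>m x \<le> 32 * n^2 * h\<close>.\<close>
  define C where "C = 32 * ?n\<^sup>2"
  have C2: "2 \<le> C" using one_le_power[OF n_ge_1, of 2] unfolding C_def by linarith
  then have C1: "1 \<le> C" by linarith
  define l where "l = min \<tau> (C * h)"
  have l: "0 < l" "l \<le> \<tau>" "l \<le> C * h" using \<tau>_pos h C1 by (auto simp: l_def)
  \<comment> \<open>The lowest barrier value consistent with \<open>m x \<le> l\<close> on the cube,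
    so the barrier never falls below it there.\<close>
  define k0 where "k0 = B * ln (\<tau> / l)"
  \<comment> \<open>For side at least \<tau> the oscillation bound says nothing about the mean of
    \<open>f\<close>, but then \<open>l = \<tau>\<close> and \<open>k0 = 0\<close>, so truncating at
    \<open>k0\<close> gives zero anyway.\<close>
  define c where "c = (if \<tau> \<le> 2 * h then 0 else truncate ?m k0)"
  have mQ: "m x \<le> l" if "x \<in> ?Q" for x
  proof -
    have "dist q x \<le> ?n * h" using that cub_subset_cball[of q h] by auto
    then have "r x \<le> r q + ?n * h / 8" using r_lipschitz[of q x] by linarith
    moreover have "0 \<le> ?n * h" using h by simp
    ultimately have "r x \<le> 4 * ?n * h" using big by linarith
    then have "8 * ?n * r x \<le> 8 * ?n * (4 * ?n * h)" by (intro mult_left_mono) auto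
    then show ?thesis using bdist_le[of \<tau> \<Omega> x] by (simp add: l_def C_def m_eq power2_eq_square)
  qed
  have pt: "\<bar>f x - soft_threshold B x - c\<bar> \<le> 2 * \<bar>f x - u x\<bar> + (if \<tau>
      \<le> 2 * h then 0 else \<bar>f x - ?m\<bar>) + B * ln (l / m x)"
    if x: "x \<in> ?Q" for x
  proof -
    have mx: "0 < m x" using x Q m_pos by auto
    have kk: "barrier B x - k0 = B * ln (l / m x)"
      using mx l \<tau>_pos by (simp add: barrier_def k0_def ln_div algebra_simps)
    have kk0: "0 \<le> B * ln (l / m x)" using mQ[OF x] mx B by simp
    show ?thesis
    proof (cases "\<tau> \<le> 2 * h")
      case True
      have "C * h \<ge> 2 * h" using C2 h by (intro mult_right_mono) auto
      then have "l = \<tau>" using True by (simp add: l_def)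
      then have "k0 = 0" using \<tau>_pos by (simp add: k0_def)
      then have "\<bar>truncate (u x) (barrier B x)\<bar> \<le> B * ln (l / m x)"
        using kk kk0 abs_truncate_le[of "barrier B x"] by simp
      moreover note abs_diff_shift_le[of "f x" "u x" "truncate (u x) (barrier B x)"]
      ultimately have "\<bar>f x - (u x - truncate (u x) (barrier B x)) - 0\<bar>
          \<le> 2 * \<bar>f x - u x\<bar> + B * ln (l / m x)"
        by (meson add_left_mono order_trans)
      then show ?thesis using True unfolding c_def soft_threshold_def by simp
    next
      case False
      have "\<bar>truncate (u x) (barrier B x) - truncate ?m k0\<bar> \<le> \<bar>u x - ?m\<bar> + B * ln (l / m x)"
        using truncate_diff[of "u x" "barrier B x" ?m k0] kk kk0 by linarith
      moreover have "\<bar>a - (b - t) - s\<bar> \<le> 2 * \<bar>a - b\<bar> + \<bar>a - d\<bar> + e"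
        if "\<bar>t - s\<bar> \<le> \<bar>b - d\<bar> + e" for a b t s d e :: real
        using that by (smt (verit))
      ultimately have "\<bar>f x - (u x - truncate (u x) (barrier B x)) - truncate ?m k0\<bar>
          \<le> 2 * \<bar>f x - u x\<bar> + \<bar>f x - ?m\<bar> + B * ln (l / m x)" by blast
      then show ?thesis using False unfolding c_def soft_threshold_def by simp
    qed
  qed
  have fi: "integrable (lebesgue_on ?Q) f" using locint_f h Q by auto
  have [measurable]: "f \<in> borel_measurable (lebesgue_on ?Q)" using fi by auto
  have [measurable]: "u \<in> borel_measurable (lebesgue_on ?Q)" "m \<in> borel_measurable (lebesgue_on ?Q)"
    using measurable_smoothed[OF Q] measurable_m by auto
  let ?G = "\<lambda>x. (if \<tau> \<le> 2 * h then 0 else ennreal \<bar>f x - ?m\<bar>)"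
  have "dev ?Q (\<lambda>x. f x - soft_threshold B x) c
    \<le> (\<integral>\<^sup>+x. 2 * ennreal \<bar>f x - u x - 0\<bar> + ?G x + ennreal B * ennreal (ln (l / m x)) \<partial>lebesgue_on ?Q)"
    unfolding dev_def
  proof (rule nn_integral_mono)
    fix x assume "x \<in> space (lebesgue_on ?Q)"
    then have x: "x \<in> ?Q" by simp
    have "0 \<le> ln (l / m x)" using mQ[OF x] m_pos x Q by auto
    then have "ennreal (2 * \<bar>f x - u x\<bar> + (if \<tau> \<le> 2 * h then 0 else \<bar>f x - ?m\<bar>) + B * ln (l / m x))
        = 2 * ennreal \<bar>f x - u x - 0\<bar> + ?G x + ennreal B * ennreal (ln (l / m x))"
      using B by (auto simp: ennreal_mult' ennreal_plus)
    then show "ennreal \<bar>f x - soft_threshold B x - c\<bar>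
        \<le> 2 * ennreal \<bar>f x - u x - 0\<bar> + ?G x + ennreal B * ennreal (ln (l / m x))"
      using ennreal_leI[OF pt[OF x]] by simp
  qed
  also have "\<dots> = (\<integral>\<^sup>+x. 2 * ennreal \<bar>f x - u x - 0\<bar> + ?G x \<partial>lebesgue_on ?Q)
      + (\<integral>\<^sup>+x. ennreal B * ennreal (ln (l / m x)) \<partial>lebesgue_on ?Q)"
    by (rule nn_integral_add) measurable
  also have "(\<integral>\<^sup>+x. 2 * ennreal \<bar>f x - u x - 0\<bar> + ?G x \<partial>lebesgue_on ?Q)
      = (\<integral>\<^sup>+x. 2 * ennreal \<bar>f x - u x - 0\<bar> \<partial>lebesgue_on ?Q) + (\<integral>\<^sup>+x. ?G x \<partial>lebesgue_on ?Q)"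
    by (rule nn_integral_add) measurable
  also have "(\<integral>\<^sup>+x. 2 * ennreal \<bar>f x - u x - 0\<bar> \<partial>lebesgue_on ?Q) = 2 * dev ?Q (\<lambda>x. f x - u x) 0"
    unfolding dev_def by (rule nn_integral_cmult) measurable
  also have "(\<integral>\<^sup>+x. ennreal B * ennreal (ln (l / m x)) \<partial>lebesgue_on ?Q)
      = ennreal B * (\<integral>\<^sup>+x. ennreal (ln (l / m x)) \<partial>lebesgue_on ?Q)"
    by (rule nn_integral_cmult) measurable
  also have "2 * dev ?Q (\<lambda>x. f x - u x) 0 + (\<integral>\<^sup>+x. ?G x \<partial>lebesgue_on ?Q)
      + ennreal B * (\<integral>\<^sup>+x. ennreal (ln (l / m x)) \<partial>lebesgue_on ?Q)
    \<le> 2 * ennreal (vitali_const ?N * W * (2 * h) ^ ?N) + ennreal (W * (2 * h) ^ ?N)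
      + ennreal B * ennreal ((ln C + 2 * ?n) * (2 * h) ^ ?N)"
  proof (intro add_mono mult_left_mono)
    show "dev ?Q (\<lambda>x. f x - u x) 0 \<le> ennreal (vitali_const ?N * W * (2 * h) ^ ?N)"
      by (rule dev_smoothed[OF W h Q big])
    show "(\<integral>\<^sup>+x. ennreal (ln (l / m x)) \<partial>lebesgue_on ?Q) \<le> ennreal ((ln C + 2 * ?n) * (2 * h) ^ ?N)"
      by (rule log_bdist_integral[OF h Q l C1])
    show "(\<integral>\<^sup>+x. ?G x \<partial>lebesgue_on ?Q) \<le> ennreal (W * (2 * h) ^ ?N)"
    proof (cases "\<tau> \<le> 2 * h")
      case False
      then show ?thesis
        using dev_mean_le_osc(2)[OF fi h _ Q W] by (simp add: dev_def)
    qed simp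
  qed auto
  also have "\<dots> = ennreal ((2 * vitali_const ?N * W + W + B * (ln C + 2 * ?n)) * (2 * h) ^ ?N)"
  proof -
    define V where "V = (2 * h) ^ ?N"
    have V: "0 \<le> V" using h by (simp add: V_def)
    have lC: "0 \<le> ln C" using C1 by simp
    have "2 * ennreal (vitali_const ?N * W * V) = ennreal (2 * (vitali_const ?N * W * V))"
      by (simp add: ennreal_mult')
    moreover have "ennreal B * ennreal ((ln C + 2 * ?n) * V) = ennreal (B * ((ln C + 2 * ?n) * V))"
      using B by (simp add: ennreal_mult')
    ultimately have "2 * ennreal (vitali_const ?N * W * V) + ennreal (W * V) + ennreal B * ennreal ((ln C + 2 * ?n) * V)
        = ennreal (2 * (vitali_const ?N * W * V) + W * V + B * ((ln C + 2 * ?n) * V))"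
      using V W B lC vitali_const_nonneg[of ?N] by (simp add: ennreal_plus)
    then show ?thesis unfolding V_def by (simp add: algebra_simps)
  qed
  also have "\<dots> \<le> ennreal (approx_const ?N * (W + B) * (2 * h) ^ ?N)"
  proof (intro ennreal_leI mult_right_mono)
    have "(2 * vitali_const ?N + 1) * W \<le> approx_const ?N * W"
      using tent_const_nonneg[of ?N] W(2) unfolding approx_const_def by (intro mult_right_mono) auto
    moreover have "(ln C + 2 * ?n) * B \<le> approx_const ?N * B"
    proof (intro mult_right_mono B)
      have "ln C \<le> C" using C1 ln_bound by auto
      then show "ln C + 2 * ?n \<le> approx_const ?N"
          using vitali_const_nonneg[of ?N] tent_const_nonneg[of ?N]
          unfolding approx_const_def C_def by linarith
    qed
    ultimately show "2 * vitali_const ?N * W + W + B * (ln C + 2 * ?n) \<le> approx_const ?N * (W + B)"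
        by (simp add: algebra_simps)
  qed (use h in auto)
  finally show ?thesis by (intro exI[of _ c]) (auto simp: c_def)
qed

text \<open>Since \<open>4 * r x < \<tau>\<close>, a cube of side at least
  \<open>\<rho> \<ge> \<tau>\<close> always falls under \<open>dev_large_cube\<close>, and there
  with the constant \<open>0\<close>.\<close>

lemma bmo_norm_soft_threshold:
  assumes W: "osc \<Omega> f \<tau> \<le> ennreal W" "0 \<le> W" and B: "0 \<le> B" and "\<tau> \<le> \<rho>"
    and g: "locint \<Omega> (soft_threshold B)"
  shows "bmo_norm \<rho> \<Omega> (\<lambda>x. f x - soft_threshold B x)
      \<le> ennreal (3 * (approx_const CARD('n) * (W + B)))"
proof (rule bmo_norm_le_dev)
  show "locint \<Omega> (\<lambda>x. f x - soft_threshold B x)" using locint_f g by (rule locint_diff)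
  show "0 \<le> approx_const CARD('n) * (W + B)"
    using W B vitali_const_nonneg tent_const_nonneg unfolding approx_const_def
        by (intro mult_nonneg_nonneg add_nonneg_nonneg) auto
next
  fix x h assume h: "0 < (h::real)" "cub x h \<subseteq> \<Omega>"
  show "\<exists>c. dev (cub x h) (\<lambda>x. f x - soft_threshold B x) c
      \<le> ennreal (approx_const CARD('n) * (W + B) * (2 * h) ^ CARD('n))"
    using dev_small_cube[OF W B h] dev_large_cube[OF W B h] by (meson not_le)
next
  fix x h assume h: "0 < (h::real)" "\<rho> \<le> 2 * h" "cub x h \<subseteq> \<Omega>"
  then have "x \<in> \<Omega>" using centre_in_cub[of h x] by auto
  have "1 * h \<le> real CARD('n) * h" using h n_ge_1 by (intro mult_right_mono) auto
  then have "r x \<le> 2 * real CARD('n) * h"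
    using r_small[OF \<open>x \<in> \<Omega>\<close>] r_pos[OF \<open>x \<in> \<Omega>\<close>] h assms(4) by linarith
  then show "dev (cub x h) (\<lambda>x. f x - soft_threshold B x) 0
      \<le> ennreal (approx_const CARD('n) * (W + B) * (2 * h) ^ CARD('n))"
    using dev_large_cube[OF W B h(1,3)] h assms(4) by force
qed

end

subsection \<open>Climbing away from the boundary\<close>

text \<open>By uniform continuity a fine equal subdivision of \<open>[0, s]\<close> has consecutive
  image points within \<open>h\<close>, so the local Lipschitz bound applies to each step; the sum
  of the steps is at most the arclength. Only points on the initial piece need the bound.\<close>

lemma lipschitz_along_curve:
  fixes \<gamma> :: "real \<Rightarrow> 'a::metric_space"
  assumes \<gamma>: "path \<gamma>" and len: "arclength \<gamma> \<le> ennreal A" "0 \<le> A"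
    and s: "0 \<le> s" "s \<le> 1" and h: "0 < h" and L: "0 \<le> L"
    and u: "\<And>t b. 0 \<le> t \<Longrightarrow> t \<le> s \<Longrightarrow> dist (\<gamma> t) b \<le> h \<Longrightarrow> \<bar>u (\<gamma> t) - u b\<bar> \<le> L * dist (\<gamma> t) b"
  shows "\<bar>u (\<gamma> 0) - u (\<gamma> s)\<bar> \<le> L * (A::real)"
proof -
  have "uniformly_continuous_on {0..1} \<gamma>"
    using \<gamma> by (intro compact_uniformly_continuous) (auto simp: path_def)
  then obtain d where d: "0 < d" "\<And>t t'. t \<in> {0..1} \<Longrightarrow> t' \<in> {0..1} \<Longrightarrow> dist t' t < d
      \<Longrightarrow> dist (\<gamma> t') (\<gamma> t) < h"
    unfolding uniformly_continuous_on_def using h by blast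
  obtain j where j: "1 / real (Suc j) < d" using nat_approx_posE[OF d(1)] by blast
  define k where "k = Suc j"
  have k: "k > 0" "1 / k < d" using j by (auto simp: k_def)
  define t where "t i = real i * s / real k" for i
  define ts where "ts = map t [0..<Suc k]"
  have tm: "t i \<le> t j" if "i \<le> j" for i j
    using that s by (auto simp: t_def intro!: divide_right_mono mult_right_mono)
  have t01: "0 \<le> t i" "t i \<le> s" if "i \<le> k" for i
  proof -
    show "0 \<le> t i" using s by (simp add: t_def)
    show "t i \<le> s" using tm[OF that] k by (simp add: t_def)
  qed
  have "sorted ts" unfolding ts_def sorted_iff_nth_mono using tm by (auto simp del: upt_Suc)
  moreover have "set ts \<subseteq> {0..1}" 
  proof -
    have "t i \<in> {0..1}" if "i < Suc k" for i using t01[of i] that s by auto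
    then show ?thesis unfolding ts_def by auto
  qed
  ultimately have "(\<Sum>i<length ts - 1. ennreal (dist (\<gamma> (ts ! i)) (\<gamma> (ts ! Suc i)))) \<le> arclength \<gamma>"
    unfolding arclength_def by (intro SUP_upper) auto
  also have "(\<Sum>i<length ts - 1. ennreal (dist (\<gamma> (ts ! i)) (\<gamma> (ts ! Suc i))))
      = (\<Sum>i<k. ennreal (dist (\<gamma> (t i)) (\<gamma> (t (Suc i)))))"
    unfolding ts_def by (intro sum.cong) (auto simp del: upt_Suc)
  also have "\<dots> = ennreal (\<Sum>i<k. dist (\<gamma> (t i)) (\<gamma> (t (Suc i))))" by (rule sum_ennreal) auto
  finally have "ennreal (\<Sum>i<k. dist (\<gamma> (t i)) (\<gamma> (t (Suc i)))) \<le> ennreal A" using len(1)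
      by (rule order_trans)
  then have sumA: "(\<Sum>i<k. dist (\<gamma> (t i)) (\<gamma> (t (Suc i)))) \<le> A" using len
      by (simp add: ennreal_le_iff)
  have "\<bar>u (\<gamma> (t i)) - u (\<gamma> (t (Suc i)))\<bar> \<le> L * dist (\<gamma> (t i)) (\<gamma> (t (Suc i)))" if "i < k" for i
  proof (rule u)
    show "0 \<le> t i" "t i \<le> s" using t01 that by auto
    have "t (Suc i) - t i = s / k" by (simp add: t_def distrib_right add_divide_distrib)
    also have "\<dots> \<le> 1 / k" using s by (intro divide_right_mono) auto
    finally have "dist (t i) (t (Suc i)) < d" using k tm[of i "Suc i"] by (simp add: dist_real_def)
    then show "dist (\<gamma> (t i)) (\<gamma> (t (Suc i))) \<le> h"
      using d(2)[of "t (Suc i)" "t i"] t01[of i] t01[of "Suc i"] that s by force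
  qed
  then have "(\<Sum>i<k. \<bar>u (\<gamma> (t i)) - u (\<gamma> (t (Suc i)))\<bar>) \<le> (\<Sum>i<k. L * dist (\<gamma> (t i)) (\<gamma> (t (Suc i))))"
    by (intro sum_mono) auto
  also have "\<dots> = L * (\<Sum>i<k. dist (\<gamma> (t i)) (\<gamma> (t (Suc i))))" by (simp add: sum_distrib_left)
  also have "\<dots> \<le> L * A" by (intro mult_left_mono sumA L)
  finally have "(\<Sum>i<k. \<bar>u (\<gamma> (t i)) - u (\<gamma> (t (Suc i)))\<bar>) \<le> L * A" .
  moreover have "u (\<gamma> 0) - u (\<gamma> s) = (\<Sum>i<k. u (\<gamma> (t i)) - u (\<gamma> (t (Suc i))))"
    using k by (subst sum_lessThan_telescope') (simp add: t_def)
  ultimately show ?thesis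
      using sum_abs[of "\<lambda>i. u (\<gamma> (t i)) - u (\<gamma> (t (Suc i)))" "{..<k}"] by linarith
qed

text \<open>A ball is connected, so if it met both \<Omega> and the complement it would meet the
  frontier. An empty frontier has infinite distance and is included.\<close>

lemma edist_frontier_ball:
  fixes z :: "'a::euclidean_space"
  assumes "open \<Omega>" "z \<in> \<Omega>" "ennreal e \<le> edist {z} (frontier \<Omega>)" "0 < e"
  shows "ball z e \<subseteq> \<Omega>"
proof (rule ccontr)
  assume "\<not> ball z e \<subseteq> \<Omega>"
  then have "ball z e - \<Omega> \<noteq> {}" by auto
  moreover have "ball z e \<inter> \<Omega> \<noteq> {}" using assms by (auto intro: centre_in_ball[THEN iffD2])
  ultimately have "ball z e \<inter> frontier \<Omega> \<noteq> {}" by (intro connected_Int_frontier) auto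
  then obtain y where y: "y \<in> frontier \<Omega>" "dist z y < e" by auto
  have "ennreal e \<le> ennreal (dist z y)"
    using assms(3) y(1) by (auto simp: edist_def le_INF_iff)
  with y(2) show False using assms(4) by (simp add: ennreal_le_iff2)
qed

text \<open>The curve to a point at distance \<open>8 * s / \<epsilon>\<close> from \<open>x\<close> is followed up to its first point at
  distance \<open>4 * s / \<epsilon>\<close>. On this part it stays at distance \<open>\<epsilon> * s / 3\<close> from the boundary.\<close>

lemma eps_delta_climb:
  fixes \<Omega> :: "(real ^ 'n) set"
  assumes dom: "eps_delta_domain \<epsilon> \<delta> \<Omega>" and eps: "0 < \<epsilon>" "\<epsilon> \<le> 1"
    and x: "x \<in> \<Omega>" and s: "0 < s" "ball x s \<subseteq> \<Omega>" "8 * s / \<epsilon> < \<delta>"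
    and p: "p \<in> \<Omega>" "8 * s / \<epsilon> \<le> dist x p"
  obtains z where "z \<in> \<Omega>" "dist x z \<le> 4 * s / \<epsilon>" "ball z (2 * s) \<subseteq> \<Omega>"
    "\<And>u h L. 0 < h \<Longrightarrow> 0 \<le> L \<Longrightarrow>
       (\<And>a b. a \<in> \<Omega> \<Longrightarrow> ball a (\<epsilon> * s / 3) \<subseteq> \<Omega> \<Longrightarrow> dist x a \<le> 4 * s / \<epsilon> \<Longrightarrow> dist a b \<le> h \<Longrightarrow>
          \<bar>u a - u b\<bar> \<le> L * dist a b) \<Longrightarrow>
       \<bar>u x - u z\<bar> \<le> L * (8 * s / \<epsilon>\<^sup>2)"
proof -
  have op: "open \<Omega>" and con: "connected \<Omega>" using dom by (auto simp: eps_delta_domain_def domain_def)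
  have "connected (dist x ` \<Omega>)" by (intro connected_continuous_image continuous_intros con)
  moreover have "dist x x \<in> dist x ` \<Omega>" "dist x p \<in> dist x ` \<Omega>" using x p by blast+
  \<comment> \<open>The distances from \<open>x\<close> to points of a connected set form an
    interval, so the far point \<open>p\<close> can be traded for one at exactly the wanted
    distance.\<close>
  ultimately have "8 * s / \<epsilon> \<in> dist x ` \<Omega>"
    using p s eps unfolding connected_iff_interval
        by (metis dist_self divide_nonneg_pos less_imp_le mult_nonneg_nonneg zero_le_numeral)
  then obtain y where y: "y \<in> \<Omega>" "dist x y = 8 * s / \<epsilon>" by auto
  have nxy: "norm (x - y) = 8 * s / \<epsilon>" using y by (simp add: dist_norm)
  have "norm (x - y) < \<delta>" using nxy s by simp
  then obtain \<gamma> where \<gamma>: "rectifiable_curve \<gamma>" "path_image \<gamma> \<subseteq> \<Omega>" "pathstart \<gamma> = x" "pathfinish \<gamma>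
      = y"
      "arclength \<gamma> \<le> ennreal (norm (x - y) / \<epsilon>)"
      "\<And>z. z \<in> path_image \<gamma> \<Longrightarrow>
        edist {z} (frontier \<Omega>) \<ge> ennreal (\<epsilon> * (norm (z - x) * norm (z - y) / norm (x - y)))"
    using dom x y(1) unfolding eps_delta_domain_def by blast
  have pth: "path \<gamma>" using \<gamma> by (simp add: rectifiable_curve_def)
  have g0: "\<gamma> 0 = x" and g1: "\<gamma> 1 = y" using \<gamma> by (auto simp: pathstart_def pathfinish_def)
  \<comment> \<open>Half the distance from \<open>x\<close> to \<open>y\<close>: as long as the
    curve stays within \<open>R\<close> of \<open>x\<close>, it is at least \<open>R\<close> away
    from \<open>y\<close>.\<close>
  define R where "R = 4 * s / \<epsilon>"
  have R: "0 < R" "dist x y = 2 * R" using s eps y by (auto simp: R_def)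
  define T where "T = {t \<in> {0..1}. R \<le> dist x (\<gamma> t)}"
  have cont: "continuous_on {0..1} (\<lambda>t. dist x (\<gamma> t))" using pth
      by (auto simp: path_def intro!: continuous_intros)
  have "1 \<in> T" using R g1 by (simp add: T_def)
  have "closed T"
    unfolding T_def using continuous_closed_preimage[OF cont, of "{R..}"]
    by (simp add: vimage_def Int_def)
  moreover have "bdd_below T" by (auto simp: T_def)
  ultimately have tT: "Inf T \<in> T" using \<open>1 \<in> T\<close> closed_contains_Inf by blast
  define t1 where "t1 = Inf T"
  have t1: "0 \<le> t1" "t1 \<le> 1" "R \<le> dist x (\<gamma> t1)" using tT by (auto simp: T_def t1_def)
  have below: "dist x (\<gamma> t) < R" if "0 \<le> t" "t < t1" for t
  proof (rule ccontr)
    assume "\<not> dist x (\<gamma> t) < R"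
    then have "t \<in> T" using that t1 by (auto simp: T_def)
    then have "t1 \<le> t" unfolding t1_def by (rule cInf_lower) (auto simp: T_def)
    then show False using that by simp
  qed
  have eqR: "dist x (\<gamma> t1) = R"
  proof (rule ccontr)
    assume "dist x (\<gamma> t1) \<noteq> R"
    then have gt: "R < dist x (\<gamma> t1)" using t1 by simp
    then have "t1 \<noteq> 0" using g0 R by auto
    have c1: "continuous_on {0..t1} (\<lambda>t. dist x (\<gamma> t))"
      by (rule continuous_on_subset[OF cont]) (use t1 in auto)
    have "\<exists>t\<ge>0. t \<le> t1 \<and> dist x (\<gamma> t) = R"
      by (rule IVT'[OF _ _ _ c1]) (use g0 R gt t1 in auto)
    then obtain t where t: "0 \<le> t" "t \<le> t1" "dist x (\<gamma> t) = R" by blast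
    then show False using below[of t] gt by (cases "t = t1") auto
  qed
  have upto: "dist x (\<gamma> t) \<le> R" if "0 \<le> t" "t \<le> t1" for t
    using below[of t] eqR that by (cases "t = t1") auto
  have inO: "\<gamma> t \<in> \<Omega>" if "0 \<le> t" "t \<le> 1" for t
    using \<gamma>(2) that by (auto simp: path_image_def)
  \<comment> \<open>The quotient \<open>norm (z - y) / norm (x - y)\<close> is at least one half
    here. At the end point the radius is \<open>\<epsilon> * R / 2 = 2 * s\<close>, the doubling
    sought.\<close>
  have dd: "ball (\<gamma> t) (\<epsilon> * dist x (\<gamma> t) / 2) \<subseteq> \<Omega>" if "0 \<le> t" "t \<le> t1" for t
  proof (cases "\<gamma> t = x")
    case False
    have im: "\<gamma> t \<in> path_image \<gamma>" using that t1 by (auto simp: path_image_def)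
    have "R \<le> dist (\<gamma> t) y" using R upto[OF that] dist_triangle[of x y "\<gamma> t"] by simp
    then have "norm (\<gamma> t - x) * R / (2 * R) \<le> norm (\<gamma> t - x) * norm (\<gamma> t - y) / norm (x - y)"
      using R by (intro frac_le mult_left_mono) (auto simp: dist_norm)
    then have "norm (\<gamma> t - x) / 2 \<le> norm (\<gamma> t - x) * norm (\<gamma> t - y) / norm (x - y)" using R by simp
    then have "\<epsilon> * (norm (\<gamma> t - x) / 2) \<le> \<epsilon> * (norm (\<gamma> t - x) * norm (\<gamma> t - y) / norm (x - y))"
      using eps by (intro mult_left_mono) auto
    then have "\<epsilon> * dist x (\<gamma> t) / 2 \<le> \<epsilon> * (norm (\<gamma> t - x) * norm (\<gamma> t - y) / norm (x - y))"
      by (simp add: dist_norm norm_minus_commute)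
    from order_trans[OF ennreal_leI[OF this] \<gamma>(6)[OF im]]
    have "ennreal (\<epsilon> * dist x (\<gamma> t) / 2) \<le> edist {\<gamma> t} (frontier \<Omega>)" .
    then show ?thesis using False eps op inO[of t] that t1 by (intro edist_frontier_ball) auto
  qed auto
  \<comment> \<open>The bound \<open>dd\<close> degenerates near \<open>x\<close>, where the ball of
    radius \<open>s\<close> around \<open>x\<close> takes over; \<open>2 * s / 3\<close> is where
    the two regimes meet.\<close>
  have thick: "ball (\<gamma> t) (\<epsilon> * s / 3) \<subseteq> \<Omega>" if "0 \<le> t" "t \<le> t1" for t
  proof (cases "dist x (\<gamma> t) \<le> 2 * s / 3")
    case True
    have "\<epsilon> * s \<le> 1 * s" using eps s by (intro mult_right_mono) auto
    then have "ball (\<gamma> t) (\<epsilon> * s / 3) \<subseteq> ball x s"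
      using True by (intro ball_subset_ball_iff[THEN iffD2]) (auto simp: dist_commute)
    then show ?thesis using s by auto
  next
    case False
    then have "\<epsilon> * s / 3 \<le> \<epsilon> * dist x (\<gamma> t) / 2" using eps by simp
    then show ?thesis using dd[OF that] subset_ball by blast
  qed
  show ?thesis
  proof (rule that[of "\<gamma> t1"])
    show "\<gamma> t1 \<in> \<Omega>" using inO t1 by auto
    show "dist x (\<gamma> t1) \<le> 4 * s / \<epsilon>" using eqR by (simp add: R_def)
    show "ball (\<gamma> t1) (2 * s) \<subseteq> \<Omega>" using dd[of t1] t1 eqR eps by (simp add: R_def)
  next
    fix u :: "real ^ 'n \<Rightarrow> real" and h L :: real
    assume h: "0 < h" "0 \<le> L"
      and u: "\<And>a b. a \<in> \<Omega> \<Longrightarrow> ball a (\<epsilon> * s / 3) \<subseteq> \<Omega> \<Longrightarrow> dist x a \<le> 4 * s / \<epsilon> \<Longrightarrow> dist a b \<le> h \<Longrightarrow>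
          \<bar>u a - u b\<bar> \<le> L * dist a b"
    have "\<bar>u (\<gamma> 0) - u (\<gamma> t1)\<bar> \<le> L * (8 * s / \<epsilon>\<^sup>2)"
    proof (rule lipschitz_along_curve[OF pth _ _ t1(1,2) h])
      show "arclength \<gamma> \<le> ennreal (8 * s / \<epsilon>\<^sup>2)" using \<gamma>(5) nxy by (simp add: power2_eq_square)
      fix t b assume "0 \<le> t" "t \<le> t1" "dist (\<gamma> t) b \<le> h"
      then show "\<bar>u (\<gamma> t) - u b\<bar> \<le> L * dist (\<gamma> t) b"
        using u[of "\<gamma> t" b] inO[of t] thick[of t] upto[of t] t1 by (auto simp: R_def)
    qed (use s in auto)
    then show "\<bar>u x - u (\<gamma> t1)\<bar> \<le> L * (8 * s / \<epsilon>\<^sup>2)" by (simp add: g0)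
  qed
qed

text \<open>\<open>192 = 8 * 8 * 3\<close>: the divisor of the smoothing radius, the length
  \<open>8 * s / \<epsilon>^2\<close> of the curve, and the distance
  \<open>\<epsilon> * s / 3\<close> to the boundary along it.\<close>

definition climb_const :: "nat \<Rightarrow> real \<Rightarrow> real" where
  "climb_const k \<epsilon> = 192 * real k * tent_const k / \<epsilon> ^ 3"

locale eps_delta_smoothing = smoothing \<Omega> f \<tau> for \<Omega> :: "(real ^ 'n) set" and f \<tau> +
  fixes \<epsilon> \<delta> :: real
  assumes dom: "eps_delta_domain \<epsilon> \<delta> \<Omega>" and eps: "0 < \<epsilon>" "\<epsilon> \<le> 1"
begin

lemma J_pos: "0 < climb_const CARD('n) \<epsilon>"
  using eps by (simp add: climb_const_def tent_const_def)

lemma J_nonneg: "0 \<le> climb_const CARD('n) \<epsilon>"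
  using J_pos by simp

text \<open>Along the piece of curve \<open>u\<close> has Lipschitz constant
  \<open>O(W / \<sigma>)\<close>, where \<sigma> is the distance to the boundary capped at \<tau>.
  The length is proportional to \<open>s\<close>, which may exceed \<tau>; this explains the factor
  \<open>T / \<tau>\<close>. Points of the curve stay within \<open>4 * s / \<epsilon>\<close> of
  \<open>x\<close> and the smoothing reaches at most \<tau> further, so oscillation inside
  \<open>Z\<close> is never seen.\<close>

lemma climb_step:
  assumes x: "x \<in> \<Omega>" and s: "0 < s" "s \<le> T" "ball x s \<subseteq> \<Omega>" "8 * s / \<epsilon> < \<delta>" and T: "\<tau> \<le> T"
    and p: "p \<in> \<Omega>" "8 * s / \<epsilon> \<le> dist x p"
    and W: "osc (\<Omega> - Z) f \<tau> \<le> ennreal W" "0 \<le> W" and Z: "ball x (4 * s / \<epsilon> + \<tau>) \<inter> Z = {}"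
  obtains z where "z \<in> \<Omega>" "dist x z \<le> 4 * s / \<epsilon>" "ball z (2 * s) \<subseteq> \<Omega>"
    "\<bar>u x - u z\<bar> \<le> climb_const CARD('n) \<epsilon> * (T / \<tau>) * W"
proof -
  from eps_delta_climb[OF dom eps x s(1,3,4) p] obtain z
    where z: "z \<in> \<Omega>" "dist x z \<le> 4 * s / \<epsilon>" "ball z (2 * s) \<subseteq> \<Omega>"
      and *: "\<And>u h L. 0 < h \<Longrightarrow> 0 \<le> L \<Longrightarrow>
       (\<And>a b. a \<in> \<Omega> \<Longrightarrow> ball a (\<epsilon> * s / 3) \<subseteq> \<Omega> \<Longrightarrow> dist x a \<le> 4 * s / \<epsilon> \<Longrightarrow> dist a b \<le> h \<Longrightarrow>
          \<bar>u a - u b\<bar> \<le> L * dist a b) \<Longrightarrow>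
       \<bar>u x - u z\<bar> \<le> L * (8 * s / \<epsilon>\<^sup>2)" by blast
  define \<sigma> where "\<sigma> = min \<tau> (\<epsilon> * s / 3)"
  have \<sigma>: "0 < \<sigma>" using s eps \<tau>_pos by (simp add: \<sigma>_def)
  define L where "L = tent_const CARD('n) * W * (8 * real CARD('n) / \<sigma>)"
  have L0: "0 \<le> L" using W \<sigma> tent_const_nonneg[of "CARD('n)"] by (simp add: L_def)
  have "\<bar>u x - u z\<bar> \<le> L * (8 * s / \<epsilon>\<^sup>2)"
  proof (rule *[of "\<sigma> / (16 * real CARD('n))"])
    fix a b assume a: "a \<in> \<Omega>" "ball a (\<epsilon> * s / 3) \<subseteq> \<Omega>" "dist x a \<le> 4 * s / \<epsilon>"
      and ab: "dist a b \<le> \<sigma> / (16 * real CARD('n))"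
    have ma: "\<sigma> \<le> m a" unfolding \<sigma>_def using a by (intro bdist_ge)
    then have ra: "\<sigma> / (8 * real CARD('n)) \<le> r a" unfolding smoothing_radius_def
        by (intro divide_right_mono) auto
    have "ball a (m a) \<subseteq> ball x (4 * s / \<epsilon> + \<tau>)"
      using a(3) bdist_le[of \<tau> \<Omega> a]
          by (intro ball_subset_ball_iff[THEN iffD2]) (auto simp: dist_commute)
    then have U: "cub a (2 * r a) \<subseteq> \<Omega> - Z"
      using cub_r_subset[OF a(1)] cub_r_subset_dom[OF a(1)] Z by blast
    have "dist a b \<le> r a / 2" using ab ra by simp
    then have "\<bar>u a - u b\<bar> \<le> tent_const CARD('n) * W * (dist a b / r a)"
      by (rule smoothed_estimates(2)[OF a(1) W U])
    also have "\<dots> \<le> tent_const CARD('n) * W * (dist a b / (\<sigma> / (8 * real CARD('n))))"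
      using ra \<sigma> W tent_const_nonneg[of "CARD('n)"]
          by (intro mult_left_mono divide_left_mono mult_pos_pos r_pos[OF a(1)]) auto
    also have "\<dots> = L * dist a b" by (simp add: L_def)
    finally show "\<bar>u a - u b\<bar> \<le> L * dist a b" .
  qed (use L0 \<sigma> in auto)
  also have "L * (8 * s / \<epsilon>\<^sup>2) = 64 * real CARD('n) * tent_const CARD('n) * W / \<epsilon>\<^sup>2 * (s / \<sigma>)"
    by (simp add: L_def ac_simps)
  also have "\<dots> \<le> 64 * real CARD('n) * tent_const CARD('n) * W / \<epsilon>\<^sup>2 * (3 / \<epsilon> * (T / \<tau>))"
  proof (rule mult_left_mono)
    have "s * (\<epsilon> * \<tau>) \<le> 3 * T * \<sigma>"
    proof (cases "\<tau> \<le> \<epsilon> * s / 3")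
      case True
      have "s * \<epsilon> \<le> T * 1" using s eps by (intro mult_mono) auto
      then have "s * \<epsilon> * \<tau> \<le> 3 * T * \<tau>" using \<tau>_pos T by (intro mult_right_mono) auto
      then show ?thesis using True by (simp add: \<sigma>_def mult.assoc)
    next
      case False
      have "\<tau> * (s * \<epsilon>) \<le> T * (s * \<epsilon>)" using T s eps by (intro mult_right_mono) auto
      then show ?thesis using False by (simp add: \<sigma>_def algebra_simps)
    qed
    then show "s / \<sigma> \<le> 3 / \<epsilon> * (T / \<tau>)" using \<sigma> \<tau>_pos eps by (simp add: field_simps)
  qed (use W tent_const_nonneg[of "CARD('n)"] in simp)
  also have "\<dots> = climb_const CARD('n) \<epsilon> * (T / \<tau>) * W" using eps
      by (simp add: climb_const_def power2_eq_square power3_eq_cube ac_simps)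
  finally show ?thesis using z that by blast
qed

text \<open>Induction on the number \<open>k\<close> of doublings. The quantity
  \<open>4 / \<epsilon> * (2 * T - bdist T \<Omega> x)\<close> is a budget of distance: a step of
  length \<open>4 * s / \<epsilon>\<close> raises \<open>bdist\<close> from \<open>s\<close> to at
  least \<open>2 * s\<close>, unless it already reaches \<open>T\<close>, and so pays for itself.
  The budget also keeps the whole walk away from \<open>Z\<close>.\<close>

lemma climb:
  assumes T: "\<tau> \<le> T" "8 * T / \<epsilon> < \<delta>" and far: "\<And>x. x \<in> \<Omega> \<Longrightarrow> \<exists>p\<in>\<Omega>. 8 * T / \<epsilon> \<le> dist x p"
    and W: "osc (\<Omega> - Z) f \<tau> \<le> ennreal W" "0 \<le> W"
  shows "x \<in> \<Omega> \<Longrightarrow> T / 2 ^ k \<le> bdist T \<Omega> x \<Longrightarrow> ball x (4 / \<epsilon> * (2 * T - bdist T \<Omega> x) + \<tau>) \<inter> Z = {} \<Longrightarrow>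
    \<exists>z\<in>\<Omega>. bdist T \<Omega> z = T \<and> dist x z \<le> 4 / \<epsilon> * (2 * T - bdist T \<Omega> x) \<and> \<bar>u x - u z\<bar>
        \<le> real k * (climb_const CARD('n) \<epsilon> * (T / \<tau>) * W)"
proof (induction k arbitrary: x)
  case 0
  then have "bdist T \<Omega> x = T" using bdist_le[of T \<Omega> x] by simp
  then show ?case using 0 eps T \<tau>_pos by (intro bexI[of _ x]) auto
next
  case (Suc k)
  let ?b = "bdist T \<Omega>"
  define K where "K = climb_const CARD('n) \<epsilon> * (T / \<tau>) * W"
  have T0: "0 < T" using T \<tau>_pos by simp
  have K0: "0 \<le> K" using J_nonneg W T0 \<tau>_pos by (simp add: K_def)
  show ?case
  proof (cases "?b x = T")
    case True
    have "0 \<le> real (Suc k) * K" using K0 by simp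
    then show ?thesis using True Suc.prems(1) eps T0 unfolding K_def[symmetric]
        by (intro bexI[of _ x]) auto
  next
    case False
    define s where "s = ?b x"
    have s: "0 < s" "s < T" "s \<le> T"
        using False bdist_le[of T \<Omega> x] bdist_pos[OF open_dom T0 Suc.prems(1)] by (auto simp: s_def)
    obtain p where p: "p \<in> \<Omega>" "8 * T / \<epsilon> \<le> dist x p" using far Suc.prems by blast
    have sT: "8 * s / \<epsilon> \<le> 8 * T / \<epsilon>" "4 * s / \<epsilon> \<le> 4 / \<epsilon> * (2 * T - s)"
      using s eps by (auto simp: field_simps)
    have Z: "ball x (4 * s / \<epsilon> + \<tau>) \<inter> Z = {}"
      using Suc.prems(3) sT subset_ball[of "4 * s / \<epsilon> + \<tau>" "4 / \<epsilon> * (2 * T - s) + \<tau>" x]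
          unfolding s_def by auto
    obtain z where z: "z \<in> \<Omega>" "dist x z \<le> 4 * s / \<epsilon>" "ball z (2 * s) \<subseteq> \<Omega>" "\<bar>u x - u z\<bar> \<le> K"
      using climb_step[OF Suc.prems(1) s(1,3) _ _ T(1) p(1) _ W Z]  T p sT ball_bdist_subset[of x T \<Omega>] unfolding s_def K_def
      by (smt (verit))
    have bz: "min T (2 * s) \<le> ?b z" using z(3) by (rule bdist_ge)
    show ?thesis
    proof (cases "?b z = T")
      case True
      have "1 * K \<le> real (Suc k) * K" using K0 by (intro mult_right_mono) auto
      then have "\<bar>u x - u z\<bar> \<le> real (Suc k) * K" using z(4) by linarith
      moreover have "dist x z \<le> 4 / \<epsilon> * (2 * T - s)" using z(2) sT by linarith
      ultimately show ?thesis using True z unfolding s_def K_def by blast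
    next
      case False
      then have b2: "2 * s \<le> ?b z" using bz bdist_le[of T \<Omega> z] by auto
      have "T / 2 ^ k \<le> 2 * s" using Suc.prems(2) unfolding s_def by (simp add: field_simps)
      then have 1: "T / 2 ^ k \<le> ?b z" using b2 by linarith
      have "4 / \<epsilon> * (2 * T - ?b z) \<le> 4 / \<epsilon> * (2 * T - 2 * s)" using b2 eps
          by (intro mult_left_mono) auto
      also have "\<dots> = 4 / \<epsilon> * (2 * T - s) - 4 * s / \<epsilon>" using eps by (simp add: field_simps)
      finally have le: "4 / \<epsilon> * (2 * T - ?b z) + dist x z \<le> 4 / \<epsilon> * (2 * T - s)"
          using z(2) by linarith
      then have "ball z (4 / \<epsilon> * (2 * T - ?b z) + \<tau>) \<subseteq> ball x (4 / \<epsilon> * (2 * T - s) + \<tau>)"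
        by (intro ball_subset_ball_iff[THEN iffD2]) (auto simp: dist_commute)
      then have "ball z (4 / \<epsilon> * (2 * T - ?b z) + \<tau>) \<inter> Z = {}" using Suc.prems(3)
          unfolding s_def by blast
      from Suc.IH[OF z(1) 1 this] obtain w where w: "w \<in> \<Omega>" "?b w = T" "dist z w
          \<le> 4 / \<epsilon> * (2 * T - ?b z)"
        "\<bar>u z - u w\<bar> \<le> real k * K" unfolding K_def by blast
      have "dist x w \<le> 4 / \<epsilon> * (2 * T - s)" using dist_triangle[of x w z] w(3) le by linarith
      moreover have "\<bar>u x - u w\<bar> \<le> real (Suc k) * K" using z(4) w(4) by (simp add: algebra_simps)
      ultimately show ?thesis using w unfolding s_def K_def by blast
    qed
  qed
qed

text \<open>The number of doublings is at most the binary logarithm plus one;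
  \<open>1 / ln 2 \<le> 2\<close> turns it into the natural logarithm of the barrier.\<close>

lemma climb_log:
  assumes T: "\<tau> \<le> T" "8 * T / \<epsilon> < \<delta>" and far: "\<And>x. x \<in> \<Omega> \<Longrightarrow> \<exists>p\<in>\<Omega>. 8 * T / \<epsilon> \<le> dist x p"
    and W: "osc (\<Omega> - Z) f \<tau> \<le> ennreal W" "0 \<le> W"
    and x: "x \<in> \<Omega>" and Z: "ball x (8 / \<epsilon> * T + \<tau>) \<inter> Z = {}"
  shows "\<exists>z\<in>\<Omega>. bdist T \<Omega> z = T \<and> dist x z \<le> 8 / \<epsilon> * T \<and>
    \<bar>u x - u z\<bar> \<le> (2 * ln (T / bdist T \<Omega> x) + 1) * (climb_const CARD('n) \<epsilon> * (T / \<tau>) * W)"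
proof -
  let ?b = "bdist T \<Omega> x"
  have T0: "0 < T" using T \<tau>_pos by simp
  have b: "0 < ?b" "?b \<le> T" using bdist_le[of T \<Omega> x] bdist_pos[OF open_dom T0 x] by auto
  define k where "k = nat \<lceil>log 2 (T / ?b)\<rceil>"
  have lg: "0 \<le> log 2 (T / ?b)" using b by simp
  have "log 2 (T / ?b) \<le> real k" unfolding k_def using lg by linarith
  then have "T / ?b \<le> 2 powr real k" using b T0 by (subst (asm) log_le_iff) auto
  then have "T / 2 ^ k \<le> ?b" using b by (simp add: powr_realpow field_simps)
  moreover have le: "4 / \<epsilon> * (2 * T - ?b) \<le> 8 / \<epsilon> * T" using eps b by (simp add: field_simps)
  then have "ball x (4 / \<epsilon> * (2 * T - ?b) + \<tau>) \<inter> Z = {}"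
    using Z subset_ball[of "4 / \<epsilon> * (2 * T - ?b) + \<tau>" "8 / \<epsilon> * T + \<tau>" x] by auto
  ultimately obtain z where z: "z \<in> \<Omega>" "bdist T \<Omega> z = T" "dist x z \<le> 4 / \<epsilon> * (2 * T - ?b)"
      "\<bar>u x - u z\<bar> \<le> real k * (climb_const CARD('n) \<epsilon> * (T / \<tau>) * W)"
    using climb[OF T far W x, of k] by blast
  have "real k \<le> 2 * ln (T / ?b) + 1"
  proof -
    have "real k \<le> log 2 (T / ?b) + 1" unfolding k_def using lg by linarith
    also have "log 2 (T / ?b) \<le> 2 * ln (T / ?b)"
    proof -
      have "1 / ln 2 \<le> (2::real)" using ln2_ge_two_thirds by (simp add: field_simps)
      moreover have "0 \<le> ln (T / ?b)" using b by simp
      ultimately have "ln (T / ?b) * (1 / ln 2) \<le> ln (T / ?b) * 2" by (intro mult_left_mono)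
      then show ?thesis by (simp add: log_def)
    qed
    finally show ?thesis by simp
  qed
  moreover have "0 \<le> climb_const CARD('n) \<epsilon> * (T / \<tau>) * W" using J_nonneg W T0 \<tau>_pos by simp
  ultimately have "real k * (climb_const CARD('n) \<epsilon> * (T / \<tau>) * W)
      \<le> (2 * ln (T / ?b) + 1) * (climb_const CARD('n) \<epsilon> * (T / \<tau>) * W)"
    by (rule mult_right_mono)
  then show ?thesis using z le by force
qed

end

section \<open>The thresholded function: size, Lipschitz bound, support\<close>

context smoothing
begin

lemma soft_threshold_abs: "0 \<le> B \<Longrightarrow> x \<in> \<Omega> \<Longrightarrow> \<bar>soft_threshold B x\<bar> = max 0 (\<bar>u x\<bar> - barrier B x)"
  unfolding soft_threshold_def using barrier_nonneg by (rule abs_diff_truncate)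

text \<open>\<open>u\<close> grows like \<open>2 * K * ln (\<tau> / m x)\<close> and the barrier at
  least like \<open>3 * K * ln (\<tau> / m x)\<close>; the surplus
  \<open>K * ln (\<tau> / m x)\<close> outweighs the constant \<open>M + K\<close> near the
  boundary, however large \<open>M\<close> is.\<close>

lemma soft_threshold_Lip_away:
  assumes W: "osc \<Omega> f \<tau> \<le> ennreal W" "0 \<le> W" and K: "0 < K" "3 * K \<le> B" and M: "0 \<le> M"
    and bound: "\<And>x. x \<in> \<Omega> \<Longrightarrow> \<bar>u x\<bar> \<le> M + (2 * ln (\<tau> / m x) + 1) * K"
  shows "soft_threshold B \<in> Lip_away \<Omega>"
    and "\<And>x. x \<in> \<Omega> \<Longrightarrow> \<bar>soft_threshold B x\<bar> \<le> M + K"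
proof -
  let ?n = "real CARD('n)"
  have B0: "0 \<le> B" using K by simp
  have le: "\<bar>soft_threshold B x\<bar> \<le> max 0 (M + K - K * ln (\<tau> / m x))" if "x \<in> \<Omega>" for x
  proof -
    have "0 \<le> ln (\<tau> / m x)" using m_pos[OF that] bdist_le[of \<tau> \<Omega> x] by simp
    then have "3 * K * ln (\<tau> / m x) \<le> B * ln (\<tau> / m x)" using K by (intro mult_right_mono) auto
    then have "\<bar>u x\<bar> - barrier B x \<le> M + K - K * ln (\<tau> / m x)"
      using bound[OF that] by (simp add: barrier_def algebra_simps)
    then show ?thesis using soft_threshold_abs[OF B0 that] by simp
  qed
  show bd: "\<bar>soft_threshold B x\<bar> \<le> M + K" if "x \<in> \<Omega>" for x
  proof -
    have "0 \<le> ln (\<tau> / m x)" using m_pos[OF that] bdist_le[of \<tau> \<Omega> x] by simp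
    then have "0 \<le> K * ln (\<tau> / m x)" using K by simp
    then show ?thesis using le[OF that] M K by simp
  qed
  \<comment> \<open>The solution of \<open>K * ln (\<tau> / m0) = M + K\<close>.\<close>
  define m0 where "m0 = \<tau> * exp (- ((M + K) / K))"
  have m0: "0 < m0" using \<tau>_pos by (simp add: m0_def)
  have zero: "soft_threshold B x = 0" if x: "x \<in> \<Omega>" and "m x \<le> m0" for x
  proof -
    have "\<tau> * exp (- ((M + K) / K)) * exp ((M + K) / K) \<ge> m x * exp ((M + K) / K)"
      using that by (intro mult_right_mono) (auto simp: m0_def)
    then have "exp ((M + K) / K) \<le> \<tau> / m x" using m_pos[OF x] by (simp add: exp_minus field_simps)
    then have "(M + K) / K \<le> ln (\<tau> / m x)" using m_pos[OF x] \<tau>_pos by (simp add: ln_ge_iff)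
    then have "M + K \<le> K * ln (\<tau> / m x)" using K by (simp add: field_simps)
    then show ?thesis using le[OF x] by simp
  qed
  \<comment> \<open>Twice the Lipschitz bound for \<open>u\<close>, once that for the barrier, and
    the bound \<open>2 * (M + K)\<close> on differences divided by \<open>m0 / (16 * n)\<close>, for
    points too far apart for the local estimates.\<close>
  define L where "L = 2 * (tent_const CARD('n) * W) * (8 * ?n / m0) + B * (2 / m0) + 2 * (M + K) * (16 * ?n / m0)"
  have terms: "0 \<le> 2 * (tent_const CARD('n) * W) * (8 * ?n / m0)" "0 \<le> B * (2 / m0)" "0
      \<le> 2 * (M + K) * (16 * ?n / m0)"
    using W tent_const_nonneg[of "CARD('n)"] m0 B0 M K by auto
  have lip: "\<bar>soft_threshold B x - soft_threshold B y\<bar>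
      \<le> L * dist x y" if x: "x \<in> \<Omega>" and y: "y \<in> \<Omega>" and mx: "m0 \<le> m x" for x y
  proof (cases "dist x y \<le> m0 / (16 * ?n)")
    case True
    have rx: "m0 / (8 * ?n) \<le> r x" unfolding smoothing_radius_def using mx
        by (intro divide_right_mono) auto
    have "\<bar>u x - u y\<bar> \<le> tent_const CARD('n) * W * (dist x y / r x)"
      by (rule smoothed_estimates(2)[OF x W cub_r_subset_dom[OF x]]) (use True rx in simp)
    also have "\<dots> \<le> tent_const CARD('n) * W * (dist x y / (m0 / (8 * ?n)))"
      using rx m0 W tent_const_nonneg[of "CARD('n)"]
          by (intro mult_left_mono divide_left_mono mult_pos_pos r_pos[OF x]) auto
    finally have 1: "\<bar>u x - u y\<bar> \<le> (tent_const CARD('n) * W) * (8 * ?n / m0) * dist x y"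
        by (simp add: ac_simps)
    have "2 \<le> 16 * ?n" using n_ge_1 by linarith
    then have "m0 / (16 * ?n) \<le> m0 / 2" using m0 by (intro divide_left_mono) auto
    then have "m0 / 2 \<le> m y" using mx True bdist_lipschitz[of \<tau> \<Omega> x y] by linarith
    then have "\<bar>barrier B x - barrier B y\<bar> \<le> B * (dist x y / (m0 / 2))"
      using mx m0 by (intro barrier_lipschitz x y B0) auto
    then have 2: "\<bar>barrier B x - barrier B y\<bar> \<le> B * (2 / m0) * dist x y" by (simp add: ac_simps)
    have "\<bar>soft_threshold B x - soft_threshold B y\<bar> \<le> 2 * \<bar>u x - u y\<bar> + \<bar>barrier B x - barrier B y\<bar>"
      using truncate_diff[of "u x" "barrier B x" "u y" "barrier B y"] unfolding soft_threshold_def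
          by (smt (verit))
    also have "\<dots> \<le> 2 * ((tent_const CARD('n) * W) * (8 * ?n / m0) * dist x y) + B * (2 / m0) * dist x y"
      by (intro add_mono mult_left_mono 1 2) auto
    also have "\<dots> = (2 * (tent_const CARD('n) * W) * (8 * ?n / m0) + B * (2 / m0)) * dist x y"
      by (simp only: distrib_right mult.assoc)
    also have "\<dots> \<le> L * dist x y" using terms unfolding L_def by (intro mult_right_mono) auto
    finally show ?thesis .
  next
    case False
    then have "1 \<le> 16 * ?n / m0 * dist x y" using m0 n_ge_1 by (simp add: field_simps)
    then have "2 * (M + K) * 1 \<le> 2 * (M + K) * (16 * ?n / m0 * dist x y)" using M K
        by (intro mult_left_mono) auto
    then have "\<bar>soft_threshold B x - soft_threshold B y\<bar> \<le> 2 * (M + K) * (16 * ?n / m0) * dist x y"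
      using bd[OF x] bd[OF y] by (simp add: mult.assoc)
    also have "\<dots> \<le> L * dist x y" using terms unfolding L_def by (intro mult_right_mono) auto
    finally show ?thesis .
  qed
  have "L-lipschitz_on \<Omega> (soft_threshold B)"
  proof (rule lipschitz_onI)
    show "0 \<le> L" using terms unfolding L_def by linarith
    fix x y assume xy: "x \<in> \<Omega>" "y \<in> \<Omega>"
    \<comment> \<open>The estimate \<open>lip\<close> asks only its first point to be away from the
      boundary; if neither is, both values are zero.\<close>
    consider "m0 \<le> m x" | "m0 \<le> m y" | "m x \<le> m0" "m y \<le> m0" by linarith
    then show "dist (soft_threshold B x) (soft_threshold B y) \<le> L * dist x y"
    proof cases
      case 1 then show ?thesis using lip xy by (simp add: dist_real_def)
    next
      case 2 then show ?thesis using lip[OF xy(2,1)]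
          by (simp add: dist_real_def abs_minus_commute dist_commute)
    next
      case 3 then show ?thesis using zero xy \<open>0 \<le> L\<close> by simp
    qed
  qed
  moreover have "bounded (soft_threshold B ` \<Omega>)" using bd by (auto simp: bounded_iff)
  moreover have "edist (supp \<Omega> (soft_threshold B)) (frontier \<Omega>) > 0"
  proof -
    have "m0 \<le> dist x y" if x: "x \<in> supp \<Omega> (soft_threshold B)" and y: "y \<in> frontier \<Omega>" for x y
    proof -
      have yO: "y \<notin> \<Omega>" using y open_dom by (simp add: frontier_def interior_open)
      have "support_on \<Omega> (soft_threshold B) \<subseteq> {x. m0 \<le> dist x y}"
      proof
        fix z assume "z \<in> support_on \<Omega> (soft_threshold B)"
        then have z: "z \<in> \<Omega>" "soft_threshold B z \<noteq> 0" by (auto simp: support_on_def)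
        then have "m0 < m z" using zero by (meson not_le)
        then show "z \<in> {x. m0 \<le> dist x y}" using ball_bdist_subset[of z \<tau> \<Omega>] yO
            by (force simp: subset_iff)
      qed
      moreover have "closed {x. m0 \<le> dist x y}" by (intro closed_Collect_le continuous_intros)
      ultimately show ?thesis using x closure_minimal unfolding supp_def by blast
    qed
    then have "ennreal m0 \<le> edist (supp \<Omega> (soft_threshold B)) (frontier \<Omega>)"
      unfolding edist_def by (intro INF_greatest ennreal_leI) auto
    then show ?thesis using m0 by (metis ennreal_less_zero_iff less_le_trans)
  qed
  ultimately show "soft_threshold B \<in> Lip_away \<Omega>" unfolding Lip_away_def by blast
qed

text \<open>The points of a bounded \<Omega> at distance at least \<tau> from the complement form a
  compact set, on which the continuous \<open>u\<close> is bounded. This replaces the large-scale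
  climb, whose far points may be missing.\<close>

lemma smoothed_bounded_on_compact:
  assumes "bounded \<Omega>"
  obtains M where "0 \<le> M" "\<And>x. x \<in> \<Omega> \<Longrightarrow> m x = \<tau> \<Longrightarrow> \<bar>u x\<bar> \<le> M"
proof -
  have "\<Omega> \<noteq> UNIV" using assms by (metis not_bounded_UNIV)
  then have eq: "{x \<in> \<Omega>. m x = \<tau>} = {x. \<tau> \<le> infdist x (- \<Omega>)}"
    using \<tau>_pos by (auto simp: bdist_def min_def split: if_splits intro: ccontr)
  have "closed {x. \<tau> \<le> infdist x (- \<Omega>)}"
    by (intro closed_Collect_le continuous_intros)
  moreover have "bounded {x \<in> \<Omega>. m x = \<tau>}" using assms by (rule bounded_subset) auto
  ultimately have "compact {x \<in> \<Omega>. m x = \<tau>}" by (simp add: compact_eq_bounded_closed eq)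
  then have "compact (u ` {x \<in> \<Omega>. m x = \<tau>})"
    by (intro compact_continuous_image continuous_on_subset[OF continuous_smoothed]) auto
  then obtain M where "\<And>x. x \<in> \<Omega> \<Longrightarrow> m x = \<tau> \<Longrightarrow> \<bar>u x\<bar> \<le> M"
    using compact_imp_bounded by (fastforce simp: bounded_iff)
  then show ?thesis using that[of "max M 0"] by force
qed

end

context eps_delta_smoothing
begin

text \<open>From a point with \<open>m x = \<tau>\<close> one climbs on to distance
  \<open>T\<close>, where a cube of side \<rho> fits and the norm bounds the mean of
  \<open>\<bar>f\<bar>\<close>. Shrinking that cube to the one used for \<open>u z\<close> costs the
  volume ratio \<open>(2 * n * \<rho> / \<tau>) ^ n\<close>. The bound is linear in the norm on
  \<open>\<Omega> - Z\<close>, which gives both boundedness and decay.\<close>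

lemma smoothed_bound_large_scale:
  assumes T: "\<tau> \<le> T" "8 * T / \<epsilon> < \<delta>" and far: "\<And>x. x \<in> \<Omega> \<Longrightarrow> \<exists>p\<in>\<Omega>. 8 * T / \<epsilon> \<le> dist x p"
    and rho: "real CARD('n) * \<rho> \<le> T" "\<tau> \<le> \<rho>"
    and W: "bmo_norm \<rho> (\<Omega> - Z) f \<le> ennreal W" "0 \<le> W"
    and x: "x \<in> \<Omega>" "m x = \<tau>" and Z: "ball x (8 / \<epsilon> * T + \<tau> + T) \<inter> Z = {}"
  shows "\<bar>u x\<bar> \<le> ((2 * ln (T / \<tau>) + 1) * (climb_const CARD('n) \<epsilon> * (T / \<tau>))
      + tent_const CARD('n) * (2 * real CARD('n) * \<rho> / \<tau>) ^ CARD('n)) * W"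
proof -
  let ?n = "real CARD('n)" and ?N = "CARD('n)"
  have T0: "0 < T" "0 < \<rho>" using T rho \<tau>_pos by auto
  have "osc (\<Omega> - Z) f \<tau> \<le> osc (\<Omega> - Z) f \<rho>" using rho by (intro osc_mono) auto
  also have "\<dots> \<le> ennreal W" using osc_le_bmo_norm W(1) by (rule order_trans)
  finally have oW: "osc (\<Omega> - Z) f \<tau> \<le> ennreal W" .
  have "ball x (8 / \<epsilon> * T + \<tau>) \<inter> Z = {}"
    using Z subset_ball[of "8 / \<epsilon> * T + \<tau>" "8 / \<epsilon> * T + \<tau> + T" x] T0 by auto
  from climb_log[OF T far oW W(2) x(1) this] obtain z where z: "z \<in> \<Omega>" "bdist T \<Omega> z = T"
      "dist x z \<le> 8 / \<epsilon> * T" "\<bar>u x - u z\<bar>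
          \<le> (2 * ln (T / bdist T \<Omega> x) + 1) * (climb_const ?N \<epsilon> * (T / \<tau>) * W)"
    by blast
  have "\<tau> \<le> bdist T \<Omega> x" using x(2) bdist_eq_min[OF T(1), of \<Omega> x] by simp
  then have "ln (T / bdist T \<Omega> x) \<le> ln (T / \<tau>)"
    using T0 \<tau>_pos by (subst ln_le_cancel_iff) (auto intro!: divide_left_mono)
  then have "(2 * ln (T / bdist T \<Omega> x) + 1) * (climb_const ?N \<epsilon> * (T / \<tau>) * W)
      \<le> (2 * ln (T / \<tau>) + 1) * (climb_const ?N \<epsilon> * (T / \<tau>) * W)"
    using J_nonneg T0 \<tau>_pos W by (intro mult_right_mono) auto
  with z(4) have 1: "\<bar>u x - u z\<bar> \<le> (2 * ln (T / \<tau>) + 1) * (climb_const ?N \<epsilon> * (T / \<tau>)) * W"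
      by (simp add: mult.assoc)
  have mz: "m z = \<tau>" using bdist_eq_min[OF T(1), of \<Omega> z] z(2) T by simp
  then have rz: "r z = \<tau> / (8 * ?n)" by (simp add: smoothing_radius_def)
  have "?n * (\<rho> / 2) < T" using rho T0 by simp
  then have "cub z (\<rho> / 2) \<subseteq> ball z T" using cub_subset_cball[of z "\<rho> / 2"] by auto
  moreover have "ball z T \<subseteq> \<Omega>" using ball_bdist_subset[of z T \<Omega>] z(2) by simp
  moreover have "ball z T \<subseteq> ball x (8 / \<epsilon> * T + \<tau> + T)"
    using z(3) \<tau>_pos by (intro ball_subset_ball_iff[THEN iffD2]) (auto simp: dist_commute)
  ultimately have big: "cub z (\<rho> / 2) \<subseteq> \<Omega> - Z" "cub z (\<rho> / 2) \<subseteq> \<Omega>" using Z by blast+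
  have "ennreal (cube_mean (cub z (\<rho> / 2)) (\<lambda>y. \<bar>f y\<bar>)) \<le> ennreal W"
    using le_bmo_norm[of "\<rho> / 2" \<rho> z "\<Omega> - Z" f] W(1) big T0 by (auto intro: order_trans)
  then have "cube_mean (cub z (\<rho> / 2)) (\<lambda>y. \<bar>f y\<bar>) \<le> W" using W(2) by (simp add: ennreal_le_iff)
  then have Ib: "(LINT y|lebesgue_on (cub z (\<rho> / 2)). \<bar>f y\<bar>) \<le> W * \<rho> ^ ?N"
    using T0 by (simp add: cube_mean_eq measure_cub field_simps)
  have sub: "cub z (2 * r z) \<subseteq> cub z (\<rho> / 2)"
    using r_small[OF z(1)] rho by (intro cub_mono) auto
  have "(LINT y|lebesgue_on (cub z (2 * r z)). \<bar>f y\<bar>) \<le> (LINT y|lebesgue_on (cub z (\<rho> / 2)). \<bar>f y\<bar>)"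
  proof -
    have i: "integrable (lebesgue_on (cub z (2 * r z))) (\<lambda>y. \<bar>f y\<bar>)" "integrable (lebesgue_on (cub z (\<rho> / 2))) (\<lambda>y. \<bar>f y\<bar>)"
      using int_f[OF z(1)] locint_f big T0 by auto
    then show ?thesis
      using sub by (simp add: integral_restrict_space integrable_restrict_space)
        (rule integral_mono, auto split: split_indicator)
  qed
  also have "\<dots> \<le> W * (2 * ?n * \<rho> / \<tau>) ^ ?N * (4 * r z) ^ ?N"
  proof -
    have e: "(2 * ?n * \<rho> / \<tau>) * (4 * r z) = \<rho>" using \<tau>_pos by (simp add: rz)
    have "(2 * ?n * \<rho> / \<tau>) ^ ?N * (4 * r z) ^ ?N = \<rho> ^ ?N"
      unfolding power_mult_distrib[symmetric] e ..
    then show ?thesis using Ib by (simp only: mult.assoc)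
  qed
  finally have "\<bar>u z\<bar> \<le> tent_const ?N * (W * (2 * ?n * \<rho> / \<tau>) ^ ?N)"
      by (rule smoothed_abs_le[OF z(1)])
  then have "\<bar>u z\<bar> \<le> tent_const ?N * (2 * ?n * \<rho> / \<tau>) ^ ?N * W" by (simp add: ac_simps)
  then show ?thesis using 1 by (simp only: distrib_right)
qed

end

lemma eps_delta_smoothingI:
  assumes "eps_delta_domain \<epsilon> \<delta> \<Omega>" "0 < \<epsilon>" "\<epsilon> \<le> 1" "0 < \<tau>" "locint \<Omega> f"
  shows "eps_delta_smoothing \<Omega> f \<tau> \<epsilon> \<delta>"
  using assms by unfold_locales (auto simp: eps_delta_domain_def domain_def)

text \<open>The second inequality permits a climb up to \<open>T = CARD('n) * \<rho>\<close>, enough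
  room for a cube of side \<rho>.\<close>

lemma scale_param_bounds:
  assumes "0 < \<epsilon>" "\<epsilon> \<le> 1" "0 < \<delta>"
  shows "0 < scale_param CARD('n::finite) \<epsilon> \<delta>"
    and "8 * (real CARD('n) * scale_param CARD('n) \<epsilon> \<delta>) / \<epsilon> < \<delta>"
proof -
  let ?n = "real CARD('n)"
  have d: "1 \<le> 1 + sqrt ?n * \<epsilon>" using assms by simp
  then show "0 < scale_param CARD('n) \<epsilon> \<delta>" using assms unfolding scale_param_def
      by (intro divide_pos_pos mult_pos_pos) (auto intro: add_pos_nonneg)
  have "8 * (?n * scale_param CARD('n) \<epsilon> \<delta>) / \<epsilon> = \<epsilon> * \<delta> / (40 * (1 + sqrt ?n * \<epsilon>))"
  proof -
    define D where "D = 1 + sqrt ?n * \<epsilon>"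
    have "0 < D" using d by (simp add: D_def)
    then show ?thesis using assms
      unfolding scale_param_def D_def[symmetric] by (simp add: power2_eq_square field_simps)
  qed
  also have "\<dots> \<le> 1 * \<delta> / (40 * 1)" using assms d
      by (intro frac_le mult_right_mono mult_left_mono) auto
  also have "\<dots> < \<delta>" using assms by simp
  finally show "8 * (?n * scale_param CARD('n) \<epsilon> \<delta>) / \<epsilon> < \<delta>" .
qed

subsection \<open>Approximation and its converse\<close>

lemma Lip_away_continuous: "g \<in> Lip_away \<Omega> \<Longrightarrow> continuous_on \<Omega> g"
  by (auto simp: Lip_away_def intro: lipschitz_on_continuous_on)

lemma bounded_continuous_in_bmo_space:
  assumes "continuous_on \<Omega> g" "\<And>x. x \<in> \<Omega> \<Longrightarrow> \<bar>g x\<bar> \<le> M"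
  shows "g \<in> bmo_space \<rho> \<Omega>"
proof -
  have "bmo_norm \<rho> \<Omega> g \<le> ennreal (3 * max M 0)"
    using assms by (intro bmo_norm_le_bound locint_continuous) force+
  then show ?thesis unfolding bmo_space_iff
    using locint_continuous[OF assms(1)] by (auto intro: le_less_trans)
qed

lemma Lip_away_in_bmo_space: "g \<in> Lip_away \<Omega> \<Longrightarrow> g \<in> bmo_space \<rho> \<Omega>"
  using Lip_away_continuous[of g \<Omega>]
  by (auto simp: Lip_away_def bounded_iff intro!: bounded_continuous_in_bmo_space)

lemma ball_disjoint_cball_zero:
  fixes z :: "'a::real_normed_vector"
  assumes "R + e \<le> norm z"
  shows "ball z e \<inter> cball 0 R = {}"
proof (rule ccontr)
  assume "ball z e \<inter> cball 0 R \<noteq> {}"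
  then obtain y where "dist z y < e" "norm y \<le> R" by auto
  then show False using norm_triangle_ineq2[of z y] assms by (simp add: dist_norm)
qed

lemma Lip_away_approximation:
  fixes \<Omega> :: "(real ^ 'n) set" and f :: "real ^ 'n \<Rightarrow> real"
  assumes eps: "0 < \<epsilon>" "\<epsilon> \<le> 1" "0 < \<delta>" and dom: "eps_delta_domain \<epsilon> \<delta> \<Omega>"
    and rho: "\<rho> = scale_param CARD('n) \<epsilon> \<delta>" and f: "f \<in> bmo_space \<rho> \<Omega>"
    and osc0: "(osc \<Omega> f \<longlongrightarrow> 0) (at_right 0)" and ne: "\<Omega> \<noteq> {}" and eta: "0 < \<eta>"
  obtains g where "g \<in> Lip_away \<Omega>" "bmo_norm \<rho> \<Omega> (\<lambda>x. f x - g x) < ennreal \<eta>"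
    "vanishes_at_infinity \<rho> \<Omega> f \<Longrightarrow> \<exists>R. \<forall>x\<in>\<Omega>. R \<le> norm x \<longrightarrow> \<bar>g x\<bar> \<le> \<eta>"
proof -
  let ?n = "real CARD('n)" and ?N = "CARD('n)"
  define J where "J = climb_const ?N \<epsilon>"
  have J: "0 < J" using eps by (simp add: J_def climb_const_def tent_const_def)
  define E where "E = 3 * (approx_const ?N * (1 + 3 * J))"
  have E: "0 \<le> E" using J vitali_const_nonneg[of ?N] tent_const_nonneg[of ?N]
      by (simp add: E_def approx_const_def)
  \<comment> \<open>The two bounds serve the two conclusions: \<open>E * W < \<eta>\<close> controls
    the norm of \<open>f - g\<close>, and \<open>2 * (J * W) \<le> \<eta>\<close> the size of
    \<open>g\<close> far out.\<close>
  define W where "W = min (\<eta> / (2 * (E + 1))) (\<eta> / (2 * J))"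
  have W: "0 < W" "W \<le> \<eta> / (2 * (E + 1))" "W \<le> \<eta> / (2 * J)" using eta E J by (auto simp: W_def)
  have EW: "E * W < \<eta>"
  proof -
    define F where "F = E + 1"
    have F: "0 < F" "W \<le> \<eta> / (2 * F)" "E \<le> F" using E W by (auto simp: F_def)
    have "E * W \<le> F * (\<eta> / (2 * F))" using F E W by (intro mult_mono) auto
    also have "\<dots> = \<eta> / 2" using F by simp
    also have "\<dots> < \<eta>" using eta by simp
    finally show ?thesis .
  qed
  have JW: "2 * (J * W) \<le> \<eta>" using W(3) J by (simp add: field_simps)
  have "eventually (\<lambda>t. osc \<Omega> f t < ennreal W) (at_right 0)"
    using order_tendstoD(2)[OF osc0, of "ennreal W"] W by simp
  then obtain t1 where t1: "0 < t1" "\<And>t. 0 < t \<Longrightarrow> t < t1 \<Longrightarrow> osc \<Omega> f t < ennreal W"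
    unfolding eventually_at_right_field by auto
  have op: "open \<Omega>" using dom by (auto simp: eps_delta_domain_def domain_def)
  obtain p where p: "p \<in> \<Omega>" using ne by auto
  \<comment> \<open>Two distinct points give the climb its targets: any point is at distance at
    least half of \<open>dist p q\<close> from one of them.\<close>
  then have "\<Omega> \<noteq> {p}" using op not_open_singleton by metis
  then obtain q where q: "q \<in> \<Omega>" "q \<noteq> p" using p by auto
  note rho_pos = scale_param_bounds(1)[OF eps, where 'n='n, folded rho]
  note rho_delta = scale_param_bounds(2)[OF eps, where 'n='n, folded rho]
  \<comment> \<open>Small oscillation, scale at most \<rho>, and a far point at distance
    \<open>8 * \<tau> / \<epsilon>\<close> from everywhere; the last works even in a domain of small
    diameter.\<close>
  define \<tau> where "\<tau> = min (min (t1 / 2) \<rho>) (\<epsilon> * dist p q / 32)"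
  have tau: "0 < \<tau>" "\<tau> < t1" "\<tau> \<le> \<rho>" "\<tau> \<le> \<epsilon> * dist p q / 32"
    using t1 rho_pos q eps by (auto simp: \<tau>_def)
  have lf: "locint \<Omega> f" using f by (simp add: bmo_space_iff)
  interpret eps_delta_smoothing \<Omega> f \<tau> \<epsilon> \<delta>
    by (rule eps_delta_smoothingI) (use dom eps tau lf in auto)
  define T where "T = ?n * \<rho>"
  have "1 * \<rho> \<le> T" unfolding T_def using rho_pos n_ge_1 by (intro mult_right_mono) auto
  then have T: "\<tau> \<le> T" using tau by linarith
  moreover have "8 * T / \<epsilon> < \<delta>" using rho_delta by (simp add: T_def)
  ultimately have T: "\<tau> \<le> T" "8 * T / \<epsilon> < \<delta>" by auto
  then have T0: "0 < T" using tau by linarith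
  have oW: "osc \<Omega> f \<tau> \<le> ennreal W" using t1 tau by (auto intro: less_imp_le)
  have "8 * \<tau> / \<epsilon> \<le> 8 * T / \<epsilon>" using T eps by (intro divide_right_mono) auto
  then have tau_delta: "8 * \<tau> / \<epsilon> < \<delta>" using T by linarith
  have far: "\<exists>p\<in>\<Omega>. 8 * \<tau> / \<epsilon> \<le> dist x p" for x
  proof -
    define y where "y = 8 * \<tau> / \<epsilon>"
    have "4 * y \<le> dist p q" using tau eps by (simp add: y_def field_simps)
    then have "y \<le> dist x p \<or> y \<le> dist x q"
      using dist_triangle[of p q x] zero_le_dist[of x p] zero_le_dist[of x q] dist_commute[of p x] dist_commute[of q x]
      by linarith
    then have "8 * \<tau> / \<epsilon> \<le> dist x p \<or> 8 * \<tau> / \<epsilon> \<le> dist x q" by (simp add: y_def)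
    then show ?thesis using p q by blast
  qed
  \<comment> \<open>One constant for all \<open>Z\<close> and \<open>W2\<close>: with
    \<open>Z\<close> empty it yields \<open>M\<close>, with \<open>Z\<close> a large ball and
    \<open>W2\<close> small it yields decay.\<close>
  have "\<exists>C\<ge>0. \<forall>Z W2 x. \<not> bounded \<Omega> \<longrightarrow> bmo_norm \<rho> (\<Omega> - Z) f \<le> ennreal W2 \<longrightarrow> 0 \<le> W2 \<longrightarrow> x \<in> \<Omega> \<longrightarrow> m x = \<tau> \<longrightarrow>
      ball x (8 / \<epsilon> * T + \<tau> + T) \<inter> Z = {} \<longrightarrow> \<bar>u x\<bar> \<le> C * W2"
  proof (intro exI conjI allI impI)
    show "0 \<le> (2 * ln (T / \<tau>) + 1) * (climb_const ?N \<epsilon> * (T / \<tau>)) + tent_const ?N * (2 * ?n * \<rho> / \<tau>) ^ ?N"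
      using T0 T tau rho_pos J_nonneg tent_const_nonneg[of ?N]
          by (intro add_nonneg_nonneg mult_nonneg_nonneg zero_le_power) auto
    fix Z W2 x
    assume unb: "\<not> bounded \<Omega>" and *: "bmo_norm \<rho> (\<Omega> - Z) f \<le> ennreal W2" "0 \<le> W2" "x \<in> \<Omega>" "m x = \<tau>"
      "ball x (8 / \<epsilon> * T + \<tau> + T) \<inter> Z = {}"
    have "\<exists>p\<in>\<Omega>. 8 * T / \<epsilon> \<le> dist y p" for y
    proof (rule ccontr)
      assume "\<not> (\<exists>p\<in>\<Omega>. 8 * T / \<epsilon> \<le> dist y p)"
      then have "\<Omega> \<subseteq> ball y (8 * T / \<epsilon>)" by (auto simp: not_le)
      then show False using unb bounded_subset bounded_ball by blast
    qed
    then show "\<bar>u x\<bar>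
        \<le> ((2 * ln (T / \<tau>) + 1) * (climb_const ?N \<epsilon> * (T / \<tau>)) + tent_const ?N * (2 * ?n * \<rho> / \<tau>) ^ ?N) * W2"
      using * T tau by (intro smoothed_bound_large_scale) (auto simp: T_def)
  qed
  then obtain C where C: "0 \<le> C" "\<And>Z W2 x. \<not> bounded \<Omega> \<Longrightarrow> bmo_norm \<rho> (\<Omega> - Z) f \<le> ennreal W2 \<Longrightarrow> 0
      \<le> W2 \<Longrightarrow>
      x \<in> \<Omega> \<Longrightarrow> m x = \<tau> \<Longrightarrow> ball x (8 / \<epsilon> * T + \<tau> + T) \<inter> Z = {} \<Longrightarrow> \<bar>u x\<bar> \<le> C * W2"
    by blast
  obtain M where M: "0 \<le> M" "\<And>x. x \<in> \<Omega> \<Longrightarrow> m x = \<tau> \<Longrightarrow> \<bar>u x\<bar> \<le> M"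
  proof (cases "bounded \<Omega>")
    case True
    then show ?thesis using smoothed_bounded_on_compact that by metis
  next
    case False
    define W2 where "W2 = enn2real (bmo_norm \<rho> \<Omega> f)"
    have "bmo_norm \<rho> (\<Omega> - {}) f \<le> ennreal W2"
      using f by (simp add: W2_def bmo_space_iff ennreal_enn2real)
    then have "\<bar>u x\<bar> \<le> C * W2" if "x \<in> \<Omega>" "m x = \<tau>" for x
      using C(2)[OF False, of "{}" W2 x] that by (auto simp: W2_def)
    then show ?thesis using that[of "C * W2"] C(1) by (simp add: W2_def)
  qed
  define K where "K = J * W"
  have K: "0 < K" using J W by (simp add: K_def)
  \<comment> \<open>With target \<open>T = \<tau>\<close> the factor \<open>T / \<tau>\<close> is
    \<open>1\<close>, so a doubling costs only \<open>J * W\<close>.\<close>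
  have chain: "\<exists>z\<in>\<Omega>. m z = \<tau> \<and> dist x z \<le> 8 / \<epsilon> * \<tau> \<and> \<bar>u x - u z\<bar> \<le> (2 * ln (\<tau> / m x) + 1) * K"
    if x: "x \<in> \<Omega>" for x
    using climb_log[of \<tau> "{}" W x] tau_delta far oW W x tau by (simp add: K_def J_def)
  have bound: "\<bar>u x\<bar> \<le> M + (2 * ln (\<tau> / m x) + 1) * K" if x: "x \<in> \<Omega>" for x
    using chain[OF x] M(2) by force
  \<comment> \<open>Any slope above the growth rate \<open>2 * K\<close> would make the barrier win;
    \<open>3 * K\<close> is still proportional to \<open>W\<close>.\<close>
  define B where "B = 3 * K"
  have B0: "0 \<le> B" using K by (simp add: B_def)
  define g where "g = soft_threshold B"
  have gL: "g \<in> Lip_away \<Omega>" unfolding g_def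
    by (rule soft_threshold_Lip_away(1)[OF oW _ K _ M(1) bound]) (use W in \<open>auto simp: B_def\<close>)
  have "bmo_norm \<rho> \<Omega> (\<lambda>x. f x - g x) \<le> ennreal (3 * (approx_const ?N * (W + B)))"
    unfolding g_def using W tau gL B0
        by (intro bmo_norm_soft_threshold oW locint_continuous Lip_away_continuous) (auto simp: g_def)
  also have "3 * (approx_const ?N * (W + B)) = E * W" by (simp add: E_def B_def K_def algebra_simps)
  also have "ennreal (E * W) < ennreal \<eta>" using EW E W by (simp add: ennreal_lessI eta)
  finally have gn: "bmo_norm \<rho> \<Omega> (\<lambda>x. f x - g x) < ennreal \<eta>" .
  have gv: "\<exists>R. \<forall>x\<in>\<Omega>. R \<le> norm x \<longrightarrow> \<bar>g x\<bar> \<le> \<eta>" if van: "vanishes_at_infinity \<rho> \<Omega> f"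
  proof (cases "bounded \<Omega>")
    case True
    then obtain R where "\<And>x. x \<in> \<Omega> \<Longrightarrow> norm x \<le> R" by (auto simp: bounded_iff)
    then show ?thesis by (intro exI[of _ "R + 1"]) force
  next
    case False
    \<comment> \<open>Makes the far-out replacement \<open>C * W2\<close> of \<open>M\<close> at
      most \<open>K\<close>. Then \<open>\<bar>u x\<bar>\<close> is at most
      \<open>2 * K + 2 * K * ln (\<tau> / m x)\<close>, hence within \<open>2 * K\<close> of the
      barrier.\<close>
    define W2 where "W2 = K / (C + 1)"
    have W2: "0 < W2" using K C by (simp add: W2_def)
    have "C * W2 \<le> (C + 1) * W2" using W2 by (intro mult_right_mono) auto
    then have CW2: "C * W2 \<le> K" using C(1) by (simp add: W2_def)
    have "eventually (\<lambda>R. bmo_norm \<rho> (\<Omega> - cball 0 R) f < ennreal W2) at_top"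
      using van W2 unfolding vanishes_at_infinity_def by (intro order_tendstoD(2)) auto
    then obtain R0 where R0: "bmo_norm \<rho> (\<Omega> - cball 0 R0) f < ennreal W2"
      unfolding eventually_at_top_linorder by blast
    \<comment> \<open>Room for the climb from \<open>x\<close> to distance \<tau> from the boundary,
      and then for the ball that must avoid \<open>cball 0 R0\<close>.\<close>
    define R where "R = R0 + (8 / \<epsilon> * T + \<tau> + T) + 8 / \<epsilon> * \<tau>"
    have "\<bar>g x\<bar> \<le> \<eta>" if x: "x \<in> \<Omega>" and R: "R \<le> norm x" for x
    proof -
      obtain z where z: "z \<in> \<Omega>" "m z = \<tau>" "dist x z \<le> 8 / \<epsilon> * \<tau>" "\<bar>u x - u z\<bar>
          \<le> (2 * ln (\<tau> / m x) + 1) * K"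
        using chain[OF x] by blast
      have "R0 + (8 / \<epsilon> * T + \<tau> + T) \<le> norm z"
        using R z(3) norm_triangle_ineq2[of x z] unfolding R_def dist_norm by linarith
      then have "\<bar>u z\<bar> \<le> C * W2"
        using z R0 W2 by (intro C(2)[OF False, of "cball 0 R0"] ball_disjoint_cball_zero) auto
      then have ux: "\<bar>u x\<bar> \<le> K + (2 * ln (\<tau> / m x) + 1) * K" using z(4) CW2 by linarith
      have "0 \<le> ln (\<tau> / m x)" using m_pos[OF x] bdist_le[of \<tau> \<Omega> x] by simp
      then have "0 \<le> K * ln (\<tau> / m x)" using K by simp
      then have "\<bar>u x\<bar> - barrier B x \<le> 2 * K" using ux
          by (simp add: barrier_def B_def algebra_simps)
      then have "\<bar>g x\<bar> \<le> 2 * K" unfolding g_def soft_threshold_abs[OF B0 x] using K by simp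
      then show ?thesis using JW by (simp add: K_def)
    qed
    then show ?thesis by blast
  qed
  show ?thesis using that gL gn gv by blast
qed

section \<open>Cutting off to compact support\<close>

lemma supp_subset_dom:
  assumes "edist (supp \<Omega> g) (frontier \<Omega>) > 0"
  shows "supp \<Omega> g \<subseteq> \<Omega>"
proof
  fix x assume x: "x \<in> supp \<Omega> g"
  then have "x \<in> closure \<Omega>"
    using closure_mono[of "support_on \<Omega> g" \<Omega>] by (auto simp: supp_def support_on_def)
  moreover have "x \<notin> frontier \<Omega>"
  proof
    assume "x \<in> frontier \<Omega>"
    then have "edist (supp \<Omega> g) (frontier \<Omega>) \<le> ennreal (dist x x)"
      unfolding edist_def using x by (intro INF_lower2[of x]) auto
    with assms show False by simp
  qed
  ultimately show "x \<in> \<Omega>" using interior_subset[of \<Omega>] by (auto simp: frontier_def)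
qed

lemma supp_zero:
  assumes "x \<in> \<Omega>" "x \<notin> supp \<Omega> g"
  shows "g x = 0"
proof (rule ccontr)
  assume "g x \<noteq> 0"
  then have "x \<in> support_on \<Omega> g" using assms by (simp add: support_on_def)
  then have "x \<in> supp \<Omega> g" unfolding supp_def by (rule subsetD[OF closure_subset])
  then show False using assms by simp
qed

lemma supp_mult_subset: "supp \<Omega> (\<lambda>x. g x * c x) \<subseteq> supp \<Omega> g"
  unfolding supp_def by (intro closure_mono) (auto simp: support_on_def)

lemma bounded_continuous_dist:
  assumes "locint \<Omega> f" "continuous_on \<Omega> g" "continuous_on \<Omega> h" "\<And>x. x \<in> \<Omega> \<Longrightarrow> \<bar>g x - h x\<bar> \<le> e" "0 \<le> e"
    and "bmo_norm \<rho> \<Omega> (\<lambda>x. f x - g x) < ennreal a" "0 < a"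
  shows "bmo_norm \<rho> \<Omega> (\<lambda>x. f x - h x) < ennreal (a + 3 * e)"
proof -
  have lg: "locint \<Omega> g" "locint \<Omega> h" using assms locint_continuous by blast+
  have "bmo_norm \<rho> \<Omega> (\<lambda>x. (f x - g x) + (g x - h x))
      \<le> bmo_norm \<rho> \<Omega> (\<lambda>x. f x - g x) + bmo_norm \<rho> \<Omega> (\<lambda>x. g x - h x)"
    using assms lg by (intro bmo_norm_triangle locint_diff)
  also have "\<dots> \<le> bmo_norm \<rho> \<Omega> (\<lambda>x. f x - g x) + ennreal (3 * e)"
    using assms lg by (intro add_left_mono bmo_norm_le_bound locint_diff) auto
  also have "\<dots> < ennreal a + ennreal (3 * e)"
    using assms(6) by (subst (1 2) add.commute) (simp add: ennreal_add_left_cancel_less)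
  finally show ?thesis using assms by simp
qed

text \<open>The Lipschitz approximation is at most \<open>\<eta> / 4\<close> in absolute value
  wherever the cutoff differs from one, so the cutoff is a uniformly small change; a uniform change
  \<open>e\<close> costs \<open>3 * e\<close> in norm. Distance from the boundary is inherited, and
  boundedness of the support then makes it compact.\<close>

lemma Cc_approximation:
  fixes \<Omega> :: "(real ^ 'n) set" and f :: "real ^ 'n \<Rightarrow> real"
  assumes eps: "0 < \<epsilon>" "\<epsilon> \<le> 1" "0 < \<delta>" and dom: "eps_delta_domain \<epsilon> \<delta> \<Omega>"
    and rho: "\<rho> = scale_param CARD('n) \<epsilon> \<delta>" and f: "f \<in> bmo_space \<rho> \<Omega>"
    and osc0: "(osc \<Omega> f \<longlongrightarrow> 0) (at_right 0)" and ne: "\<Omega> \<noteq> {}" and eta: "0 < \<eta>"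
    and van: "vanishes_at_infinity \<rho> \<Omega> f"
  obtains g where "g \<in> Cc \<Omega>" "bmo_norm \<rho> \<Omega> (\<lambda>x. f x - g x) < ennreal \<eta>"
proof -
  have "0 < \<eta> / 4" using eta by simp
  from Lip_away_approximation[OF eps dom rho f osc0 ne this] van obtain g R
    where g: "g \<in> Lip_away \<Omega>" "bmo_norm \<rho> \<Omega> (\<lambda>x. f x - g x) < ennreal (\<eta> / 4)"
      and R: "\<And>x. x \<in> \<Omega> \<Longrightarrow> R \<le> norm x \<Longrightarrow> \<bar>g x\<bar> \<le> \<eta> / 4"
    by metis
  define c where "c x = max 0 (min 1 (R + 1 - norm x))" for x :: "real ^ 'n"
  define h where "h x = g x * c x" for x
  have c: "0 \<le> c x" "c x \<le> 1" "R + 1 \<le> norm x \<Longrightarrow> c x = 0" "norm x \<le> R \<Longrightarrow> c x = 1" for x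
    by (auto simp: c_def)
  have cg: "continuous_on \<Omega> g" using g Lip_away_continuous by blast
  have ch: "continuous_on \<Omega> h" unfolding h_def c_def by (intro continuous_intros cg)
  have sub: "supp \<Omega> h \<subseteq> \<Omega>"
    using supp_mult_subset[of \<Omega> g c] supp_subset_dom[of \<Omega> g] g
        by (auto simp: h_def[abs_def] Lip_away_def)
  have "support_on \<Omega> h \<subseteq> cball 0 (R + 1)"
  proof
    fix x assume "x \<in> support_on \<Omega> h"
    then have "c x \<noteq> 0" by (auto simp: support_on_def h_def)
    then show "x \<in> cball 0 (R + 1)" using c(3)[of x] by (cases "norm x \<le> R + 1") auto
  qed
  then have "bounded (supp \<Omega> h)" unfolding supp_def
      using bounded_closure bounded_subset bounded_cball by metis
  then have "compact (supp \<Omega> h)" by (simp add: compact_eq_bounded_closed supp_def)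
  with ch sub have "h \<in> Cc \<Omega>" by (simp add: Cc_def)
  moreover have "bmo_norm \<rho> \<Omega> (\<lambda>x. f x - h x) < ennreal (\<eta> / 4 + 3 * (\<eta> / 4))"
  proof (rule bounded_continuous_dist[OF _ cg ch _ _ g(2)])
    show "locint \<Omega> f" using f by (simp add: bmo_space_iff)
    fix x assume x: "x \<in> \<Omega>"
    have "\<bar>g x - h x\<bar> = \<bar>g x\<bar> * (1 - c x)"
    proof -
      have "g x - h x = g x * (1 - c x)" by (simp add: h_def algebra_simps)
      then show ?thesis using c(2)[of x] by (simp add: abs_mult)
    qed
    also have "\<dots> \<le> \<eta> / 4"
    proof (cases "norm x \<le> R")
      case False
      then have "\<bar>g x\<bar> * (1 - c x) \<le> \<eta> / 4 * 1" using R[OF x] c[of x] eta by (intro mult_mono) auto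
      then show ?thesis by simp
    qed (use c eta in simp)
    finally show "\<bar>g x - h x\<bar> \<le> \<eta> / 4" .
  qed (use eta in auto)
  ultimately show ?thesis using that[of h] by simp
qed

section \<open>Necessity: small oscillation and decay pass to closures\<close>

lemma osc_uniformly_continuous:
  assumes g: "uniformly_continuous_on \<Omega> (g :: real ^ 'n \<Rightarrow> real)"
  shows "(osc \<Omega> g \<longlongrightarrow> 0) (at_right 0)"
proof (rule tendsto_zero_ennreal)
  fix e :: real assume e: "0 < e"
  then have "0 < e / 4" by simp
  then obtain d where d: "0 < d" "\<And>x y. x \<in> \<Omega> \<Longrightarrow> y \<in> \<Omega> \<Longrightarrow> dist y x < d \<Longrightarrow> dist (g y) (g x) < e / 4"
    using g unfolding uniformly_continuous_on_def by blast
  have lg: "locint \<Omega> g" using g uniformly_continuous_imp_continuous locint_continuous by blast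
  have "osc \<Omega> g t < ennreal e" if "t < d / CARD('n)" for t
  proof -
    have "osc \<Omega> g t \<le> ennreal (2 * (e / 4))"
    proof (rule osc_le_dev[OF lg])
      fix x h assume h: "0 < (h::real)" "2 * h < t" "cub x h \<subseteq> \<Omega>"
      show "\<exists>c. dev (cub x h) g c \<le> ennreal (e / 4 * (2 * h) ^ CARD('n))"
      proof (intro exI dev_le_bound)
        fix y assume y: "y \<in> cub x h"
        have "dist x y \<le> CARD('n) * h" using y cub_subset_cball[of x h] by auto
        also have "\<dots> \<le> CARD('n) * t" using h by (intro mult_left_mono) auto
        also have "\<dots> < d" using that by (simp add: field_simps)
        finally have "dist (g y) (g x) < e / 4"
          using y h centre_in_cub[of h x] by (intro d(2)) (auto simp: dist_commute)
        then show "\<bar>g y - g x\<bar> \<le> e / 4" by (simp add: dist_real_def)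
      qed (use h e in auto)
    qed (use e in auto)
    also have "\<dots> < ennreal e" using e by (simp add: ennreal_lessI)
    finally show ?thesis .
  qed
  moreover have "0 < d / CARD('n)" using d by simp
  ultimately show "eventually (\<lambda>t. osc \<Omega> g t < ennreal e) (at_right 0)"
    unfolding eventually_at_right_field by blast
qed

text \<open>At scales below \<rho> the oscillation of \<open>f - g\<close> is at most its norm,
  uniformly in the scale, so the limit for \<open>g\<close> carries over to
  \<open>f\<close>.\<close>

lemma osc_bmo_closure:
  assumes f: "f \<in> bmo_closure \<rho> \<Omega> A" and "0 < \<rho>"
    and A: "\<And>g. g \<in> A \<Longrightarrow> (osc \<Omega> g \<longlongrightarrow> 0) (at_right 0)"
  shows "(osc \<Omega> f \<longlongrightarrow> 0) (at_right 0)"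
proof (rule tendsto_zero_ennreal)
  fix e :: real assume e: "0 < e"
  then obtain g where g: "g \<in> A" "g \<in> bmo_space \<rho> \<Omega>" "bmo_norm \<rho> \<Omega> (\<lambda>x. f x - g x) < ennreal (e / 2)"
    using f unfolding bmo_closure_def by (auto dest!: spec[of _ "e / 2"])
  have lf: "locint \<Omega> f" "locint \<Omega> g" using f g by (auto simp: bmo_closure_def bmo_space_iff)
  have "eventually (\<lambda>t. osc \<Omega> g t < ennreal (e / 2)) (at_right 0)"
    using e by (intro order_tendstoD(2)[OF A[OF g(1)]]) auto
  moreover have "eventually (\<lambda>t. t < \<rho>) (at_right (0::real))"
    using \<open>0 < \<rho>\<close> unfolding eventually_at_right_field by blast
  ultimately show "eventually (\<lambda>t. osc \<Omega> f t < ennreal e) (at_right 0)"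
  proof eventually_elim
    case (elim t)
    have "osc \<Omega> (\<lambda>x. f x - g x) t \<le> osc \<Omega> (\<lambda>x. f x - g x) \<rho>" using elim by (intro osc_mono) auto
    also have "\<dots> < ennreal (e / 2)" using osc_le_bmo_norm g(3) by (rule le_less_trans)
    finally have "osc \<Omega> (\<lambda>x. f x - g x) t + osc \<Omega> g t < ennreal (e / 2 + e / 2)"
      using elim by (intro add_mono_ennreal)
    moreover have "osc \<Omega> (\<lambda>x. (f x - g x) + g x) t \<le> osc \<Omega> (\<lambda>x. f x - g x) t + osc \<Omega> g t"
      using lf by (intro osc_triangle locint_diff)
    ultimately show ?case by simp
  qed
qed

text \<open>Outside a ball containing the support of \<open>g\<close>, \<open>f\<close> coincides
  with \<open>f - g\<close>.\<close>

lemma vanishes_at_infinity_bmo_closure: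
  assumes f: "f \<in> bmo_closure \<rho> \<Omega> (Cc \<Omega>)"
  shows "vanishes_at_infinity \<rho> \<Omega> f"
  unfolding vanishes_at_infinity_def
proof (rule tendsto_zero_ennreal)
  fix e :: real assume e: "0 < e"
  then obtain g where g: "g \<in> Cc \<Omega>" "bmo_norm \<rho> \<Omega> (\<lambda>x. f x - g x) < ennreal e"
    using f unfolding bmo_closure_def by auto
  obtain R where R: "\<And>x. x \<in> supp \<Omega> g \<Longrightarrow> norm x \<le> R"
    using g(1) compact_imp_bounded by (force simp: Cc_def bounded_iff)
  have "bmo_norm \<rho> (\<Omega> - cball 0 R') f < ennreal e" if "R \<le> R'" for R'
  proof -
    have "g x = 0" if x: "x \<in> \<Omega> - cball 0 R'" for x
    proof (rule supp_zero)
      show "x \<notin> supp \<Omega> g" using R x \<open>R \<le> R'\<close> by force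
    qed (use x in simp)
    then have "bmo_norm \<rho> (\<Omega> - cball 0 R') f = bmo_norm \<rho> (\<Omega> - cball 0 R') (\<lambda>x. f x - g x)"
      by (intro bmo_norm_cong) simp
    also have "\<dots> \<le> bmo_norm \<rho> \<Omega> (\<lambda>x. f x - g x)" by (intro bmo_norm_mono) auto
    finally show ?thesis using g(2) by simp
  qed
  then show "eventually (\<lambda>R. bmo_norm \<rho> (\<Omega> - cball 0 R) f < ennreal e) at_top"
    unfolding eventually_at_top_linorder by blast
qed

text \<open>Values of \<open>g\<close> outside \<Omega> are arbitrary, so they are first reset to
  zero. The result is continuous because \<Omega> and the complement of the support are open and
  cover the space.\<close>

lemma Cc_extension:
  fixes g :: "real ^ 'n \<Rightarrow> real"
  assumes g: "g \<in> Cc \<Omega>" and op: "open \<Omega>"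
  shows "continuous_on UNIV (\<lambda>x. if x \<in> \<Omega> then g x else 0)"
    and "x \<notin> supp \<Omega> g \<Longrightarrow> (if x \<in> \<Omega> then g x else 0) = 0"
proof -
  define g' where "g' x = (if x \<in> \<Omega> then g x else 0)" for x
  let ?K = "supp \<Omega> g"
  have K: "compact ?K" "?K \<subseteq> \<Omega>" "continuous_on \<Omega> g" using g by (auto simp: Cc_def)
  have out: "g' x = 0" if "x \<notin> ?K" for x
    using that supp_zero[of x \<Omega> g] by (simp add: g'_def)
  have "continuous_on (\<Omega> \<union> - ?K) g'"
  proof (rule continuous_on_open_Un[OF op])
    show "open (- ?K)" using K compact_imp_closed by blast
    show "continuous_on \<Omega> g'" using K(3) by (simp add: g'_def cong: continuous_on_cong)
    show "continuous_on (- ?K) g'" 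
    proof (rule continuous_on_eq)
      show "continuous_on (- ?K) (\<lambda>x. 0 :: real)" by simp
    qed (use out in auto)
  qed
  moreover have "\<Omega> \<union> - ?K = UNIV" using K by auto
  ultimately show "continuous_on UNIV (\<lambda>x. if x \<in> \<Omega> then g x else 0)" by (simp add: g'_def[abs_def])
  show "(if x \<in> \<Omega> then g x else 0) = 0" if "x \<notin> ?K" using out[OF that] by (simp add: g'_def)
qed

lemma Cc_uniformly_continuous:
  assumes g: "g \<in> Cc \<Omega>" and op: "open \<Omega>"
  shows "uniformly_continuous_on \<Omega> (g :: real ^ 'n \<Rightarrow> real)"
proof -
  define g' where "g' x = (if x \<in> \<Omega> then g x else 0)" for x
  let ?K = "supp \<Omega> g"
  have K: "compact ?K" using g by (simp add: Cc_def)
  have cont: "continuous_on UNIV g'"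
    using Cc_extension(1)[OF g op] by (simp add: g'_def[abs_def])
  have out: "g' x = 0" if "x \<notin> ?K" for x
    using Cc_extension(2)[OF g op that] by (simp add: g'_def)
  obtain R where R: "\<And>x. x \<in> ?K \<Longrightarrow> norm x \<le> R" using K compact_imp_bounded
      by (force simp: bounded_iff)
  have "uniformly_continuous_on (cball 0 (R + 1)) g'"
    using cont by (intro compact_uniformly_continuous) (auto intro: continuous_on_subset)
  show ?thesis
    unfolding uniformly_continuous_on_def
  proof (intro allI impI)
    fix e :: real assume e: "0 < e"
    then obtain d where d: "0 < d" "\<And>x y. x \<in> cball 0 (R + 1) \<Longrightarrow> y \<in> cball 0 (R + 1) \<Longrightarrow> dist y x < d
        \<Longrightarrow> dist (g' y) (g' x) < e"
      using \<open>uniformly_continuous_on _ g'\<close> unfolding uniformly_continuous_on_def by blast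
    show "\<exists>d>0. \<forall>x\<in>\<Omega>. \<forall>y\<in>\<Omega>. dist y x < d \<longrightarrow> dist (g y) (g x) < e"
    \<comment> \<open>With distance below \<open>1\<close>, if one point lies outside radius
      \<open>R + 1\<close>, both lie outside radius \<open>R\<close>, where the function
      vanishes.\<close>
    proof (intro exI[of _ "min d 1"] conjI ballI impI)
      fix x y assume xy: "x \<in> \<Omega>" "y \<in> \<Omega>" "dist y x < min d 1"
      have "dist (g' y) (g' x) < e"
      proof (cases "x \<in> cball 0 (R + 1) \<and> y \<in> cball 0 (R + 1)")
        case True then show ?thesis using d xy by auto
      next
        case False
        have "R < norm x" "R < norm y"
          using False xy(3) norm_triangle_ineq2[of x y] norm_triangle_ineq2[of y x]
          by (auto simp: dist_norm norm_minus_commute)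
        then have "g' x = 0" "g' y = 0" using R out by (meson not_le)+
        then show ?thesis using e by simp
      qed
      then show "dist (g y) (g x) < e" using xy by (simp add: g'_def)
    qed (use d in auto)
  qed
qed

subsection \<open>Smooth compactly supported functions\<close>

lemma Ck_on_subset: "Ck_on k S g \<Longrightarrow> T \<subseteq> S \<Longrightarrow> Ck_on k T g"
  by (induction k arbitrary: g) (auto intro: continuous_on_subset)

lemma Ck_on_Un:
  "Ck_on k S g \<Longrightarrow> Ck_on k T g \<Longrightarrow> open S \<Longrightarrow> open T \<Longrightarrow> Ck_on k (S \<union> T) g"
  by (induction k arbitrary: g) (auto intro: continuous_on_open_Un)

lemma Ck_on_cong:
  assumes "open S" "\<And>x. x \<in> S \<Longrightarrow> g x = h x" "Ck_on k S g"
  shows "Ck_on k S h"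
  using assms(2,3)
proof (induction k arbitrary: g h)
  case 0
  then show ?case by (simp cong: continuous_on_cong)
next
  case (Suc k)
  have d: "(h has_derivative frechet_derivative g (at x)) (at x)" if "x \<in> S" for x
    using Suc.prems that assms(1)
    by (intro has_derivative_transform_within_open[of g _ x UNIV S h])
       (auto simp: frechet_derivative_works)
  have eq: "frechet_derivative h (at x) = frechet_derivative g (at x)" if "x \<in> S" for x
    using frechet_derivative_at[OF d[OF that]] by simp
  moreover have "h differentiable at x" if "x \<in> S" for x
    using d[OF that] differentiable_def by blast
  moreover have "Ck_on k S (\<lambda>x. frechet_derivative h (at x) v)" for v
  proof (rule Suc.IH)
    show "Ck_on k S (\<lambda>x. frechet_derivative g (at x) v)" using Suc.prems(2) by simp
  qed (simp add: eq)
  ultimately show ?case by simp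
qed

text \<open>The standard flat function \<open>exp (- 1 / t)\<close> together with its multiples by
  powers of \<open>1 / t\<close>; the powers make the linear span closed under
  differentiation.\<close>

definition flat :: "nat \<Rightarrow> real \<Rightarrow> real" where
  "flat k t = (if t \<le> 0 then 0 else inverse t ^ k * exp (- inverse t))"

lemma flat_tendsto_0: "(flat k \<longlongrightarrow> 0) (at_right 0)"
proof -
  have "((\<lambda>t::real. inverse t ^ k / exp (inverse t)) \<longlongrightarrow> 0) (at_right 0)"
    by (rule filterlim_compose[OF tendsto_power_div_exp_0 filterlim_inverse_at_top_right])
  moreover have "eventually (\<lambda>t. inverse t ^ k / exp (inverse t) = flat k t) (at_right 0)"
    using eventually_at_right_less[of 0]
    by eventually_elim (simp add: flat_def exp_minus divide_inverse)
  ultimately show ?thesis by (rule Lim_transform_eventually)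
qed

lemma flat_has_derivative:
  "(flat k has_real_derivative flat (k + 2) t - real k * flat (k + 1) t) (at t)"
proof -
  consider "t < 0" | "t = 0" | "0 < t" by linarith
  then show ?thesis
  proof cases
    case 1
    have "((\<lambda>_. 0) has_real_derivative flat (k + 2) t - real k * flat (k + 1) t) (at t)"
      using 1 by (simp add: flat_def)
    then show ?thesis
      by (rule has_field_derivative_transform_within_open[of _ _ _ "{..<0}"]) (use 1 in \<open>auto simp: flat_def\<close>)
  next
    case 2
    have "((\<lambda>h. flat k h / h) \<longlongrightarrow> 0) (at_left 0)"
    proof (rule Lim_transform_eventually[of "\<lambda>_. 0"])
      show "eventually (\<lambda>h. 0 = flat k h / h) (at_left 0)"
        unfolding eventually_at_left_field by (auto simp: flat_def intro!: exI[of _ "-1"])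
    qed simp
    \<comment> \<open>Dividing by \<open>h\<close> only raises the index: the difference quotient at
      \<open>0\<close> is \<open>flat (Suc k) h\<close>.\<close>
    moreover have "((\<lambda>h. flat k h / h) \<longlongrightarrow> 0) (at_right 0)"
    proof (rule Lim_transform_eventually[OF flat_tendsto_0[of "Suc k"]])
      show "eventually (\<lambda>h. flat (Suc k) h = flat k h / h) (at_right 0)"
        using eventually_at_right_less[of 0]
        by eventually_elim (simp add: flat_def divide_inverse)
    qed
    ultimately have "((\<lambda>h. flat k h / h) \<longlongrightarrow> 0) (at 0)" by (simp add: filterlim_split_at)
    moreover have "flat j 0 = 0" for j by (simp add: flat_def)
    ultimately show ?thesis using 2 by (simp add: DERIV_def)
  next
    case 3
    have "((\<lambda>t. inverse t ^ k * exp (- inverse t)) has_real_derivative flat (k + 2) t - real k * flat (k + 1) t) (at t)"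
    proof (rule DERIV_cong)
      have D: "(inverse has_real_derivative - (inverse t ^ Suc (Suc 0))) (at t)"
        using 3 by (intro DERIV_inverse) simp
      show "((\<lambda>t. inverse t ^ k * exp (- inverse t)) has_real_derivative
          real k * (- (inverse t ^ Suc (Suc 0)) * inverse t ^ (k - Suc 0)) * exp (- inverse t) +
          exp (- inverse t) * - (- (inverse t ^ Suc (Suc 0))) * inverse t ^ k) (at t)"
        by (rule DERIV_mult[OF DERIV_power[OF D] DERIV_fun_exp[OF DERIV_minus[OF D]]])
      \<comment> \<open>For \<open>k = 0\<close> the exponent \<open>k - Suc 0\<close> is truncated
        to \<open>0\<close>, but its term has the factor \<open>real k = 0\<close>; hence the case
        split.\<close>
      show "real k * (- (inverse t ^ Suc (Suc 0)) * inverse t ^ (k - Suc 0)) * exp (- inverse t) +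
          exp (- inverse t) * - (- (inverse t ^ Suc (Suc 0))) * inverse t ^ k
          = flat (k + 2) t - real k * flat (k + 1) t"
        using 3 by (cases k) (auto simp: flat_def algebra_simps)
    qed
    then show ?thesis
      by (rule has_field_derivative_transform_within_open[of _ _ _ "{0<..}"]) (use 3 in \<open>auto simp: flat_def\<close>)
  qed
qed

lemma polynomial_has_derivative:
  assumes "real_polynomial_function (q :: real ^ 'n \<Rightarrow> real)"
  shows "\<exists>q'. (\<forall>x. (q has_derivative q' x) (at x)) \<and> (\<forall>v. real_polynomial_function (\<lambda>x. q' x v))"
  using assms
proof induction
  case (linear q)
  then show ?case
    by (intro exI[of _ "\<lambda>_. q"]) (auto intro: bounded_linear_imp_has_derivative real_polynomial_function.intros)
next
  case (const c)
  then show ?case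
    by (intro exI[of _ "\<lambda>_ _. 0"]) (auto intro: real_polynomial_function.intros)
next
  case (add p q)
  then obtain p' q' where "\<And>x. (p has_derivative p' x) (at x)" "\<And>v. real_polynomial_function (\<lambda>x. p' x v)"
      "\<And>x. (q has_derivative q' x) (at x)" "\<And>v. real_polynomial_function (\<lambda>x. q' x v)" by blast
  then show ?case
    by (intro exI[of _ "\<lambda>x v. p' x v + q' x v"]) (auto intro: has_derivative_add real_polynomial_function.intros)
next
  case (mult p q)
  then obtain p' q' where "\<And>x. (p has_derivative p' x) (at x)" "\<And>v. real_polynomial_function (\<lambda>x. p' x v)"
      "\<And>x. (q has_derivative q' x) (at x)" "\<And>v. real_polynomial_function (\<lambda>x. q' x v)" by blast
  with mult(1,2) show ?case
    by (intro exI[of _ "\<lambda>x v. p x * q' x v + p' x v * q x"]) (auto intro!: has_derivative_mult real_polynomial_function.intros(2-4))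
qed

text \<open>A class that contains the directional derivatives of its members, so continuous
  differentiability of every order follows by induction on the order, without formulas for higher
  derivatives.\<close>

inductive flat_poly :: "(real ^ 'n \<Rightarrow> real) \<Rightarrow> bool" where
  poly: "real_polynomial_function q \<Longrightarrow> flat_poly q"
| flat: "real_polynomial_function q \<Longrightarrow> flat_poly (\<lambda>x. flat k (q x))"
| add: "flat_poly g \<Longrightarrow> flat_poly h \<Longrightarrow> flat_poly (\<lambda>x. g x + h x)"
| mult: "flat_poly g \<Longrightarrow> flat_poly h \<Longrightarrow> flat_poly (\<lambda>x. g x * h x)"

lemma flat_poly_has_derivative:
  assumes "flat_poly g"
  shows "\<exists>g'. (\<forall>x. (g has_derivative g' x) (at x)) \<and> (\<forall>v. flat_poly (\<lambda>x. g' x v))"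
  using assms
proof induction
  case (poly q)
  from polynomial_has_derivative[OF poly] show ?case by (blast intro: flat_poly.poly)
next
  case (flat q k)
  then obtain q' where q': "\<And>x. (q has_derivative q' x) (at x)" "\<And>v. real_polynomial_function (\<lambda>x. q' x v)"
    using polynomial_has_derivative[OF flat] by blast
  let ?d = "\<lambda>x. flat (k + 2) (q x) + (- real k) * flat (k + 1) (q x)"
  have "((\<lambda>x. flat k (q x)) has_derivative (\<lambda>v. ?d x * q' x v)) (at x)" for x
    using has_derivative_compose[OF q'(1)[of x], of "flat k" "(*) (?d x)"] flat_has_derivative[of k "q x"]
    by (simp add: has_field_derivative_def)
  moreover have "flat_poly (\<lambda>x. ?d x * q' x v)" for v
    using flat q'(2) by (intro flat_poly.intros real_polynomial_function.intros(2)) auto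
  ultimately show ?case by (intro exI[of _ "\<lambda>x v. ?d x * q' x v"]) auto
next
  case (add p q)
  then obtain p' q' where "\<And>x. (p has_derivative p' x) (at x)" "\<And>v. flat_poly (\<lambda>x. p' x v)"
      "\<And>x. (q has_derivative q' x) (at x)" "\<And>v. flat_poly (\<lambda>x. q' x v)" by blast
  then show ?case
    by (intro exI[of _ "\<lambda>x v. p' x v + q' x v"]) (auto intro: has_derivative_add flat_poly.add)
next
  case (mult p q)
  then obtain p' q' where "\<And>x. (p has_derivative p' x) (at x)" "\<And>v. flat_poly (\<lambda>x. p' x v)"
      "\<And>x. (q has_derivative q' x) (at x)" "\<And>v. flat_poly (\<lambda>x. q' x v)" by blast
  with mult(1,2) show ?case
    by (intro exI[of _ "\<lambda>x v. p x * q' x v + p' x v * q x"]) (auto intro!: has_derivative_mult flat_poly.add flat_poly.mult)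
qed

lemma flat_poly_Ck_on: "flat_poly g \<Longrightarrow> Ck_on k S g"
proof (induction k arbitrary: g)
  case 0
  then obtain g' where "\<And>x. (g has_derivative g' x) (at x)"
      using flat_poly_has_derivative[OF 0] by blast
  then have "continuous_on S g"
      by (intro continuous_at_imp_continuous_on ballI has_derivative_continuous)
  then show ?case by simp
next
  case (Suc k)
  then obtain g' where g': "\<And>x. (g has_derivative g' x) (at x)" "\<And>v. flat_poly (\<lambda>x. g' x v)"
    using flat_poly_has_derivative[OF Suc.prems] by blast
  have "frechet_derivative g (at x) = g' x" for x using frechet_derivative_at[OF g'(1)] by simp
  then show ?case using g' Suc.IH by (auto simp: differentiable_def)
qed

text \<open>A polynomial approximation \<open>p\<close> is cut off by the factor \<open>flat 0 ((p\<^sup>2 - 4 * \<eta>\<^sup>2) / c)\<close>, which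
  vanishes where \<open>p\<close> is at most \<open>2 * \<eta>\<close> in absolute value and is close to one where \<open>p\<close> exceeds \<open>3 * \<eta>\<close>.\<close>

lemma Cc_infinity_approximation:
  fixes g :: "real ^ 'n \<Rightarrow> real"
  assumes g: "g \<in> Cc \<Omega>" and op: "open \<Omega>" and e: "0 < e"
  obtains h where "h \<in> Cc_infinity \<Omega>" "\<And>x. x \<in> \<Omega> \<Longrightarrow> \<bar>g x - h x\<bar> \<le> e"
proof -
  define \<eta> where "\<eta> = e / 4"
  have eta: "0 < \<eta>" using e by (simp add: \<eta>_def)
  define g' where "g' x = (if x \<in> \<Omega> then g x else 0)" for x
  let ?K = "supp \<Omega> g"
  have K: "compact ?K" "?K \<subseteq> \<Omega>" using g by (auto simp: Cc_def)
  have cont: "continuous_on UNIV g'"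
    using Cc_extension(1)[OF g op] by (simp add: g'_def[abs_def])
  have out: "g' x = 0" if "x \<notin> ?K" for x
    using Cc_extension(2)[OF g op that] by (simp add: g'_def)
  obtain R where R: "?K \<subseteq> ball 0 R"
    using K(1) compact_imp_bounded bounded_subset_ballD by blast
  obtain p where p: "real_polynomial_function p" "\<And>x. x \<in> cball 0 R \<Longrightarrow> \<bar>g' x - p x\<bar> < \<eta>"
    using Stone_Weierstrass_real_polynomial_function[OF compact_cball continuous_on_subset[OF cont subset_UNIV] eta] by metis
  have "continuous_on (cball 0 R) p"
    using p(1) by (simp add: continuous_on_polymonial_function real_polynomial_function_eq)
  then have "bounded (p ` cball 0 R)"
      by (intro compact_imp_bounded compact_continuous_image compact_cball)
  then obtain M where M: "0 < M" "\<And>x. x \<in> cball 0 R \<Longrightarrow> \<bar>p x\<bar> \<le> M" unfolding bounded_pos by auto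
  \<comment> \<open>Where \<open>\<bar>p x\<bar>\<close> exceeds \<open>3 * \<eta>\<close> one has
    \<open>q x \<ge> 5 * \<eta>^2 / c\<close>, so the factor misses one by at most
    \<open>c / (5 * \<eta>^2)\<close>; times the bound \<open>M\<close> for \<open>p\<close> this is
    \<eta>.\<close>
  define c where "c = 5 * \<eta> ^ 3 / M"
  have c: "0 < c" using eta M by (simp add: c_def)
  define q where "q x = ((p x)\<^sup>2 - 4 * \<eta>\<^sup>2) / c" for x
  have q: "real_polynomial_function q"
    unfolding q_def[abs_def] power2_eq_square using p(1)
    by (intro real_polynomial_function_divide real_polynomial_function_diff real_polynomial_function.intros(2-4))
  define \<phi> where "\<phi> x = p x * flat 0 (q x)" for x
  have phi: "flat_poly \<phi>" unfolding \<phi>_def[abs_def] by (intro flat_poly.intros p q)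
  \<comment> \<open>Outside the ball the polynomial approximates nothing and must be discarded; no
    jump arises, as \<phi> already vanishes near the sphere.\<close>
  define h where "h x = (if x \<in> ball 0 R then \<phi> x else 0)" for x
  \<comment> \<open>A closed part of the support of \<open>g\<close> outside which \<open>h\<close>
    vanishes: in the ball, \<open>\<bar>p x\<bar> > 2 * \<eta>\<close> forces
    \<open>\<bar>g' x\<bar> > \<eta>\<close>.\<close>
  define C where "C = {x. \<eta> \<le> \<bar>g' x\<bar>}"
  have CK: "C \<subseteq> ?K" using out eta by (force simp: C_def)
  have clC: "closed C" unfolding C_def using cont by (intro closed_Collect_le continuous_intros)
  have hC: "h x = 0" if "x \<notin> C" for x
  proof (rule ccontr)
    assume "h x \<noteq> 0"
    then have x: "x \<in> ball 0 R" "\<phi> x \<noteq> 0" by (auto simp: h_def split: if_splits)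
    then have "0 < q x" by (auto simp: \<phi>_def flat_def split: if_splits)
    then have "(2 * \<eta>)\<^sup>2 < (p x)\<^sup>2" using c
        by (simp add: q_def zero_less_divide_iff power_mult_distrib)
    then have "2 * \<eta> < \<bar>p x\<bar>" using eta power2_less_imp_less[of "2 * \<eta>" "\<bar>p x\<bar>"] by simp
    moreover have "\<bar>g' x - p x\<bar> < \<eta>" using p(2)[of x] x(1) by auto
    ultimately have "\<eta> \<le> \<bar>g' x\<bar>" by linarith
    then show False using that by (simp add: C_def)
  qed
  \<comment> \<open>The ball and the complement of \<open>C\<close> are open and cover everything;
    \<open>h\<close> is \<phi> on the first and zero on the second.\<close>
  have "Ck_on k \<Omega> h" for k
  proof -
    have "Ck_on k (ball 0 R) h"
      by (rule Ck_on_cong[OF _ _ flat_poly_Ck_on[OF phi]]) (auto simp: h_def)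
    moreover have "Ck_on k (- C) h"
      by (rule Ck_on_cong[OF _ _ flat_poly_Ck_on[OF flat_poly.poly[OF real_polynomial_function.intros(2)[of 0]]]])
         (use clC hC in auto)
    ultimately have "Ck_on k (ball 0 R \<union> - C) h" using clC by (intro Ck_on_Un) auto
    then show ?thesis by (rule Ck_on_subset) (use CK R in auto)
  qed
  moreover have sC: "supp \<Omega> h \<subseteq> C"
    unfolding supp_def by (rule closure_minimal) (use hC clC in \<open>auto simp: support_on_def\<close>)
  have "compact C" using clC CK K(1) compact_Int_closed[of ?K C] by (simp add: Int_absorb1)
  then have "compact (supp \<Omega> h)"
    using sC by (metis closed_closure compact_Int_closed inf.absorb_iff2 supp_def)
  moreover have "supp \<Omega> h \<subseteq> \<Omega>" using sC CK K by blast
  ultimately have "h \<in> Cc_infinity \<Omega>" by (simp add: Cc_infinity_def)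
  moreover have "\<bar>g x - h x\<bar> \<le> e" if x: "x \<in> \<Omega>" for x
  proof (cases "x \<in> ball 0 R")
    case False
    then have "x \<notin> ?K" using R by blast
    then have "g x = 0" using out[of x] x by (simp add: g'_def)
    then show ?thesis using False e by (simp add: h_def)
  next
    case True
    have xc: "x \<in> cball 0 R" using True by auto
    have f01: "0 \<le> flat 0 (q x)" "flat 0 (q x) \<le> 1" by (auto simp: flat_def)
    have "\<bar>p x - \<phi> x\<bar> = \<bar>p x\<bar> * (1 - flat 0 (q x))"
    proof -
      have "p x - \<phi> x = p x * (1 - flat 0 (q x))" by (simp add: \<phi>_def algebra_simps)
      then show ?thesis using f01 by (simp add: abs_mult)
    qed
    also have "\<dots> \<le> 3 * \<eta>"
    proof (cases "\<bar>p x\<bar> \<le> 3 * \<eta>")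
      case True
      then have "\<bar>p x\<bar> * (1 - flat 0 (q x)) \<le> 3 * \<eta> * 1" using f01 eta by (intro mult_mono) auto
      then show ?thesis by simp
    next
      case False
      then have "(3 * \<eta>)\<^sup>2 \<le> \<bar>p x\<bar>\<^sup>2" using eta by (intro power_mono) auto
      then have "5 * \<eta>\<^sup>2 / c \<le> q x" using c
          by (simp add: q_def power_mult_distrib divide_right_mono)
      moreover have "0 < 5 * \<eta>\<^sup>2 / c" using eta c by simp
      ultimately have q0: "0 < q x" "inverse (q x) \<le> inverse (5 * \<eta>\<^sup>2 / c)"
        by (linarith, rule le_imp_inverse_le)
      have "1 + (- inverse (q x)) \<le> exp (- inverse (q x))" by (rule exp_ge_add_one_self)
      then have "1 - flat 0 (q x) \<le> inverse (q x)" using q0 by (simp add: flat_def)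
      also have "\<dots> \<le> c / (5 * \<eta>\<^sup>2)" using q0(2) by (simp only: inverse_divide)
      finally have "\<bar>p x\<bar> * (1 - flat 0 (q x)) \<le> M * (c / (5 * \<eta>\<^sup>2))"
        using M f01 xc by (intro mult_mono) auto
      also have "\<dots> = \<eta>" using M eta by (simp add: c_def power2_eq_square power3_eq_cube)
      finally show ?thesis using eta by simp
    qed
    finally have "\<bar>p x - \<phi> x\<bar> \<le> 3 * \<eta>" .
    moreover have "\<bar>g x - p x\<bar> < \<eta>" using p(2)[OF xc] x by (simp add: g'_def)
    ultimately have "\<bar>g x - \<phi> x\<bar> \<le> 4 * \<eta>" by linarith
    then show ?thesis using True by (simp add: h_def \<eta>_def)
  qed
  ultimately show ?thesis using that by blast
qed

section \<open>Equality of the two closures, and the theorem\<close>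

lemma Cc_bounded:
  fixes g :: "real ^ 'n \<Rightarrow> real"
  assumes g: "g \<in> Cc \<Omega>"
  shows "\<exists>M. \<forall>x\<in>\<Omega>. \<bar>g x\<bar> \<le> M"
proof -
  have "compact (g ` supp \<Omega> g)"
    using g by (intro compact_continuous_image) (auto simp: Cc_def intro: continuous_on_subset)
  then obtain M where M: "\<And>x. x \<in> supp \<Omega> g \<Longrightarrow> \<bar>g x\<bar> \<le> M"
    using compact_imp_bounded by (fastforce simp: bounded_iff)
  have "\<bar>g x\<bar> \<le> max M 0" if "x \<in> \<Omega>" for x
    using M[of x] supp_zero[OF that, of g] by fastforce
  then show ?thesis by blast
qed

lemma Cc_in_bmo_space:
  assumes "g \<in> Cc \<Omega>"
  shows "g \<in> bmo_space \<rho> \<Omega>"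
proof -
  obtain M where "\<And>x. x \<in> \<Omega> \<Longrightarrow> \<bar>g x\<bar> \<le> M" using Cc_bounded[OF assms] by blast
  then show ?thesis using assms by (intro bounded_continuous_in_bmo_space) (auto simp: Cc_def)
qed

lemma Cc_infinity_subset: "Cc_infinity \<Omega> \<subseteq> Cc \<Omega>"
  by (auto simp: Cc_infinity_def Cc_def dest: spec[of _ 0])

text \<open>Uniform approximation within \<open>\<eta> / 4\<close> costs
  \<open>3 * (\<eta> / 4)\<close> in norm, on top of the \<open>\<eta> / 4\<close> for the
  continuous approximant.\<close>

lemma bmo_closure_Cc_infinity:
  assumes op: "open (\<Omega> :: (real ^ 'n) set)"
  shows "bmo_closure \<rho> \<Omega> (Cc_infinity \<Omega>) = bmo_closure \<rho> \<Omega> (Cc \<Omega>)"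
proof
  show "bmo_closure \<rho> \<Omega> (Cc_infinity \<Omega>) \<subseteq> bmo_closure \<rho> \<Omega> (Cc \<Omega>)"
    using Cc_infinity_subset[of \<Omega>] unfolding bmo_closure_def by blast
  show "bmo_closure \<rho> \<Omega> (Cc \<Omega>) \<subseteq> bmo_closure \<rho> \<Omega> (Cc_infinity \<Omega>)"
  proof
    fix f assume f: "f \<in> bmo_closure \<rho> \<Omega> (Cc \<Omega>)"
    then have fs: "f \<in> bmo_space \<rho> \<Omega>" by (simp add: bmo_closure_def)
    have "\<exists>h \<in> Cc_infinity \<Omega> \<inter> bmo_space \<rho> \<Omega>. bmo_norm \<rho> \<Omega> (\<lambda>x. f x - h x) < ennreal \<eta>" if eta: "0 < \<eta>" for \<eta> :: real
    proof -
      obtain g where g: "g \<in> Cc \<Omega>" "bmo_norm \<rho> \<Omega> (\<lambda>x. f x - g x) < ennreal (\<eta> / 4)"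
        using f eta unfolding bmo_closure_def by (auto dest!: spec[of _ "\<eta> / 4"])
      obtain h where h: "h \<in> Cc_infinity \<Omega>" "\<And>x. x \<in> \<Omega> \<Longrightarrow> \<bar>g x - h x\<bar> \<le> \<eta> / 4"
        using Cc_infinity_approximation[OF g(1) op, of "\<eta> / 4"] eta by auto
      have hc: "h \<in> Cc \<Omega>" using h Cc_infinity_subset by blast
      have "bmo_norm \<rho> \<Omega> (\<lambda>x. f x - h x) < ennreal (\<eta> / 4 + 3 * (\<eta> / 4))"
        using fs g hc h(2) eta
            by (intro bounded_continuous_dist[of \<Omega> f g h]) (auto simp: Cc_def bmo_space_iff)
      then show ?thesis using h(1) Cc_in_bmo_space[OF hc] by auto
    qed
    then show "f \<in> bmo_closure \<rho> \<Omega> (Cc_infinity \<Omega>)" using fs by (simp add: bmo_closure_def)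
  qed
qed

theorem proposition4:
  fixes \<Omega> :: "(real ^ 'n) set" and f :: "real ^ 'n \<Rightarrow> real" and \<epsilon> \<delta> \<rho> :: real
  assumes "0 < \<epsilon>" "\<epsilon> \<le> 1" "0 < \<delta>"
    and "eps_delta_domain \<epsilon> \<delta> \<Omega>"
    and "\<rho> = scale_param CARD('n) \<epsilon> \<delta>"
    and "f \<in> bmo_space \<rho> \<Omega>"
  shows "(f \<in> bmo_closure \<rho> \<Omega> (Lip_away \<Omega>) \<longleftrightarrow> (osc \<Omega> f \<longlongrightarrow> 0) (at_right 0)) \<and>
    (f \<in> cmo \<rho> \<Omega> \<longleftrightarrow> f \<in> bmo_closure \<rho> \<Omega> (Cc_infinity \<Omega>)) \<and>
    (f \<in> bmo_closure \<rho> \<Omega> (Cc_infinity \<Omega>) \<longleftrightarrow>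
       vanishes_at_infinity \<rho> \<Omega> f \<and> (osc \<Omega> f \<longlongrightarrow> 0) (at_right 0))"
proof (cases "\<Omega> = {}")
  \<comment> \<open>The empty set counts as connected. It contains no cube, so every norm is zero
    and the zero function approximates \<open>f\<close>; the construction itself requires a point of
    \<Omega>.\<close>
  case True
  have zero: "(\<lambda>_. 0) \<in> Lip_away \<Omega>" "(\<lambda>_. 0) \<in> Cc \<Omega>" 
    using True by (auto simp: Lip_away_def Cc_def edist_def supp_def support_on_def intro: exI[of _ 0])
  have n: "bmo_norm \<rho> \<Omega> g \<le> 0" for g
    using bmo_norm_le_bound[of \<Omega> g 0 \<rho>] True centre_in_cub by (force simp: subset_empty)
  have "f \<in> bmo_closure \<rho> \<Omega> A" if "(\<lambda>_. 0) \<in> A \<inter> bmo_space \<rho> \<Omega>" for A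
    using that n[of "\<lambda>x. f x - 0"] assms(6) unfolding bmo_closure_def by force
  then have in_closure: "f \<in> bmo_closure \<rho> \<Omega> (Lip_away \<Omega>)" "f \<in> bmo_closure \<rho> \<Omega> (Cc \<Omega>)"
    using zero Lip_away_in_bmo_space Cc_in_bmo_space by blast+
  moreover have "(osc \<Omega> f \<longlongrightarrow> 0) (at_right 0)"
    using osc_bmo_closure[OF in_closure(2)] scale_param_bounds(1)[OF assms(1-3), where 'n='n] assms(5)
      osc_uniformly_continuous Cc_uniformly_continuous True by blast
  moreover have "open \<Omega>" using True by simp
  ultimately show ?thesis
    using bmo_closure_Cc_infinity[of \<Omega> \<rho>] vanishes_at_infinity_bmo_closure[of f \<rho> \<Omega>]
    unfolding cmo_def by blast
next
  case False
  have op: "open \<Omega>" using assms(4) by (simp add: eps_delta_domain_def domain_def)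
  have rho: "0 < \<rho>" using scale_param_bounds(1)[OF assms(1-3), where 'n='n] assms(5) by simp
  have 1: "(osc \<Omega> f \<longlongrightarrow> 0) (at_right 0)" if "f \<in> bmo_closure \<rho> \<Omega> (Lip_away \<Omega>)"
    using that rho by (rule osc_bmo_closure)
      (auto simp: Lip_away_def intro: osc_uniformly_continuous lipschitz_on_uniformly_continuous)
  have 2: "f \<in> bmo_closure \<rho> \<Omega> (Lip_away \<Omega>)" if "(osc \<Omega> f \<longlongrightarrow> 0) (at_right 0)"
  proof -
    have "\<exists>g \<in> Lip_away \<Omega> \<inter> bmo_space \<rho> \<Omega>. bmo_norm \<rho> \<Omega> (\<lambda>x. f x - g x) < ennreal \<eta>" if eta: "0 < \<eta>" for \<eta>
    proof -
      obtain g where "g \<in> Lip_away \<Omega>" "bmo_norm \<rho> \<Omega> (\<lambda>x. f x - g x) < ennreal \<eta>"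
        by (rule Lip_away_approximation[OF assms \<open>(osc \<Omega> f \<longlongrightarrow> 0) (at_right 0)\<close> False eta])
      then show ?thesis using Lip_away_in_bmo_space by blast
    qed
    then show ?thesis using assms(6) by (simp add: bmo_closure_def)
  qed
  have 3: "(osc \<Omega> f \<longlongrightarrow> 0) (at_right 0)" if "f \<in> bmo_closure \<rho> \<Omega> (Cc \<Omega>)"
    using that rho by (rule osc_bmo_closure) (use op osc_uniformly_continuous Cc_uniformly_continuous in blast)
  have 4: "f \<in> bmo_closure \<rho> \<Omega> (Cc \<Omega>)" if "(osc \<Omega> f \<longlongrightarrow> 0) (at_right 0)" "vanishes_at_infinity \<rho> \<Omega> f"
  proof -
    have "\<exists>g \<in> Cc \<Omega> \<inter> bmo_space \<rho> \<Omega>. bmo_norm \<rho> \<Omega> (\<lambda>x. f x - g x) < ennreal \<eta>" if eta: "0 < \<eta>" for \<eta>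
    proof -
      obtain g where "g \<in> Cc \<Omega>" "bmo_norm \<rho> \<Omega> (\<lambda>x. f x - g x) < ennreal \<eta>"
        by (rule Cc_approximation[OF assms \<open>(osc \<Omega> f \<longlongrightarrow> 0) (at_right 0)\<close> False eta
            \<open>vanishes_at_infinity \<rho> \<Omega> f\<close>])
      then show ?thesis using Cc_in_bmo_space by blast
    qed
    then show ?thesis using assms(6) by (simp add: bmo_closure_def)
  qed
  show ?thesis
    unfolding cmo_def bmo_closure_Cc_infinity[OF op]
    using 1 2 3 4 vanishes_at_infinity_bmo_closure[of f \<rho> \<Omega>] by blast
qed

end
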